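(* Let $\Delta$ be an $n$-dimensional ($n\ge1$), compact, convex polytope (in $K^n$) such that every three-dimensional face of $\Delta$ is a pyramid. If every vertex of $\Delta$ (or, equivalently, every two-dimensional face of $\Delta$) may be cleaned, in the sense of the cleaning process defined in the context, then $D^2(\Delta)=0$.
   Context: $K$ is a field with $\mathbb{Q}\subseteq K\subseteq\mathbb{R}$; polytopes are compact convex polytopes in finite-dimensional $K$-vector spaces. A pyramid is the convex hull of a polygon and a point outside its plane (tetrahedra are pyramids). Cleaning process for an $n$-dimensional polytope $\Delta$. At the beginning all vertices and all two-dimensional faces of $\Delta$ are contaminated (not clean). One may repeatedly apply the following rules in arbitrary order: (i) a two-dimensional face which is an $m$-gon is declared clean if at least $m-3$ of its vertices are clean (so every triangle is automatically clean); (ii) a vertex of $\Delta$ is declared clean if it is contained in no more than $n-3$ two-dimensional faces that are not clean yet. A vertex or two-dimensional face may be cleaned if it becomes clean after finitely many applications of these rules. Definition of $D^k$. A cohomological system $\mathcal F$ on a finite fan $\Sigma$ is a covariant functor from $\Sigma$ (morphisms: face relations $\tau\le\sigma$) to $K$-vector spaces. Fix an orientation of each cone; for a facet $\tau$ of $\sigma$ let $\varepsilon(\tau,\sigma)=\pm1$ compare the orientation of $\tau$ with the one induced from $\sigma$. Put $C^k(\Sigma,\mathcal F)=\bigoplus_{\sigma\in\Sigma,\dim\sigma=k}\mathcal F(\sigma)$, with differential $C^k\to C^{k+1}$ built from the maps $\varepsilon(\tau,\sigma)\cdot(\mathcal F(\tau)\to\mathcal F(\sigma))$, and let $H^k(\Sigma,\mathcal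 F)$ be its cohomology. For a polytope $P\subseteq K^m$ let $\mathrm{cone}(P)\subseteq K^{m+1}$ be the cone over $P\times\{1\}$, and $\underline{\mathrm{cone}}(P)$ the fan of all its faces (including $\{0\}$ and $\mathrm{cone}(P)$ itself). Then $D^k(P):=H^{k+1}(\underline{\mathrm{cone}}(P),\mathrm{span})$, where $\mathrm{span}$ sends a cone to its linear span, with inclusions as maps. For non-empty $P$ this equals $H^k(\underline{\mathrm{cone}}(P),K^{m+1}/\mathrm{span})$.
   Formalization: The equivalence of "every vertex" and "every two-dimensional face may be cleaned" is stated only for n ≥ 3, since it fails for a segment (n=1) and a triangle (n=2), where no vertex can be cleaned; D²(Δ)=0 is proved for all n ≥ 1 under either condition. *)

theory Defs
  imports
    "HOL-Analysis.Cartesian_Space"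
    "Jordan_Normal_Form.Determinant"
begin

text \<open>
  The ground field \<open>K\<close> with \<open>\<rat> \<subseteq> K \<subseteq> \<real>\<close> is a type \<open>'k\<close> of class \<open>linordered_field\<close> together
  with an embedding into the reals that respects the order.
\<close>

no_notation vec_index (infixl "$" 100)

definition real_subfield_embedding :: "('k::linordered_field \<Rightarrow> real) \<Rightarrow> bool" where
  "real_subfield_embedding \<iota> \<longleftrightarrow>
     \<iota> 1 = 1 \<and>
     (\<forall>x y. \<iota> (x + y) = \<iota> x + \<iota> y) \<and>
     (\<forall>x y. \<iota> (x * y) = \<iota> x * \<iota> y) \<and>
     (\<forall>x y. \<iota> x \<le> \<iota> y \<longleftrightarrow> x \<le> y)"


section \<open>Polytopes over an ordered field\<close>

text \<open>
  The library notions of convexity are restricted to real vector spaces, so they are stated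
  here for \<open>'k ^ 'n\<close>.
\<close>

definition kconvex_hull :: "('k::linordered_field ^ 'n::finite) set \<Rightarrow> ('k ^ 'n) set" where
  "kconvex_hull S = {(\<Sum>v\<in>T. c v *s v) | T c.
     finite T \<and> T \<subseteq> S \<and> (\<forall>v\<in>T. 0 \<le> c v) \<and> sum c T = 1}"

definition kaffine_hull :: "('k::linordered_field ^ 'n::finite) set \<Rightarrow> ('k ^ 'n) set" where
  "kaffine_hull S = {(\<Sum>v\<in>T. c v *s v) | T c. finite T \<and> T \<subseteq> S \<and> sum c T = 1}"

definition kpolytope :: "('k::linordered_field ^ 'n::finite) set \<Rightarrow> bool" where
  "kpolytope P \<longleftrightarrow> (\<exists>S. finite S \<and> P = kconvex_hull S)"

text \<open>Affine dimension; only meaningful for non-empty sets (the empty set gets 0).\<close>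

definition kdim :: "('k::linordered_field ^ 'n::finite) set \<Rightarrow> nat" where
  "kdim P = vec.dim {x - y | x y. x \<in> P \<and> y \<in> P}"

text \<open>Faces are cut out by supporting hyperplanes; \<open>P\<close> itself is the case of \<open>f = 0\<close>, \<open>b = 0\<close>.\<close>

definition kface_of :: "('k::linordered_field ^ 'n::finite) set \<Rightarrow> ('k ^ 'n) set \<Rightarrow> bool" where
  "kface_of F P \<longleftrightarrow> (\<exists>f b. Vector_Spaces.linear (*s) (*) f \<and>
     (\<forall>x\<in>P. f x \<le> b) \<and> F = {x \<in> P. f x = b})"

definition kfaces :: "nat \<Rightarrow> ('k::linordered_field ^ 'n::finite) set \<Rightarrow> ('k ^ 'n) set set" where
  "kfaces d P = {F. kface_of F P \<and> F \<noteq> {} \<and> kdim F = d}"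

definition kvertices :: "('k::linordered_field ^ 'n::finite) set \<Rightarrow> ('k ^ 'n) set" where
  "kvertices P = {v. kface_of {v} P}"

definition kpyramid :: "('k::linordered_field ^ 'n::finite) set \<Rightarrow> bool" where
  "kpyramid P \<longleftrightarrow> (\<exists>B a. kpolytope B \<and> kdim B = 2 \<and> a \<notin> kaffine_hull B \<and>
     P = kconvex_hull (insert a B))"


section \<open>The cleaning process\<close>

text \<open>
  A state is the pair of the set of clean vertices and the set of clean two-dimensional faces.
  The bounds \<open>m - 3\<close> and \<open>n - 3\<close> are moved to the other side, since subtraction on \<open>nat\<close> truncates.
\<close>

inductive clean_step ::
  "('k::linordered_field ^ 'n::finite) set \<Rightarrow>
   ('k ^ 'n) set \<times> ('k ^ 'n) set set \<Rightarrow> ('k ^ 'n) set \<times> ('k ^ 'n) set set \<Rightarrow> bool"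
  for P where
  clean_face:
    "F \<in> kfaces 2 P \<Longrightarrow> card (kvertices F) \<le> card (kvertices F \<inter> V) + 3
     \<Longrightarrow> clean_step P (V, C) (V, insert F C)"
| clean_vertex:
    "v \<in> kvertices P \<Longrightarrow> card {F \<in> kfaces 2 P. v \<in> F \<and> F \<notin> C} + 3 \<le> kdim P
     \<Longrightarrow> clean_step P (V, C) (insert v V, C)"

definition vertex_may_be_cleaned ::
  "('k::linordered_field ^ 'n::finite) set \<Rightarrow> 'k ^ 'n \<Rightarrow> bool" where
  "vertex_may_be_cleaned P v \<longleftrightarrow> (\<exists>V C. (clean_step P)\<^sup>*\<^sup>* ({}, {}) (V, C) \<and> v \<in> V)"

definition face_may_be_cleaned ::
  "('k::linordered_field ^ 'n::finite) set \<Rightarrow> ('k ^ 'n) set \<Rightarrow> bool" where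
  "face_may_be_cleaned P F \<longleftrightarrow> (\<exists>V C. (clean_step P)\<^sup>*\<^sup>* ({}, {}) (V, C) \<and> F \<in> C)"


section \<open>Cones, fans and orientations\<close>

text \<open>\<open>K\<^sup>m\<^sup>+\<^sup>1\<close> is \<open>'k ^ 'm option\<close>, with \<open>None\<close> as the index of the additional coordinate.\<close>

definition height_one :: "'k::linordered_field ^ 'm::finite \<Rightarrow> 'k ^ 'm option" where
  "height_one x = (\<chi> i. case i of None \<Rightarrow> 1 | Some j \<Rightarrow> x $ j)"

definition cone_over ::
  "('k::linordered_field ^ 'm::finite) set \<Rightarrow> ('k ^ 'm option) set" where
  "cone_over P = insert 0 {t *s height_one x | t x. 0 \<le> t \<and> x \<in> P}"

definition cone_face_of ::
  "('k::linordered_field ^ 'm::finite) set \<Rightarrow> ('k ^ 'm) set \<Rightarrow> bool" where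
  "cone_face_of \<tau> \<sigma> \<longleftrightarrow> (\<exists>f. Vector_Spaces.linear (*s) (*) f \<and>
     (\<forall>x\<in>\<sigma>. 0 \<le> f x) \<and> \<tau> = {x \<in> \<sigma>. f x = 0})"

definition face_fan ::
  "('k::linordered_field ^ 'm::finite) set \<Rightarrow> ('k ^ 'm) set set" where
  "face_fan \<sigma> = {\<tau>. cone_face_of \<tau> \<sigma>}"

definition cone_facet_of ::
  "('k::linordered_field ^ 'm::finite) set \<Rightarrow> ('k ^ 'm) set \<Rightarrow> bool" where
  "cone_facet_of \<tau> \<sigma> \<longleftrightarrow> cone_face_of \<tau> \<sigma> \<and> vec.dim \<sigma> = vec.dim \<tau> + 1"

text \<open>An orientation of a cone is represented by an ordered basis of its linear span.\<close>

definition orients ::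
  "('k::linordered_field ^ 'm::finite) list \<Rightarrow> ('k ^ 'm) set \<Rightarrow> bool" where
  "orients b \<sigma> \<longleftrightarrow> distinct b \<and> vec.independent (set b) \<and> vec.span (set b) = vec.span \<sigma>"

text \<open>The sign of the determinant of the coordinates of \<open>c\<close> with respect to the ordered basis \<open>b\<close>.\<close>

definition orientation_sign ::
  "('k::linordered_field ^ 'm::finite) list \<Rightarrow> ('k ^ 'm) list \<Rightarrow> 'k" where
  "orientation_sign b c = sgn (Determinant.det (Matrix.mat (length b) (length b)
     (\<lambda>(i, j). vec.representation (set b) (c ! i) (b ! j))))"

text \<open>
  A basis of \<open>span \<tau>\<close> is positive for the orientation induced from \<open>\<sigma>\<close> if it becomes a positive
  basis of \<open>span \<sigma>\<close> after putting a vector in front that points out of \<open>\<sigma>\<close>. Each \<open>u \<in> \<sigma> - \<tau>\<close>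
  points into \<open>\<sigma>\<close>, so \<open>- u\<close> is such a vector, and the sign does not depend on \<open>u\<close>.
\<close>

definition incidence_sign ::
  "(('k::linordered_field ^ 'm::finite) set \<Rightarrow> ('k ^ 'm) list) \<Rightarrow>
   ('k ^ 'm) set \<Rightarrow> ('k ^ 'm) set \<Rightarrow> 'k" where
  "incidence_sign ori \<tau> \<sigma> = orientation_sign (ori \<sigma>) (- (SOME u. u \<in> \<sigma> - \<tau>) # ori \<tau>)"


section \<open>Cohomology of a cohomological system\<close>

text \<open>
  A cohomological system on a fan is given by subspaces \<open>A \<sigma>\<close> of a common space \<open>'k ^ 'd\<close> and
  maps \<open>\<phi> \<tau> \<sigma> : A \<tau> \<rightarrow> A \<sigma>\<close>. Elements of the direct sum over the cones of dimension \<open>k\<close> are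
  families that vanish at all other sets.
\<close>

definition cochains ::
  "('k::linordered_field ^ 'm::finite) set set \<Rightarrow> (('k ^ 'm) set \<Rightarrow> ('k ^ 'd::finite) set) \<Rightarrow>
   nat \<Rightarrow> (('k ^ 'm) set \<Rightarrow> 'k ^ 'd) set" where
  "cochains \<Sigma> A k = {c. \<forall>\<sigma>. if \<sigma> \<in> \<Sigma> \<and> vec.dim \<sigma> = k then c \<sigma> \<in> A \<sigma> else c \<sigma> = 0}"

definition cochain_diff ::
  "(('k::linordered_field ^ 'm::finite) set \<Rightarrow> ('k ^ 'm) list) \<Rightarrow> ('k ^ 'm) set set \<Rightarrow>
   (('k ^ 'm) set \<Rightarrow> ('k ^ 'm) set \<Rightarrow> 'k ^ 'd::finite \<Rightarrow> 'k ^ 'd) \<Rightarrow> nat \<Rightarrow>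
   (('k ^ 'm) set \<Rightarrow> 'k ^ 'd) \<Rightarrow> (('k ^ 'm) set \<Rightarrow> 'k ^ 'd)" where
  "cochain_diff ori \<Sigma> \<phi> k c = (\<lambda>\<sigma>.
     if \<sigma> \<in> \<Sigma> \<and> vec.dim \<sigma> = k + 1
     then \<Sum>\<tau> | \<tau> \<in> \<Sigma> \<and> cone_facet_of \<tau> \<sigma>. incidence_sign ori \<tau> \<sigma> *s \<phi> \<tau> \<sigma> (c \<tau>)
     else 0)"

definition cocycles ::
  "(('k::linordered_field ^ 'm::finite) set \<Rightarrow> ('k ^ 'm) list) \<Rightarrow> ('k ^ 'm) set set \<Rightarrow>
   (('k ^ 'm) set \<Rightarrow> ('k ^ 'd::finite) set) \<Rightarrow>
   (('k ^ 'm) set \<Rightarrow> ('k ^ 'm) set \<Rightarrow> 'k ^ 'd \<Rightarrow> 'k ^ 'd) \<Rightarrow> nat \<Rightarrow>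
   (('k ^ 'm) set \<Rightarrow> 'k ^ 'd) set" where
  "cocycles ori \<Sigma> A \<phi> k = {c \<in> cochains \<Sigma> A k. cochain_diff ori \<Sigma> \<phi> k c = (\<lambda>_. 0)}"

definition coboundaries ::
  "(('k::linordered_field ^ 'm::finite) set \<Rightarrow> ('k ^ 'm) list) \<Rightarrow> ('k ^ 'm) set set \<Rightarrow>
   (('k ^ 'm) set \<Rightarrow> ('k ^ 'd::finite) set) \<Rightarrow>
   (('k ^ 'm) set \<Rightarrow> ('k ^ 'm) set \<Rightarrow> 'k ^ 'd \<Rightarrow> 'k ^ 'd) \<Rightarrow> nat \<Rightarrow>
   (('k ^ 'm) set \<Rightarrow> 'k ^ 'd) set" where
  "coboundaries ori \<Sigma> A \<phi> k = (case k of
     0 \<Rightarrow> {\<lambda>_. 0}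
   | Suc j \<Rightarrow> cochain_diff ori \<Sigma> \<phi> j ` cochains \<Sigma> A j)"

definition cohomology_class ::
  "(('k::linordered_field ^ 'm::finite) set \<Rightarrow> ('k ^ 'm) list) \<Rightarrow> ('k ^ 'm) set set \<Rightarrow>
   (('k ^ 'm) set \<Rightarrow> ('k ^ 'd::finite) set) \<Rightarrow>
   (('k ^ 'm) set \<Rightarrow> ('k ^ 'm) set \<Rightarrow> 'k ^ 'd \<Rightarrow> 'k ^ 'd) \<Rightarrow> nat \<Rightarrow>
   (('k ^ 'm) set \<Rightarrow> 'k ^ 'd) \<Rightarrow> (('k ^ 'm) set \<Rightarrow> 'k ^ 'd) set" where
  "cohomology_class ori \<Sigma> A \<phi> k c = {(\<lambda>\<sigma>. c \<sigma> + b \<sigma>) | b. b \<in> coboundaries ori \<Sigma> A \<phi> k}"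

definition cohomology ::
  "(('k::linordered_field ^ 'm::finite) set \<Rightarrow> ('k ^ 'm) list) \<Rightarrow> ('k ^ 'm) set set \<Rightarrow>
   (('k ^ 'm) set \<Rightarrow> ('k ^ 'd::finite) set) \<Rightarrow>
   (('k ^ 'm) set \<Rightarrow> ('k ^ 'm) set \<Rightarrow> 'k ^ 'd \<Rightarrow> 'k ^ 'd) \<Rightarrow> nat \<Rightarrow>
   (('k ^ 'm) set \<Rightarrow> 'k ^ 'd) set set" where
  "cohomology ori \<Sigma> A \<phi> k = cohomology_class ori \<Sigma> A \<phi> k ` cocycles ori \<Sigma> A \<phi> k"


section \<open>The spaces \<open>D\<^sup>k\<close>\<close>

definition D_class ::
  "(('k::linordered_field ^ 'm::finite option) set \<Rightarrow> ('k ^ 'm option) list) \<Rightarrow> nat \<Rightarrow>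
   ('k ^ 'm) set \<Rightarrow> (('k ^ 'm option) set \<Rightarrow> 'k ^ 'm option) \<Rightarrow>
   (('k ^ 'm option) set \<Rightarrow> 'k ^ 'm option) set" where
  "D_class ori k P = cohomology_class ori (face_fan (cone_over P)) vec.span (\<lambda>\<tau> \<sigma> x. x) (k + 1)"

definition D_space ::
  "(('k::linordered_field ^ 'm::finite option) set \<Rightarrow> ('k ^ 'm option) list) \<Rightarrow> nat \<Rightarrow>
   ('k ^ 'm) set \<Rightarrow> (('k ^ 'm option) set \<Rightarrow> 'k ^ 'm option) set set" where
  "D_space ori k P = cohomology ori (face_fan (cone_over P)) vec.span (\<lambda>\<tau> \<sigma> x. x) (k + 1)"

end

(*
  D^2 vanishes when every 3-cochain c of the span system that is closed on the cones over the
  three-dimensional faces P is a coboundary. On a pyramid P this can be solved, by projecting along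
  the apex. Expanding a solution along the rays r of each edge gives coefficients X P r F with
  c F = sum_r X P r F * r which, at every vertex r of P, form a cocycle on the polygons F of P through r.

  A vertex r is unobstructed in F if X P r F does not depend on the P containing F. If all but three
  vertices of F are unobstructed, then so are these three, because distinct rays r1, r2, r3 of a
  cone are linearly independent. At a vertex r no P contains two obstructed polygons (only the base
  of P is not a triangle). If F is obstructed at r, the coefficients X P r F form a 0-cochain on the
  quotient by F whose coboundary z lives on the 4-faces R containing F. Closedness at r kills z R
  unless R contains another obstructed polygon. But z is itself closed, so a nonzero z R forces
  another nonzero value on each of the at least n - 4 5-faces containing R: too many for the n - 3
  polygons that rule (ii) tolerates.

  Once X P r F is independent of P, it is a cocycle on the star of each vertex r, hence a coboundary
  there, and the potentials assemble to an edge cochain with coboundary c. The exactness of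
  stars of faces with constant coefficients is proved by sweeping with a linear functional.
*)
theory Submission imports Defs begin


section \<open>Linear functionals\<close>

text \<open>Cones have one dimension more than the faces of the polytope: polygons are cones of
  dimension 3, pyramids of dimension 4, and \<open>z\<close> lives in dimension 5 of a cone of
  dimension n + 1. The obstacle is that more than three rays of a polygon are dependent, so the
  coefficients \<open>X P r F\<close> may change with \<open>P\<close> and solutions on different
  pyramids need not glue. Both thresholds measure this. The 3 of rule (i) is the number of rays that
  are always independent. For rule (ii), let N be the number of 4-faces R with z R nonzero. Two such
  R sharing an obstructed polygon other than F would meet in a pyramid with two obstructed polygons;
  hence N is at most the number of obstructed polygons other than F, that is n - 4. Conversely, the
  values forced on different 5-faces over R are different ones, since two of these 5-faces meet only
  in R; hence N is at least 1 + (n - 4).\<close>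

abbreviation klinear :: "('k::field ^ 'm::finite \<Rightarrow> 'k) \<Rightarrow> bool" where
  "klinear f \<equiv> Vector_Spaces.linear (*s) (*) f"

lemma klinearI:
  fixes f :: "'k::field ^ 'm::finite \<Rightarrow> 'k"
  assumes "\<And>x y. f (x + y) = f x + f y" "\<And>c x. f (c *s x) = c * f x"
  shows "klinear f"
  using assms vec.vector_space_axioms vector_space_over_itself.vector_space_axioms
  by (auto simp: Vector_Spaces.linear_iff)

lemma
  fixes f :: "'k::field ^ 'm::finite \<Rightarrow> 'k"
  assumes "klinear f"
  shows klinear_add: "f (x + y) = f x + f y"
    and klinear_scale: "f (c *s x) = c * f x"
    and klinear_zero: "f 0 = 0"
    and klinear_uminus: "f (- x) = - f x"
    and klinear_diff: "f (x - y) = f x - f y"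
    and klinear_sum: "f (\<Sum>i\<in>A. g i) = (\<Sum>i\<in>A. f (g i))"
proof -
  show *: "f (x + y) = f x + f y" "f (c *s x) = c * f x" for x y c
    using assms by (auto simp: Vector_Spaces.linear_iff)
  show 0: "f 0 = 0"
    using *(2)[of 0 0] by simp
  show "f (- x) = - f x" for x
    using *(2)[of "-1" x] by simp
  then show "f (x - y) = f x - f y"
    using *(1)[of x "- y"] by simp
  show "f (\<Sum>i\<in>A. g i) = (\<Sum>i\<in>A. f (g i))"
    by (induction A rule: infinite_finite_induct) (auto simp: 0 *)
qed

lemmas klinear_simps = klinear_add klinear_scale klinear_zero klinear_uminus klinear_diff klinear_sum

lemma klinear_combination:
  fixes f g :: "'k::field ^ 'm::finite \<Rightarrow> 'k"
  assumes "klinear f" "klinear g"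
  shows "klinear (\<lambda>x. a * f x + b * g x)"
  by (rule klinearI) (auto simp: klinear_simps[OF assms(1)] klinear_simps[OF assms(2)] algebra_simps)

lemma klinear_minus:
  fixes f :: "'k::field ^ 'm::finite \<Rightarrow> 'k"
  assumes "klinear f"
  shows "klinear (\<lambda>x. - f x)"
  using klinear_combination[OF assms assms, of "-1" 0] by simp

lemma klinear_const_zero: "klinear (\<lambda>x :: 'k::field ^ 'm::finite. 0)"
  by (rule klinearI) auto

lemma klinear_vanishes_span:
  fixes f :: "'k::field ^ 'm::finite \<Rightarrow> 'k"
  assumes "klinear f" "\<And>x. x \<in> A \<Longrightarrow> f x = 0" "x \<in> vec.span A"
  shows "f x = 0"
proof -
  have "vec.subspace {x. f x = 0}"
    by (auto simp: vec.subspace_def klinear_simps[OF assms(1)])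
  then show ?thesis
    using vec.span_minimal[of A "{x. f x = 0}"] assms(2,3) by blast
qed

text \<open>The functional is the coordinate along \<open>x\<close> in a basis that extends
  \<open>x\<close> and a basis of \<open>vec.span A\<close>.\<close>

lemma exists_separating_klinear:
  fixes x :: "'k::field ^ 'm::finite"
  assumes "x \<notin> vec.span A"
  obtains f where "klinear f" "\<forall>y\<in>vec.span A. f y = 0" "f x = 1"
proof -
  obtain B where B: "B \<subseteq> vec.span A" "vec.independent B" "vec.span A \<subseteq> vec.span B"
    using vec.basis_exists[of "vec.span A"] by metis
  have "x \<notin> vec.span B"
    using assms B(1) vec.span_mono[of B "vec.span A"] by (auto simp: vec.span_span)
  then have ind: "vec.independent (insert x B)" "x \<notin> B"
    using B(2) by (auto simp: vec.independent_insert vec.span_base)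
  obtain C where C: "insert x B \<subseteq> C" "vec.independent C" "UNIV \<subseteq> vec.span C"
    using vec.maximal_independent_subset_extend[OF subset_UNIV ind(1)] by metis
  have spC: "v \<in> vec.span C" for v
    using C(3) by auto
  define f where "f = (\<lambda>v. vec.representation C v x)"
  have lin: "klinear f"
    by (rule klinearI)
       (auto simp: f_def vec.representation_add[OF C(2) spC spC]
          vec.representation_scale[OF C(2) spC])
  have 1: "f y = 0" if "y \<in> vec.span A" for y
  proof (rule klinear_vanishes_span[OF lin])
    show "y \<in> vec.span B" using that B(3) by blast
    show "f b = 0" if "b \<in> B" for b
      using that C(1) ind(2) by (auto simp: f_def vec.representation_basis[OF C(2)])
  qed
  have "f x = 1"
    using C(1) by (auto simp: f_def vec.representation_basis[OF C(2)])
  then show ?thesis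
    using that lin 1 by blast
qed

section \<open>Finitely generated cones and their faces\<close>

text \<open>Coefficients are indexed by all of \<open>S\<close>, so this is the generated cone for
  finite \<open>S\<close> only; a sum over an infinite set is 0.\<close>

definition conic :: "('k::linordered_field ^ 'm::finite) set \<Rightarrow> ('k ^ 'm) set" where
  "conic S = {(\<Sum>s\<in>S. c s *s s) | c. \<forall>s\<in>S. 0 \<le> c s}"

definition fg_cone :: "('k::linordered_field ^ 'm::finite) set \<Rightarrow> bool" where
  "fg_cone \<sigma> \<longleftrightarrow> (\<exists>S. finite S \<and> \<sigma> = conic S)"

lemma conic_base:
  assumes "finite S" "s \<in> S"
  shows "s \<in> conic S"
proof -
  have "s = (\<Sum>t\<in>S. (if t = s then 1 else 0) *s t)"
    using assms by (simp add: if_distrib[of "\<lambda>c. c *s _"] sum.delta' cong: if_cong)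
  then show ?thesis
    unfolding conic_def by (auto intro!: exI[of _ "\<lambda>t. if t = s then 1 else 0"])
qed

lemma conic_zero: "0 \<in> conic S"
  unfolding conic_def by (auto intro!: exI[of _ "\<lambda>_. 0"])

lemma conic_add:
  assumes "x \<in> conic S" "y \<in> conic S"
  shows "x + y \<in> conic S"
proof -
  obtain a b where "x = (\<Sum>s\<in>S. a s *s s)" "\<forall>s\<in>S. 0 \<le> a s"
    "y = (\<Sum>s\<in>S. b s *s s)" "\<forall>s\<in>S. 0 \<le> b s"
    using assms by (auto simp: conic_def)
  then show ?thesis
    unfolding conic_def
    by (auto intro!: exI[of _ "\<lambda>s. a s + b s"] simp: sum.distrib vec.scale_left_distrib)
qed

lemma conic_scale:
  assumes "x \<in> conic S" "0 \<le> t"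
  shows "t *s x \<in> conic S"
proof -
  obtain a where "x = (\<Sum>s\<in>S. a s *s s)" "\<forall>s\<in>S. 0 \<le> a s"
    using assms by (auto simp: conic_def)
  then show ?thesis
    unfolding conic_def using assms(2)
    by (auto intro!: exI[of _ "\<lambda>s. t * a s"] simp: vec.scale_sum_right)
qed

lemma fg_cone_zero: "fg_cone \<sigma> \<Longrightarrow> 0 \<in> \<sigma>"
  and fg_cone_add: "fg_cone \<sigma> \<Longrightarrow> x \<in> \<sigma> \<Longrightarrow> y \<in> \<sigma> \<Longrightarrow> x + y \<in> \<sigma>"
  and fg_cone_scale: "fg_cone \<sigma> \<Longrightarrow> x \<in> \<sigma> \<Longrightarrow> 0 \<le> t \<Longrightarrow> t *s x \<in> \<sigma>"
  by (auto simp: fg_cone_def conic_zero conic_add conic_scale)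

lemma klinear_conic_nonneg:
  fixes f :: "'k::linordered_field ^ 'm::finite \<Rightarrow> 'k"
  assumes "klinear f" "\<And>s. s \<in> S \<Longrightarrow> 0 \<le> f s" "x \<in> conic S"
  shows "0 \<le> f x"
  using assms(2,3) by (auto simp: conic_def klinear_simps[OF assms(1)] intro!: sum_nonneg)

text \<open>A sum of nonnegative terms vanishes only if each term does, so a combination on which
  \<open>f\<close> vanishes uses only generators on which \<open>f\<close> vanishes.\<close>

lemma conic_zero_set:
  fixes f :: "'k::linordered_field ^ 'm::finite \<Rightarrow> 'k"
  assumes "finite S" "klinear f" "\<And>s. s \<in> S \<Longrightarrow> 0 \<le> f s"
  shows "{x \<in> conic S. f x = 0} = conic {s \<in> S. f s = 0}"
proof (intro equalityI subsetI)
  fix x assume "x \<in> {x \<in> conic S. f x = 0}"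
  then obtain a where a: "x = (\<Sum>s\<in>S. a s *s s)" "\<forall>s\<in>S. 0 \<le> a s" "f x = 0"
    by (auto simp: conic_def)
  then have "(\<Sum>s\<in>S. a s * f s) = 0"
    by (simp add: klinear_simps[OF assms(2)])
  then have "\<forall>s\<in>S. a s * f s = 0"
    using assms(1,3) a(2) by (subst (asm) sum_nonneg_eq_0_iff) auto
  then have "x = (\<Sum>s\<in>{s \<in> S. f s = 0}. a s *s s)"
    unfolding a(1) using assms(1) by (intro sum.mono_neutral_right) auto
  then show "x \<in> conic {s \<in> S. f s = 0}"
    using a(2) by (auto simp: conic_def)
next
  fix x assume "x \<in> conic {s \<in> S. f s = 0}"
  then obtain a where a: "x = (\<Sum>s\<in>{s \<in> S. f s = 0}. a s *s s)" "\<forall>s\<in>{s \<in> S. f s = 0}. 0 \<le> a s"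
    by (auto simp: conic_def)
  then have "x = (\<Sum>s\<in>S. (if f s = 0 then a s else 0) *s s)"
    unfolding a(1) using assms(1) by (intro sum.mono_neutral_cong_left) auto
  moreover have "f x = 0"
    using a(1) by (simp add: klinear_simps[OF assms(2)])
  ultimately show "x \<in> {x \<in> conic S. f x = 0}"
    using a(2) by (auto simp: conic_def intro!: exI[of _ "\<lambda>s. if f s = 0 then a s else 0"])
qed

section \<open>Faces of a finitely generated cone\<close>

lemma face_subset: "cone_face_of \<tau> \<sigma> \<Longrightarrow> \<tau> \<subseteq> \<sigma>"
  by (auto simp: cone_face_of_def)

lemma face_refl: "cone_face_of \<sigma> \<sigma>"
  using klinear_const_zero by (auto simp: cone_face_of_def)

text \<open>The zero set of the exposing functional is generated by the generators in it. Hence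
  faces are finitely generated, and there are finitely many.\<close>

lemma face_conic:
  assumes "finite S" "cone_face_of \<tau> (conic S)"
  shows "\<tau> = conic (S \<inter> \<tau>)"
proof -
  obtain f where f: "klinear f" "\<forall>x\<in>conic S. 0 \<le> f x" "\<tau> = {x \<in> conic S. f x = 0}"
    using assms(2) by (auto simp: cone_face_of_def)
  then have "\<tau> = conic {s \<in> S. f s = 0}"
    using conic_zero_set[OF assms(1) f(1)] conic_base[OF assms(1)] by auto
  moreover have "{s \<in> S. f s = 0} = S \<inter> \<tau>"
    using f(3) conic_base[OF assms(1)] by auto
  ultimately show ?thesis by simp
qed

lemma fg_cone_face: "fg_cone \<sigma> \<Longrightarrow> cone_face_of \<tau> \<sigma> \<Longrightarrow> fg_cone \<tau>"
  unfolding fg_cone_def using face_conic finite_Int by blast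

lemma finite_faces:
  assumes "fg_cone \<sigma>"
  shows "finite {\<tau>. cone_face_of \<tau> \<sigma>}"
proof -
  obtain S where S: "finite S" "\<sigma> = conic S"
    using assms by (auto simp: fg_cone_def)
  then have "{\<tau>. cone_face_of \<tau> \<sigma>} \<subseteq> conic ` Pow S"
    using face_conic by blast
  then show ?thesis
    using S(1) finite_surj[of "Pow S" _ conic] by simp
qed

text \<open>A large multiple of the functional exposing \<tau>, plus the one exposing \<rho> in
  \<tau>, exposes \<rho> in \<sigma>.\<close>

lemma face_trans:
  assumes "fg_cone \<sigma>" "cone_face_of \<tau> \<sigma>" "cone_face_of \<rho> \<tau>"
  shows "cone_face_of \<rho> \<sigma>"
proof -
  obtain S where S: "finite S" "\<sigma> = conic S"
    using assms(1) by (auto simp: fg_cone_def)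
  obtain f where f: "klinear f" "\<forall>x\<in>\<sigma>. 0 \<le> f x" "\<tau> = {x \<in> \<sigma>. f x = 0}"
    using assms(2) by (auto simp: cone_face_of_def)
  obtain g where g: "klinear g" "\<forall>x\<in>\<tau>. 0 \<le> g x" "\<rho> = {x \<in> \<tau>. g x = 0}"
    using assms(3) by (auto simp: cone_face_of_def)
  have Sf: "0 \<le> f s" "s \<in> \<sigma>" if "s \<in> S" for s
    using that S f(2) conic_base[OF S(1)] by auto
  \<comment> \<open>\<open>N\<close> exceeds \<open>\<bar>g s\<bar> / f s\<close> at every generator
    with \<open>f s > 0\<close>, so \<open>f\<close> dominates off \<tau>. Generators with
    \<open>f s = 0\<close> add nothing, as division by zero gives 0.\<close>
  define N where "N = 1 + (\<Sum>s\<in>S. \<bar>g s\<bar> / f s)"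
  define h where "h = (\<lambda>x. N * f x + 1 * g x)"
  have h: "klinear h"
    unfolding h_def by (rule klinear_combination[OF f(1) g(1)])
  have pos: "0 < h s" if "s \<in> S" "f s \<noteq> 0" for s
  proof -
    have fs: "0 < f s" using Sf[OF that(1)] that(2) by auto
    have "\<bar>g s\<bar> / f s \<le> (\<Sum>s\<in>S. \<bar>g s\<bar> / f s)"
      using S(1) that(1) Sf by (intro member_le_sum) auto
    then have "\<bar>g s\<bar> / f s < N" by (simp add: N_def)
    then have "\<bar>g s\<bar> < N * f s" using fs by (simp add: field_simps)
    then show ?thesis by (simp add: h_def)
  qed
  have zero: "h s = g s" "0 \<le> g s" if "s \<in> S" "f s = 0" for s
    using that f(3) g(2) Sf by (auto simp: h_def)
  have nonneg: "0 \<le> h s" if "s \<in> S" for s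
    using pos[OF that] zero[OF that] by (cases "f s = 0") auto
  have "{x \<in> \<sigma>. h x = 0} = conic {s \<in> S. h s = 0}"
    unfolding S(2) by (rule conic_zero_set[OF S(1) h nonneg])
  also have "{s \<in> S. h s = 0} = {s \<in> {s \<in> S. f s = 0}. g s = 0}"
    using pos zero by force
  also have "conic \<dots> = {x \<in> conic {s \<in> S. f s = 0}. g x = 0}"
    using S(1) zero by (intro conic_zero_set[symmetric] g(1)) auto
  also have "conic {s \<in> S. f s = 0} = \<tau>"
    unfolding f(3) S(2) using Sf by (intro conic_zero_set[symmetric] S(1) f(1)) auto
  finally have "{x \<in> \<sigma>. h x = 0} = \<rho>"
    using g(3) by simp
  moreover have "\<forall>x\<in>\<sigma>. 0 \<le> h x"
    using klinear_conic_nonneg[OF h nonneg] S(2) by auto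
  ultimately show ?thesis
    using h unfolding cone_face_of_def by blast
qed

lemma face_Int:
  assumes "cone_face_of \<tau> \<sigma>" "cone_face_of \<rho> \<sigma>"
  shows "cone_face_of (\<tau> \<inter> \<rho>) \<sigma>"
proof -
  obtain f where f: "klinear f" "\<forall>x\<in>\<sigma>. 0 \<le> f x" "\<tau> = {x \<in> \<sigma>. f x = 0}"
    using assms(1) by (auto simp: cone_face_of_def)
  obtain g where g: "klinear g" "\<forall>x\<in>\<sigma>. 0 \<le> g x" "\<rho> = {x \<in> \<sigma>. g x = 0}"
    using assms(2) by (auto simp: cone_face_of_def)
  have "klinear (\<lambda>x. 1 * f x + 1 * g x)"
    by (rule klinear_combination[OF f(1) g(1)])
  moreover have "\<forall>x\<in>\<sigma>. 0 \<le> 1 * f x + 1 * g x"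
    using f(2) g(2) by auto
  moreover have "\<tau> \<inter> \<rho> = {x \<in> \<sigma>. 1 * f x + 1 * g x = 0}"
    unfolding f(3) g(3) using f(2) g(2) by (auto simp: add_nonneg_eq_0_iff)
  ultimately show ?thesis
    unfolding cone_face_of_def by blast
qed

lemma face_between:
  assumes "cone_face_of \<tau> \<sigma>" "\<tau> \<subseteq> \<rho>" "\<rho> \<subseteq> \<sigma>"
  shows "cone_face_of \<tau> \<rho>"
proof -
  obtain f where f: "klinear f" "\<forall>x\<in>\<sigma>. 0 \<le> f x" "\<tau> = {x \<in> \<sigma>. f x = 0}"
    using assms(1) by (auto simp: cone_face_of_def)
  then have "\<tau> = {x \<in> \<rho>. f x = 0}" "\<forall>x\<in>\<rho>. 0 \<le> f x"
    using assms(2,3) by auto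
  then show ?thesis
    using f(1) unfolding cone_face_of_def by blast
qed

text \<open>The exposing functional vanishes on the whole span of \<tau>. This is why nested faces
  can be identified by comparing dimensions.\<close>

lemma face_span_Int:
  assumes "cone_face_of \<tau> \<sigma>" "x \<in> \<sigma>" "x \<in> vec.span \<tau>"
  shows "x \<in> \<tau>"
proof -
  obtain f where f: "klinear f" "\<tau> = {x \<in> \<sigma>. f x = 0}"
    using assms(1) by (auto simp: cone_face_of_def)
  then show ?thesis
    using klinear_vanishes_span[OF f(1) _ assms(3)] assms(2) by auto
qed

lemma face_dim_eqD:
  assumes "cone_face_of \<tau> \<sigma>" "vec.dim \<sigma> \<le> vec.dim \<tau>"
  shows "\<tau> = \<sigma>"
proof -
  have "vec.span \<tau> = vec.span \<sigma>"
    using vec.dim_eq_span[OF face_subset[OF assms(1)] assms(2)] .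
  then have "\<sigma> \<subseteq> \<tau>"
    using face_span_Int[OF assms(1)] vec.span_base by blast
  then show ?thesis
    using face_subset[OF assms(1)] by blast
qed

lemma same_dim_face_eq:
  assumes "cone_face_of \<tau> \<sigma>" "\<tau> \<subseteq> \<rho>" "\<rho> \<subseteq> \<sigma>" "vec.dim \<rho> = vec.dim \<tau>"
  shows "\<tau> = \<rho>"
  by (rule face_dim_eqD[OF face_between[OF assms(1-3)]]) (use assms(4) in simp)

lemma face_dim_less: "cone_face_of \<tau> \<sigma> \<Longrightarrow> \<tau> \<noteq> \<sigma> \<Longrightarrow> vec.dim \<tau> < vec.dim \<sigma>"
  using face_dim_eqD not_less by blast

text \<open>Both values of the exposing functional are nonnegative and they add up to 0.\<close>

lemma face_summand:
  assumes "cone_face_of \<tau> \<sigma>" "x \<in> \<sigma>" "y \<in> \<sigma>" "x + y \<in> \<tau>"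
  shows "x \<in> \<tau>"
proof -
  obtain f where f: "klinear f" "\<forall>x\<in>\<sigma>. 0 \<le> f x" "\<tau> = {x \<in> \<sigma>. f x = 0}"
    using assms(1) by (auto simp: cone_face_of_def)
  then show ?thesis
    using assms(2-4) by (auto simp: klinear_simps[OF f(1)] add_nonneg_eq_0_iff)
qed

text \<open>\<open>k\<close> is tilted by the least ratio \<open>k / f\<close> over the generators
  off the face \<open>f = 0\<close>; the result stays nonnegative and vanishes at some generator off
  that face. Covers, the diamond and the sweep are all built from this.\<close>

lemma min_ratio_face:
  assumes "fg_cone \<sigma>" "klinear f" "\<forall>x\<in>\<sigma>. 0 \<le> f x"
    and "klinear k" "\<forall>x\<in>\<sigma>. f x = 0 \<longrightarrow> k x = 0" and "x0 \<in> \<sigma>" "f x0 \<noteq> 0"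
  obtains \<theta> where "\<forall>x\<in>\<sigma>. \<theta> * f x \<le> k x" "\<exists>x\<in>\<sigma>. f x \<noteq> 0 \<and> k x = \<theta> * f x"
    "cone_face_of {x \<in> \<sigma>. k x = \<theta> * f x} \<sigma>"
proof -
  obtain S where S: "finite S" "\<sigma> = conic S"
    using assms(1) by (auto simp: fg_cone_def)
  have S\<sigma>: "s \<in> \<sigma>" if "s \<in> S" for s
    using that S conic_base by auto
  define T where "T = {s \<in> S. f s \<noteq> 0}"
  have "T \<noteq> {}"
  proof
    assume "T = {}"
    then have "\<forall>s\<in>S. f s = 0" by (auto simp: T_def)
    then have "f x0 = 0"
      using assms(6) unfolding S(2) conic_def by (auto simp: klinear_simps[OF assms(2)])
    then show False using assms(7) by simp
  qed
  have finT: "finite ((\<lambda>s. k s / f s) ` T)" using S(1) by (simp add: T_def)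
  define \<theta> where "\<theta> = Min ((\<lambda>s. k s / f s) ` T)"
  have "\<theta> \<in> (\<lambda>s. k s / f s) ` T"
    unfolding \<theta>_def using \<open>T \<noteq> {}\<close> finT by (intro Min_in) auto
  then obtain s0 where s0: "s0 \<in> T" "\<theta> = k s0 / f s0" by auto
  have lin: "klinear (\<lambda>x. 1 * k x + (- \<theta>) * f x)"
    by (rule klinear_combination[OF assms(4) assms(2)])
  have "0 \<le> 1 * k s + (- \<theta>) * f s" if "s \<in> S" for s
  proof (cases "f s = 0")
    case True
    then show ?thesis using assms(5) S\<sigma>[OF that] by simp
  next
    case False
    then have "\<theta> \<le> k s / f s"
      unfolding \<theta>_def using finT that by (intro Min_le) (auto simp: T_def)
    moreover have "0 < f s" using False assms(3) S\<sigma>[OF that] by force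
    ultimately show ?thesis by (simp add: field_simps)
  qed
  then have ge: "\<forall>x\<in>\<sigma>. 0 \<le> 1 * k x + (- \<theta>) * f x"
    using klinear_conic_nonneg[OF lin] S(2) by blast
  show ?thesis
  proof
    show "\<forall>x\<in>\<sigma>. \<theta> * f x \<le> k x" using ge by simp
    show "\<exists>x\<in>\<sigma>. f x \<noteq> 0 \<and> k x = \<theta> * f x"
      using s0 S\<sigma> by (auto simp: T_def)
    have "{x \<in> \<sigma>. k x = \<theta> * f x} = {x \<in> \<sigma>. 1 * k x + (- \<theta>) * f x = 0}"
      by (auto simp: algebra_simps)
    then show "cone_face_of {x \<in> \<sigma>. k x = \<theta> * f x} \<sigma>"
      unfolding cone_face_of_def using lin ge by blast
  qed
qed

text \<open>Modulo \<open>vec.span G\<close>, a functional that is negative somewhere on the cone is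
  negative on a ray. Tilting \<open>h\<close> by its least ratio to a functional \<open>f\<close>
  exposing \<open>G\<close> gives a face \<tau> on which \<open>h\<close> is a negative multiple of
  \<open>f\<close>. If \<tau> is too large to be a cover, a second functional cuts out a smaller
  face over \<open>G\<close>, and induction on the dimension applies.\<close>

lemma exists_negative_cover:
  assumes "fg_cone \<sigma>" "cone_face_of G \<sigma>" "klinear h" "\<forall>x\<in>G. h x = 0" "x0 \<in> \<sigma>" "h x0 < 0"
  shows "\<exists>\<tau>. cone_face_of \<tau> \<sigma> \<and> G \<subseteq> \<tau> \<and> vec.dim \<tau> = vec.dim G + 1 \<and> (\<forall>y\<in>\<tau> - G. h y < 0)"
  using assms(1,2,5,6)
proof (induction "vec.dim \<sigma>" arbitrary: \<sigma> x0 rule: less_induct)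
  case less
  obtain f where f: "klinear f" "\<forall>x\<in>\<sigma>. 0 \<le> f x" "G = {x \<in> \<sigma>. f x = 0}"
    using less.prems(2) by (auto simp: cone_face_of_def)
  have "\<forall>x\<in>\<sigma>. f x = 0 \<longrightarrow> h x = 0" using f(3) assms(4) by auto
  moreover have "f x0 \<noteq> 0" using f(3) assms(4) less.prems(3,4) by auto
  ultimately obtain \<theta> where \<theta>: "\<forall>x\<in>\<sigma>. \<theta> * f x \<le> h x" "\<exists>x\<in>\<sigma>. f x \<noteq> 0 \<and> h x = \<theta> * f x"
    "cone_face_of {x \<in> \<sigma>. h x = \<theta> * f x} \<sigma>"
    by (rule min_ratio_face[OF less.prems(1) f(1,2) assms(3) _ less.prems(3)])
  define \<tau> where "\<tau> = {x \<in> \<sigma>. h x = \<theta> * f x}"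
  have \<tau>: "cone_face_of \<tau> \<sigma>" "fg_cone \<tau>"
    using \<theta>(3) fg_cone_face[OF less.prems(1)] by (auto simp: \<tau>_def)
  have "\<theta> * f x0 < 0" "0 \<le> f x0"
    using \<theta>(1) f(2) less.prems(3,4) le_less_trans by blast+
  then have "\<theta> < 0" using mult_nonneg_nonneg[of \<theta> "f x0"] by linarith
  have G\<tau>: "G \<subseteq> \<tau>" using f(3) assms(4) by (auto simp: \<tau>_def)
  have neg: "h y < 0" if "y \<in> \<tau> - G" for y
  proof -
    have "y \<in> \<sigma>" "f y \<noteq> 0" "h y = \<theta> * f y" using that f(3) by (auto simp: \<tau>_def)
    then have "0 < f y" using f(2) by force
    then show ?thesis using \<open>\<theta> < 0\<close> \<open>h y = \<theta> * f y\<close> by (simp add: mult_neg_pos)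
  qed
  obtain y where y: "y \<in> \<tau>" "y \<notin> G" using \<theta>(2) f(3) by (auto simp: \<tau>_def)
  have Gf: "cone_face_of G \<tau>"
    using face_between[OF less.prems(2) G\<tau>] face_subset[OF \<tau>(1)] by blast
  have yG: "y \<notin> vec.span G"
    using face_span_Int[OF Gf] y by blast
  have dimy: "vec.dim (insert y G) = vec.dim G + 1"
    using yG by (simp add: vec.dim_insert)
  have "vec.dim (insert y G) \<le> vec.dim \<tau>"
    using y G\<tau> by (intro vec.dim_subset) auto
  show ?case
  proof (cases "vec.dim \<tau> = vec.dim G + 1")
    case True
    then show ?thesis using \<tau> G\<tau> neg by blast
  next
    case False
    then have "vec.dim (insert y G) < vec.dim \<tau>"
      using \<open>vec.dim (insert y G) \<le> vec.dim \<tau>\<close> dimy by simp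
    then have "\<not> \<tau> \<subseteq> vec.span (insert y G)"
      using vec.dim_subset[of \<tau> "vec.span (insert y G)"] by (auto simp: vec.dim_span)
    then obtain z where z: "z \<in> \<tau>" "z \<notin> vec.span (insert y G)" by blast
    \<comment> \<open>\<open>k\<close> vanishes on \<open>G\<close> and at \<open>y\<close> but not
      at \<open>z\<close>, so it is no multiple of \<open>f\<close> on \<tau>. The face tilted out
      by \<open>k\<close> is therefore proper and the induction descends.\<close>
    obtain k where k: "klinear k" "\<forall>x\<in>vec.span (insert y G). k x = 0" "k z = 1"
      by (rule exists_separating_klinear[OF z(2)])
    have f\<tau>: "\<forall>x\<in>\<tau>. 0 \<le> f x" "f y \<noteq> 0"
      using f(2,3) y by (auto simp: \<tau>_def)
    have k0: "\<forall>x\<in>\<tau>. f x = 0 \<longrightarrow> k x = 0" "k y = 0"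
      using k(2) f(3) vec.span_base[of _ "insert y G"] by (auto simp: \<tau>_def)
    obtain \<eta> where \<eta>: "\<forall>x\<in>\<tau>. \<eta> * f x \<le> k x" "\<exists>x\<in>\<tau>. f x \<noteq> 0 \<and> k x = \<eta> * f x"
      "cone_face_of {x \<in> \<tau>. k x = \<eta> * f x} \<tau>"
  by (rule min_ratio_face[OF \<tau>(2) f(1) f\<tau>(1) k(1) k0(1) y(1) f\<tau>(2)])
    define \<rho> where "\<rho> = {x \<in> \<tau>. k x = \<eta> * f x}"
    have "\<rho> \<noteq> \<tau>"
    proof
      assume eq: "\<rho> = \<tau>"
      have "k x = \<eta> * f x" if "x \<in> \<tau>" for x
        using that unfolding eq[symmetric] by (simp add: \<rho>_def)
      from this[OF y(1)] this[OF z(1)] show False using k0(2) f\<tau>(2) k(3) by simp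
    qed
    then have "vec.dim \<rho> < vec.dim \<tau>"
      using \<eta>(3) face_dim_less by (auto simp: \<rho>_def)
    also have "\<dots> \<le> vec.dim \<sigma>"
      using face_subset[OF \<tau>(1)] by (rule vec.dim_subset)
    finally have dl: "vec.dim \<rho> < vec.dim \<sigma>" .
    have \<rho>: "cone_face_of \<rho> \<tau>" "fg_cone \<rho>"
      using \<eta>(3) fg_cone_face[OF \<tau>(2)] by (auto simp: \<rho>_def)
    have G\<rho>: "G \<subseteq> \<rho>" using G\<tau> k0(1) f(3) by (auto simp: \<rho>_def)
    have G\<rho>f: "cone_face_of G \<rho>"
      using face_between[OF Gf G\<rho>] face_subset[OF \<rho>(1)] by blast
    obtain x1 where "x1 \<in> \<rho>" "x1 \<notin> G" using \<eta>(2) f(3) by (auto simp: \<rho>_def)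
    then have "x1 \<in> \<rho>" "h x1 < 0" using neg by (auto simp: \<rho>_def)
    from less.hyps[OF dl \<rho>(2) G\<rho>f this]
    show ?thesis
      using face_trans[OF \<tau>(2) \<rho>(1)] face_trans[OF less.prems(1) \<tau>(1)] by blast
  qed
qed

lemma exists_cover:
  assumes "fg_cone \<sigma>" "cone_face_of G \<sigma>" "G \<noteq> \<sigma>"
  shows "\<exists>\<tau>. cone_face_of \<tau> \<sigma> \<and> G \<subseteq> \<tau> \<and> vec.dim \<tau> = vec.dim G + 1"
proof -
  obtain f where f: "klinear f" "\<forall>x\<in>\<sigma>. 0 \<le> f x" "G = {x \<in> \<sigma>. f x = 0}"
    using assms(2) by (auto simp: cone_face_of_def)
  obtain x where x: "x \<in> \<sigma>" "f x \<noteq> 0" using f(3) assms(3) by auto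
  have "\<forall>x\<in>G. - f x = 0" using f(3) by auto
  moreover have "0 < f x" using f(2) x by (metis order_le_less)
  then have "- f x < 0" by simp
  ultimately show ?thesis
    using exists_negative_cover[OF assms(1,2) klinear_minus[OF f(1)] _ x(1)] by blast
qed

section \<open>Covers of a face\<close>

lemma cover_Int:
  assumes "cone_face_of G \<sigma>" "cone_face_of r \<sigma>" "cone_face_of \<tau> \<sigma>" "G \<subseteq> r" "G \<subseteq> \<tau>"
    and "vec.dim r = vec.dim G + 1" "\<not> r \<subseteq> \<tau>"
  shows "r \<inter> \<tau> = G"
proof -
  have I: "cone_face_of (r \<inter> \<tau>) \<sigma>" by (rule face_Int[OF assms(2,3)])
  have "cone_face_of (r \<inter> \<tau>) r"
    by (rule face_between[OF I _ face_subset[OF assms(2)]]) simp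
  then have "vec.dim (r \<inter> \<tau>) < vec.dim r" using face_dim_less assms(7) by blast
  moreover have "cone_face_of G (r \<inter> \<tau>)"
    by (rule face_between[OF assms(1) _ face_subset[OF I]]) (use assms(4,5) in blast)
  ultimately show ?thesis using face_dim_eqD[of G "r \<inter> \<tau>"] assms(6) by simp
qed

text \<open>For a face \<open>G\<close> these correspond to the rays of the cone modulo
  \<open>vec.span G\<close>, that is, to the vertices of the face figure.\<close>

definition face_covers :: "('k::linordered_field ^ 'm::finite) set \<Rightarrow> ('k ^ 'm) set \<Rightarrow> ('k ^ 'm) set set" where
  "face_covers G \<sigma> = {\<tau>. cone_face_of \<tau> \<sigma> \<and> G \<subseteq> \<tau> \<and> vec.dim \<tau> = vec.dim G + 1}"

lemma finite_face_covers: "fg_cone \<sigma> \<Longrightarrow> finite (face_covers G \<sigma>)"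
  by (rule finite_subset[OF _ finite_faces]) (auto simp: face_covers_def)

lemma face_covers_Diff: "\<tau> \<in> face_covers G \<sigma> \<Longrightarrow> \<exists>x. x \<in> \<tau> - G"
  by (cases "\<tau> = G") (auto simp: face_covers_def)

text \<open>Otherwise a functional would vanish on \<open>G\<close> and all covers but be negative
  at some point of \<sigma>, and hence negative on some cover.\<close>

lemma span_face_covers:
  assumes "fg_cone \<sigma>" "cone_face_of G \<sigma>"
  shows "\<sigma> \<subseteq> vec.span (G \<union> \<Union> (face_covers G \<sigma>))"
proof (rule subsetI, rule ccontr)
  fix x assume x: "x \<in> \<sigma>" "x \<notin> vec.span (G \<union> \<Union> (face_covers G \<sigma>))"
  obtain k where k: "klinear k" "\<forall>y\<in>vec.span (G \<union> \<Union> (face_covers G \<sigma>)). k y = 0" "k x = 1"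
    by (rule exists_separating_klinear[OF x(2)])
  define h where "h = (\<lambda>x. - k x)"
  have h: "klinear h" unfolding h_def by (rule klinear_minus[OF k(1)])
  have "\<forall>x\<in>G. h x = 0" "h x < 0" using k by (auto simp: h_def vec.span_base)
  from exists_negative_cover[OF assms h this(1) x(1) this(2)]
  obtain \<tau> where \<tau>: "\<tau> \<in> face_covers G \<sigma>" "\<forall>y\<in>\<tau> - G. h y < 0"
    unfolding face_covers_def by blast
  then obtain y where y: "y \<in> \<tau> - G" using face_covers_Diff by blast
  then have "y \<in> vec.span (G \<union> \<Union> (face_covers G \<sigma>))"
    using \<tau>(1) by (intro vec.span_base) blast
  then have "h y = 0" using k(2) by (simp add: h_def)
  then show False using \<tau>(2) y by force
qed

text \<open>A cover is spanned by \<open>G\<close> and any of its points off \<open>G\<close>, so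
  one point from each cover and a basis of \<open>G\<close> span \<sigma>. This is the source of the
  bound n - 4 for the number of 5-faces over a 4-face.\<close>

lemma dim_le_card_face_covers:
  assumes "fg_cone \<sigma>" "cone_face_of G \<sigma>"
  shows "vec.dim \<sigma> \<le> vec.dim G + card (face_covers G \<sigma>)"
proof -
  let ?C = "face_covers G \<sigma>"
  have fin: "finite ?C"
    by (rule finite_face_covers[OF assms(1)])
  define p where "p = (\<lambda>\<tau>. SOME x. x \<in> \<tau> - G)"
  have p: "p \<tau> \<in> \<tau> - G" if "\<tau> \<in> ?C" for \<tau>
    unfolding p_def by (rule someI_ex[OF face_covers_Diff[OF that]])
  obtain B where B: "B \<subseteq> G" "vec.independent B" "G \<subseteq> vec.span B" "card B = vec.dim G"
    by (rule vec.basis_exists)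
  let ?V = "vec.span (B \<union> p ` ?C)"
  have GV: "G \<subseteq> ?V"
    using B(3) vec.span_mono[of B "B \<union> p ` ?C"] by blast
  have "\<tau> \<subseteq> ?V" if \<tau>: "\<tau> \<in> ?C" for \<tau>
  proof -
    have \<tau>': "cone_face_of \<tau> \<sigma>" "G \<subseteq> \<tau>" "vec.dim \<tau> = vec.dim G + 1"
      using \<tau> by (auto simp: face_covers_def)
    have "cone_face_of G \<tau>"
      by (rule face_between[OF assms(2) \<tau>'(2) face_subset[OF \<tau>'(1)]])
    then have "p \<tau> \<notin> vec.span G" using face_span_Int p[OF \<tau>] by blast
    then have "vec.dim (insert (p \<tau>) G) = vec.dim \<tau>" using \<tau>' by (simp add: vec.dim_insert)
    then have "vec.span (insert (p \<tau>) G) = vec.span \<tau>"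
      using p[OF \<tau>] \<tau>' by (intro vec.dim_eq_span) auto
    then have "\<tau> \<subseteq> vec.span (insert (p \<tau>) G)" using vec.span_superset by blast
    also have "\<dots> \<subseteq> ?V"
    proof (rule vec.span_minimal)
      show "insert (p \<tau>) G \<subseteq> ?V"
        using GV \<tau> vec.span_base[of "p \<tau>" "B \<union> p ` ?C"] by blast
    qed (rule vec.subspace_span)
    finally show ?thesis .
  qed
  then have "G \<union> \<Union> ?C \<subseteq> ?V" using GV by blast
  then have "vec.span (G \<union> \<Union> ?C) \<subseteq> ?V"
    by (rule vec.span_minimal) (rule vec.subspace_span)
  then have "\<sigma> \<subseteq> ?V"
    using span_face_covers[OF assms] by blast
  then have "vec.dim \<sigma> \<le> card (B \<union> p ` ?C)"
    using fin vec.finiteI_independent[OF B(2)] by (intro vec.dim_le_card) auto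
  also have "\<dots> \<le> card B + card (p ` ?C)" by (rule card_Un_le)
  also have "\<dots> \<le> vec.dim G + card ?C"
    using B(4) card_image_le[OF fin] by simp
  finally show ?thesis .
qed


section \<open>Incidence signs\<close>

lemma facetD:
  assumes "cone_facet_of \<tau> \<sigma>"
  shows "cone_face_of \<tau> \<sigma>" "\<tau> \<subseteq> \<sigma>" "vec.dim \<sigma> = vec.dim \<tau> + 1"
  using assms face_subset by (auto simp: cone_facet_of_def)

lemma facet_span_insert:
  assumes "cone_facet_of \<tau> \<sigma>" "u \<in> \<sigma>" "u \<notin> \<tau>"
  shows "vec.span (insert u \<tau>) = vec.span \<sigma>"
proof (rule vec.dim_eq_span)
  have \<tau>: "cone_face_of \<tau> \<sigma>" "vec.dim \<sigma> = vec.dim \<tau> + 1"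
    using assms(1) by (auto simp: cone_facet_of_def)
  show "insert u \<tau> \<subseteq> \<sigma>"
    using face_subset[OF \<tau>(1)] assms(2) by blast
  have "u \<notin> vec.span \<tau>"
    using face_span_Int[OF \<tau>(1) assms(2)] assms(3) by blast
  then show "vec.dim \<sigma> \<le> vec.dim (insert u \<tau>)"
    using \<tau>(2) by (simp add: vec.dim_insert)
qed

text \<open>A facet and one further point span the whole cone.\<close>

lemma klinear_vanishes_on_facet:
  fixes l :: "'k::linordered_field ^ 'm::finite \<Rightarrow> 'k"
  assumes "cone_facet_of \<tau> \<sigma>" "u \<in> \<sigma>" "u \<notin> \<tau>" "klinear l" "\<forall>x\<in>\<tau>. l x = 0" "l u = 0" "x \<in> \<sigma>"
  shows "l x = 0"
proof (rule klinear_vanishes_span[OF assms(4)])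
  show "x \<in> vec.span (insert u \<tau>)"
    unfolding facet_span_insert[OF assms(1-3)] by (rule vec.span_base[OF assms(7)])
qed (use assms(5,6) in auto)

abbreviation facets :: "('k::linordered_field ^ 'm::finite) set \<Rightarrow> ('k ^ 'm) set set" where
  "facets \<rho> \<equiv> {\<tau>. cone_facet_of \<tau> \<rho>}"

abbreviation facets_over ::
  "('k::linordered_field ^ 'm::finite) set \<Rightarrow> ('k ^ 'm) set \<Rightarrow> ('k ^ 'm) set set" where
  "facets_over G \<rho> \<equiv> {\<tau>. cone_facet_of \<tau> \<rho> \<and> G \<subseteq> \<tau>}"

abbreviation faces_between ::
  "('k::linordered_field ^ 'm::finite) set \<Rightarrow> ('k ^ 'm) set \<Rightarrow> ('k ^ 'm) set set" where
  "faces_between \<tau> \<rho> \<equiv> {\<kappa>. cone_facet_of \<tau> \<kappa> \<and> cone_facet_of \<kappa> \<rho>}"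

text \<open>Modulo \<open>vec.span \<tau>\<close> the cone is two-dimensional and pointed. With
  \<open>f\<close> exposing \<tau> and \<open>k\<close> a second coordinate, the slope
  \<open>k / f\<close> off \<tau> is bounded on both sides, and the two faces are those where it
  attains its least and its greatest value.\<close>

lemma diamond:
  assumes "fg_cone \<sigma>" "cone_face_of \<tau> \<sigma>" "vec.dim \<sigma> = vec.dim \<tau> + 2"
  obtains \<rho>\<^sub>1 \<rho>\<^sub>2 where "\<rho>\<^sub>1 \<noteq> \<rho>\<^sub>2" "faces_between \<tau> \<sigma> = {\<rho>\<^sub>1, \<rho>\<^sub>2}"
proof -
  obtain f where f: "klinear f" "\<forall>x\<in>\<sigma>. 0 \<le> f x" "\<tau> = {x \<in> \<sigma>. f x = 0}"
    using assms(2) by (auto simp: cone_face_of_def)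
  have "\<tau> \<noteq> \<sigma>" using assms(3) by auto
  then obtain y where y: "y \<in> \<sigma>" "f y \<noteq> 0" using f(3) by auto
  then have fy: "0 < f y" using f(2) by (metis order_le_less)
  have "y \<notin> vec.span \<tau>" using face_span_Int[OF assms(2)] y f(3) by blast
  then have "vec.dim (insert y \<tau>) < vec.dim \<sigma>" using assms(3) by (simp add: vec.dim_insert)
  then have "\<not> \<sigma> \<subseteq> vec.span (insert y \<tau>)"
    using vec.dim_subset[of \<sigma> "vec.span (insert y \<tau>)"] by (auto simp: vec.dim_span)
  then obtain z where z: "z \<in> \<sigma>" "z \<notin> vec.span (insert y \<tau>)" by blast
  obtain k where k: "klinear k" "\<forall>x\<in>vec.span (insert y \<tau>). k x = 0" "k z = 1"
    by (rule exists_separating_klinear[OF z(2)])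
  have k0: "\<forall>x\<in>\<sigma>. f x = 0 \<longrightarrow> k x = 0" "k y = 0"
    using k(2) f(3) vec.span_base[of _ "insert y \<tau>"] by auto
  \<comment> \<open>Applied to \<open>k\<close> and to \<open>- k\<close> below, for the two ends of
    the range of slopes.\<close>
  have face: "\<exists>p \<theta> \<rho>. (\<forall>x\<in>\<sigma>. \<theta> * f x \<le> h x) \<and> p \<in> \<sigma> \<and> 0 < f p \<and> h p = \<theta> * f p \<and>
      \<rho> = {x \<in> \<sigma>. h x = \<theta> * f x} \<and> cone_facet_of \<tau> \<rho> \<and> cone_facet_of \<rho> \<sigma>"
    if h: "klinear h" "\<forall>x\<in>\<sigma>. f x = 0 \<longrightarrow> h x = 0" "h y = 0" "h z \<noteq> 0" for h
  proof -
    obtain \<theta> where \<theta>: "\<forall>x\<in>\<sigma>. \<theta> * f x \<le> h x" "\<exists>x\<in>\<sigma>. f x \<noteq> 0 \<and> h x = \<theta> * f x"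
      "cone_face_of {x \<in> \<sigma>. h x = \<theta> * f x} \<sigma>"
      by (rule min_ratio_face[OF assms(1) f(1,2) h(1,2) y])
    define \<rho> where "\<rho> = {x \<in> \<sigma>. h x = \<theta> * f x}"
    have \<rho>: "cone_face_of \<rho> \<sigma>" using \<theta>(3) by (simp add: \<rho>_def)
    obtain p where p: "p \<in> \<sigma>" "f p \<noteq> 0" "h p = \<theta> * f p" using \<theta>(2) by blast
    then have "0 < f p" using f(2) by (metis order_le_less)
    have "\<rho> \<noteq> \<sigma>"
    proof
      assume eq: "\<rho> = \<sigma>"
      have "h x = \<theta> * f x" if "x \<in> \<sigma>" for x
        using that unfolding eq[symmetric] by (simp add: \<rho>_def)
      from this[OF y(1)] this[OF z(1)] show False using h(3,4) y(2) by simp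
    qed
    then have "vec.dim \<rho> < vec.dim \<sigma>" using face_dim_less[OF \<rho>] by blast
    have "\<tau> \<subseteq> \<rho>" using f(3) h(2) by (auto simp: \<rho>_def)
    then have \<tau>\<rho>: "cone_face_of \<tau> \<rho>"
      using face_between[OF assms(2)] face_subset[OF \<rho>] by blast
    have "\<tau> \<noteq> \<rho>" using p f(3) by (auto simp: \<rho>_def)
    then have "vec.dim \<tau> < vec.dim \<rho>" using face_dim_less[OF \<tau>\<rho>] by blast
    then have "cone_facet_of \<tau> \<rho>" "cone_facet_of \<rho> \<sigma>"
      using \<tau>\<rho> \<rho> assms(3) \<open>vec.dim \<rho> < vec.dim \<sigma>\<close> by (auto simp: cone_facet_of_def)
    then show ?thesis
      using \<theta>(1) p(1,3) \<open>0 < f p\<close> \<rho>_def by blast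
  qed
  obtain p\<^sub>1 \<theta>\<^sub>1 \<rho>\<^sub>1 where 1: "\<forall>x\<in>\<sigma>. \<theta>\<^sub>1 * f x \<le> k x" "p\<^sub>1 \<in> \<sigma>" "0 < f p\<^sub>1" "k p\<^sub>1 = \<theta>\<^sub>1 * f p\<^sub>1"
      "\<rho>\<^sub>1 = {x \<in> \<sigma>. k x = \<theta>\<^sub>1 * f x}" "cone_facet_of \<tau> \<rho>\<^sub>1" "cone_facet_of \<rho>\<^sub>1 \<sigma>"
    using face[OF k(1) k0] k(3) by auto
  note lin = klinear_minus[OF k(1)]
  obtain p\<^sub>2 \<theta>\<^sub>2 \<rho>\<^sub>2 where 2: "\<forall>x\<in>\<sigma>. \<theta>\<^sub>2 * f x \<le> - k x" "p\<^sub>2 \<in> \<sigma>" "0 < f p\<^sub>2" "- k p\<^sub>2 = \<theta>\<^sub>2 * f p\<^sub>2"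
      "\<rho>\<^sub>2 = {x \<in> \<sigma>. - k x = \<theta>\<^sub>2 * f x}" "cone_facet_of \<tau> \<rho>\<^sub>2" "cone_facet_of \<rho>\<^sub>2 \<sigma>"
    using face[OF lin] k0 k(3) by auto
  \<comment> \<open>\<open>y\<close> has slope 0 and \<open>z\<close> has positive slope, so the
    least slope \<open>\<theta>\<^sub>1\<close> lies strictly below the greatest slope
    \<open>- \<theta>\<^sub>2\<close>.\<close>
  have "\<theta>\<^sub>1 * f y \<le> 0" using 1(1) y(1) k0(2) by force
  then have \<theta>1: "\<theta>\<^sub>1 \<le> 0" using fy by (simp add: mult_le_0_iff)
  have "\<theta>\<^sub>2 * f z < 0" "0 \<le> f z" using 2(1) z(1) k(3) f(2) by force+
  then have \<theta>2: "\<theta>\<^sub>2 < 0" using mult_nonneg_nonneg[of \<theta>\<^sub>2 "f z"] by linarith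
  have "p\<^sub>1 \<notin> \<rho>\<^sub>2"
  proof
    assume "p\<^sub>1 \<in> \<rho>\<^sub>2"
    then have "\<theta>\<^sub>1 * f p\<^sub>1 = - \<theta>\<^sub>2 * f p\<^sub>1" using 1(4) 2(5) by simp
    moreover have "(\<theta>\<^sub>1 + \<theta>\<^sub>2) * f p\<^sub>1 < 0"
      using \<theta>1 \<theta>2 1(3) by (intro mult_neg_pos) auto
    ultimately show False by (simp add: distrib_right)
  qed
  then have ne: "\<rho>\<^sub>1 \<noteq> \<rho>\<^sub>2" using 1 by auto
  have same: "\<kappa> = \<rho>" if "cone_facet_of \<kappa> \<sigma>" "cone_facet_of \<rho> \<sigma>" "\<kappa> \<subseteq> \<rho>" for \<kappa> \<rho>
  proof (rule face_dim_eqD)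
    show "cone_face_of \<kappa> \<rho>"
      using that face_between face_subset unfolding cone_facet_of_def by blast
  qed (use that in \<open>auto simp: cone_facet_of_def\<close>)
  have "\<kappa> = \<rho>\<^sub>1 \<or> \<kappa> = \<rho>\<^sub>2" if \<kappa>: "cone_facet_of \<tau> \<kappa>" "cone_facet_of \<kappa> \<sigma>" for \<kappa>
  proof -
    have "\<tau> \<subseteq> \<kappa>" "\<kappa> \<subseteq> \<sigma>" "\<tau> \<noteq> \<kappa>"
      using \<kappa> face_subset by (auto simp: cone_facet_of_def)
    then obtain x where x: "x \<in> \<kappa>" "x \<notin> \<tau>" "x \<in> \<sigma>" by blast
    then have "f x \<noteq> 0" using f(3) by blast
    then have fx: "0 < f x" using f(2) x(3) by (metis order_le_less)
    \<comment> \<open>The slope is constant on \<open>\<kappa> - \<tau>\<close>, since \<kappa> is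
      spanned by \<tau> and \<open>x\<close>.\<close>
    define \<theta> where "\<theta> = k x / f x"
    have lin': "klinear (\<lambda>x. 1 * k x + (- \<theta>) * f x)"
      by (rule klinear_combination[OF k(1) f(1)])
    have van: "k v = \<theta> * f v" if "v \<in> \<kappa>" for v
      using klinear_vanishes_on_facet[OF \<kappa>(1) x(1,2) lin' _ _ that] f(3) k0(1) fx
      by (simp add: \<theta>_def)
    have "\<theta> * f x = k x" using fx by (simp add: \<theta>_def)
    then have "\<theta>\<^sub>1 * f x \<le> \<theta> * f x" "\<theta> * f x \<le> - \<theta>\<^sub>2 * f x" using 1(1) 2(1) x(3) by force+
    then have bounds: "\<theta>\<^sub>1 \<le> \<theta>" "\<theta> \<le> - \<theta>\<^sub>2"
      using fx mult_le_cancel_right_pos by blast+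
    consider "\<theta> = \<theta>\<^sub>1" | "\<theta> = - \<theta>\<^sub>2" | "\<theta>\<^sub>1 < \<theta>" "\<theta> < - \<theta>\<^sub>2" using bounds by linarith
    then show ?thesis
    proof cases
      case 1
      then have "\<kappa> \<subseteq> \<rho>\<^sub>1" using van \<open>\<kappa> \<subseteq> \<sigma>\<close> \<open>\<rho>\<^sub>1 = _\<close> by auto
      then show ?thesis using same[OF \<kappa>(2) \<open>cone_facet_of \<rho>\<^sub>1 \<sigma>\<close>] by blast
    next
      case 2
      then have "\<kappa> \<subseteq> \<rho>\<^sub>2" using van \<open>\<kappa> \<subseteq> \<sigma>\<close> \<open>\<rho>\<^sub>2 = _\<close> by auto
      then show ?thesis using same[OF \<kappa>(2) \<open>cone_facet_of \<rho>\<^sub>2 \<sigma>\<close>] by blast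
    next
      case 3
      define l where "l = (\<lambda>x. 1 * k x + (- \<theta>) * f x)"
      have l: "klinear l" unfolding l_def by (rule lin')
      have "l p\<^sub>1 = (\<theta>\<^sub>1 - \<theta>) * f p\<^sub>1"
        by (simp add: l_def 1(4) algebra_simps)
      then have l1: "l p\<^sub>1 < 0" using 1(3) 3(1) by (simp add: mult_neg_pos)
      have "k p\<^sub>2 = - (\<theta>\<^sub>2 * f p\<^sub>2)" using 2(4) by (metis minus_minus)
      then have "l p\<^sub>2 = (- \<theta>\<^sub>2 - \<theta>) * f p\<^sub>2"
        by (simp add: l_def algebra_simps)
      moreover have "0 < (- \<theta>\<^sub>2 - \<theta>) * f p\<^sub>2" using 2(3) 3(2) by (intro mult_pos_pos) auto
      ultimately have l2: "0 < l p\<^sub>2" by simp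
      \<comment> \<open>A positive combination of points with the two extreme slopes that has slope
        \<theta> itself. It has to lie in \<kappa>, and then so does its summand along
        \<open>p\<^sub>1\<close>, whose slope is not \<theta>.\<close>
      define q where "q = l p\<^sub>2 *s p\<^sub>1 + (- l p\<^sub>1) *s p\<^sub>2"
      have parts: "l p\<^sub>2 *s p\<^sub>1 \<in> \<sigma>" "(- l p\<^sub>1) *s p\<^sub>2 \<in> \<sigma>"
        using l1 l2 fg_cone_scale[OF assms(1) 1(2), of "l p\<^sub>2"]
          fg_cone_scale[OF assms(1) 2(2), of "- l p\<^sub>1"] by simp_all
      then have "q \<in> \<sigma>" unfolding q_def by (rule fg_cone_add[OF assms(1)])
      have "l q = 0" by (simp add: q_def klinear_simps[OF l])
      have "q \<in> \<kappa>"
      proof (rule ccontr)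
        assume "q \<notin> \<kappa>"
        then have "l p\<^sub>1 = 0"
          using klinear_vanishes_on_facet[OF \<kappa>(2) \<open>q \<in> \<sigma>\<close> _ l _ \<open>l q = 0\<close> 1(2)] van
          by (simp add: l_def)
        then show False using l1 by simp
      qed
      then have "l p\<^sub>2 *s p\<^sub>1 \<in> \<kappa>"
        using face_summand[of \<kappa> \<sigma>] \<kappa>(2) parts by (auto simp: q_def cone_facet_of_def)
      then have "l (l p\<^sub>2 *s p\<^sub>1) = 0" using van by (simp add: l_def)
      then show ?thesis using l1 l2 by (simp add: klinear_simps[OF l])
    qed
  qed
  then have "faces_between \<tau> \<sigma> = {\<rho>\<^sub>1, \<rho>\<^sub>2}"
    using 1(6,7) 2(6,7) by blast
  then show ?thesis using that ne by blast
qed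

section \<open>Determinants of coordinate matrices\<close>

definition coord_mat :: "('k::linordered_field ^ 'm::finite) list \<Rightarrow> ('k ^ 'm) list \<Rightarrow> 'k mat" where
  "coord_mat b c = Matrix.mat (length b) (length b)
     (\<lambda>(i, j). vec.representation (set b) (c ! i) (b ! j))"

lemma orientation_sign_coord_mat: "orientation_sign b c = sgn (det (coord_mat b c))"
  by (simp add: orientation_sign_def coord_mat_def)

lemma coord_mat_carrier: "coord_mat b c \<in> carrier_mat (length b) (length b)"
  by (simp add: coord_mat_def)

lemma coord_mat_self:
  assumes "distinct b" "vec.independent (set b)"
  shows "coord_mat b b = 1\<^sub>m (length b)"
  unfolding coord_mat_def
  by (rule eq_matI) (auto simp: vec.representation_basis[OF assms(2)] nth_eq_iff_index_eq[OF assms(1)])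

lemma sum_representation_nth:
  assumes "distinct b" "vec.independent (set b)" "x \<in> vec.span (set b)"
  shows "x = (\<Sum>j<length b. vec.representation (set b) x (b ! j) *s b ! j)"
proof -
  have "x = (\<Sum>v\<in>set b. vec.representation (set b) x v *s v)"
    using vec.sum_representation_eq[OF assms(2,3), of "set b"] by simp
  also have "\<dots> = (\<Sum>j<length b. vec.representation (set b) x (b ! j) *s b ! j)"
    by (rule sum.reindex_bij_betw[OF bij_betw_nth[OF assms(1)], symmetric]) auto
  finally show ?thesis .
qed

text \<open>Coordinates are stored in rows, so replacing the vectors by combinations with
  coefficient matrix \<open>A\<close> multiplies from the left.\<close>

lemma coord_mat_transform:
  fixes b :: "('k::linordered_field ^ 'm::finite) list"
  assumes b: "vec.independent (set b)" and A: "A \<in> carrier_mat (length b) (length b)"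
    and c: "\<And>j. j < length b \<Longrightarrow> c ! j \<in> vec.span (set b)"
    and c': "\<And>i. i < length b \<Longrightarrow> c' ! i = (\<Sum>j<length b. A $$ (i, j) *s c ! j)"
  shows "coord_mat b c' = A * coord_mat b c"
proof (rule eq_matI)
  fix i k assume ik: "i < dim_row (A * coord_mat b c)" "k < dim_col (A * coord_mat b c)"
  then have ik: "i < length b" "k < length b" using A by (auto simp: coord_mat_def)
  have "vec.representation (set b) (c' ! i) (b ! k)
      = (\<Sum>j<length b. vec.representation (set b) (A $$ (i, j) *s c ! j) (b ! k))"
    unfolding c'[OF ik(1)]
    by (subst vec.representation_sum[OF b]) (auto intro!: vec.span_scale c)
  also have "\<dots> = (\<Sum>j<length b. A $$ (i, j) * vec.representation (set b) (c ! j) (b ! k))"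
    by (intro sum.cong refl) (simp add: vec.representation_scale[OF b c])
  finally show "coord_mat b c' $$ (i, k) = (A * coord_mat b c) $$ (i, k)"
    using A ik by (simp add: coord_mat_def scalar_prod_def atLeast0LessThan)
qed (use A in \<open>auto simp: coord_mat_def\<close>)

lemma det_first_column:
  fixes A :: "'k::comm_ring_1 mat"
  assumes A: "A \<in> carrier_mat (Suc n) (Suc n)" and 0: "\<And>i. i < n \<Longrightarrow> A $$ (Suc i, 0) = 0"
  shows "det A = A $$ (0, 0) * det (Matrix.mat n n (\<lambda>(i, j). A $$ (Suc i, Suc j)))"
proof -
  have "det A = (\<Sum>i<Suc n. A $$ (i, 0) * cofactor A i 0)"
    by (rule laplace_expansion_column[OF A]) simp
  also have "\<dots> = A $$ (0, 0) * cofactor A 0 0"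
    by (subst sum.lessThan_Suc_shift) (simp add: 0)
  also have "mat_delete A 0 0 = Matrix.mat n n (\<lambda>(i, j). A $$ (Suc i, Suc j))"
    using A by (auto simp: mat_delete_def intro!: eq_matI)
  then have "cofactor A 0 0 = det (Matrix.mat n n (\<lambda>(i, j). A $$ (Suc i, Suc j)))"
    by (simp add: cofactor_def)
  finally show ?thesis .
qed

text \<open>The transition from \<open>x # d\<close> to \<open>(\<mu> *s x + t) # c\<close> is block
  triangular with \<mu> in the corner. For \<open>c = d\<close> and positive \<mu> this shows that
  the incidence sign does not depend on the outward vector; for \<open>\<mu> = 1\<close> and
  \<open>t = 0\<close> it multiplies the signs of two successive facets.\<close>

lemma det_coord_mat_Cons:
  fixes b d :: "('k::linordered_field ^ 'm::finite) list"
  assumes b: "distinct b" "vec.independent (set b)"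
    and d: "distinct d" "vec.independent (set d)" "set d \<subseteq> vec.span (set b)"
    and len: "length b = Suc (length d)" "length c = length d"
    and x: "x \<in> vec.span (set b)" and c: "set c \<subseteq> vec.span (set d)"
    and t: "t \<in> vec.span (set d)"
  shows "det (coord_mat b ((\<mu> *s x + t) # c))
    = \<mu> * det (coord_mat d c) * det (coord_mat b (x # d))"
proof -
  let ?n = "length d"
  define A where "A = Matrix.mat (Suc ?n) (Suc ?n) (\<lambda>(i, j).
    case i of 0 \<Rightarrow> (case j of 0 \<Rightarrow> \<mu> | Suc j \<Rightarrow> vec.representation (set d) t (d ! j))
    | Suc i \<Rightarrow> (case j of 0 \<Rightarrow> 0 | Suc j \<Rightarrow> vec.representation (set d) (c ! i) (d ! j)))"
  have A: "A \<in> carrier_mat (length b) (length b)" by (simp add: A_def len)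
  have "coord_mat b ((\<mu> *s x + t) # c) = A * coord_mat b (x # d)"
  proof (rule coord_mat_transform[OF b(2) A])
    show "(x # d) ! j \<in> vec.span (set b)" if "j < length b" for j
      using that x d(3) len(1) by (cases j) auto
    fix i assume i: "i < length b"
    show "((\<mu> *s x + t) # c) ! i = (\<Sum>j<length b. A $$ (i, j) *s (x # d) ! j)"
    proof (cases i)
      case 0
      then show ?thesis
        unfolding len(1) by (subst sum.lessThan_Suc_shift)
          (simp add: A_def flip: sum_representation_nth[OF d(1,2) t])
    next
      case (Suc i')
      then have i': "i' < ?n" "c ! i' \<in> vec.span (set d)" using i len c by (auto simp: subset_iff)
      then show ?thesis
        unfolding len(1) Suc by (subst sum.lessThan_Suc_shift)
          (simp add: A_def flip: sum_representation_nth[OF d(1,2) i'(2)])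
    qed
  qed
  then have "det (coord_mat b ((\<mu> *s x + t) # c))
      = det A * det (coord_mat b (x # d))"
    using det_mult[OF A coord_mat_carrier] by simp
  also have "det A = \<mu> * det (coord_mat d c)"
  proof (subst det_first_column)
    show "A \<in> carrier_mat (Suc ?n) (Suc ?n)" by (simp add: A_def)
    show "A $$ (Suc i, 0) = 0" if "i < ?n" for i using that by (simp add: A_def)
    have "Matrix.mat ?n ?n (\<lambda>(i, j). A $$ (Suc i, Suc j)) = coord_mat d c"
      by (rule eq_matI) (auto simp: A_def coord_mat_def)
    then show "A $$ (0, 0) * det (Matrix.mat ?n ?n (\<lambda>(i, j). A $$ (Suc i, Suc j)))
        = \<mu> * det (coord_mat d c)"
      by (simp add: A_def)
  qed
  finally show ?thesis .
qed

text \<open>The coordinate matrices in the two directions multiply to the identity.\<close>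

lemma det_coord_mat_nonzero:
  fixes b c :: "('k::linordered_field ^ 'm::finite) list"
  assumes b: "distinct b" "vec.independent (set b)" and c: "distinct c" "vec.independent (set c)"
    and sp: "vec.span (set b) = vec.span (set c)" and len: "length b = length c"
  shows "det (coord_mat b c) \<noteq> 0"
proof -
  have cb: "coord_mat c b \<in> carrier_mat (length b) (length b)"
    using coord_mat_carrier[of c b] len by simp
  have "coord_mat b b = coord_mat c b * coord_mat b c"
  proof (rule coord_mat_transform[OF b(2) cb])
    show "c ! j \<in> vec.span (set b)" if "j < length b" for j
      using that len unfolding sp by (intro vec.span_base) auto
    fix i assume i: "i < length b"
    then have "b ! i \<in> vec.span (set c)" unfolding sp[symmetric] by (intro vec.span_base) auto
    from sum_representation_nth[OF c this]
    show "b ! i = (\<Sum>j<length b. coord_mat c b $$ (i, j) *s c ! j)"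
      using i len by (simp add: coord_mat_def)
  qed
  then have "det (coord_mat c b) * det (coord_mat b c) = 1"
    using det_mult[OF cb coord_mat_carrier[of b c]] by (metis coord_mat_self[OF b] det_one)
  then show ?thesis by auto
qed

lemma det_coord_mat_swap:
  assumes "2 \<le> length b"
  shows "det (coord_mat b (y # x # c)) = - det (coord_mat b (x # y # c))"
proof -
  have pos: "0 < length b" "Suc 0 < length b" using assms by auto
  have "coord_mat b (y # x # c) = swaprows 0 1 (coord_mat b (x # y # c))"
    using assms pos by (intro eq_matI) (auto simp: coord_mat_def nth_Cons')
  then show ?thesis
    using det_swaprows[OF _ _ _ coord_mat_carrier, of 0 b 1 "x # y # c"] assms pos by simp
qed

lemma orients_length:
  assumes "orients b \<sigma>"
  shows "length b = vec.dim \<sigma>"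
  using assms vec.dim_span[of "set b"] vec.dim_span[of \<sigma>] vec.dim_eq_card_independent[of "set b"]
  by (simp add: orients_def distinct_card)

lemma orients_Cons:
  assumes "orients d \<tau>" "cone_facet_of \<tau> \<sigma>" "u \<in> \<sigma>" "u \<notin> \<tau>"
  shows "orients (- u # d) \<sigma>"
proof -
  have \<tau>: "cone_face_of \<tau> \<sigma>" using assms(2) by (auto simp: cone_facet_of_def)
  have u: "- u \<notin> vec.span (set d)"
    using assms face_span_Int[OF \<tau>] vec.span_neg[of "- u" \<tau>] by (auto simp: orients_def)
  have "- u \<in> vec.span \<sigma>" using vec.span_neg[OF vec.span_base[OF assms(3)]] .
  moreover have "vec.span (set d) \<subseteq> vec.span \<sigma>"
    using assms(1) vec.span_mono[OF face_subset[OF \<tau>]] by (simp add: orients_def)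
  then have "set d \<subseteq> vec.span \<sigma>" using vec.span_superset by blast
  moreover have ind: "vec.independent (set (- u # d))" "- u \<notin> set d"
    using assms(1) u vec.span_base[of "- u" "set d"] by (auto simp: orients_def vec.independent_insert)
  moreover have "vec.dim (set (- u # d)) = vec.dim \<sigma>"
    using ind orients_length[OF assms(1)] assms(1,2) vec.dim_eq_card_independent[OF ind(1)]
    by (auto simp: orients_def cone_facet_of_def distinct_card)
  ultimately have "vec.span (set (- u # d)) = vec.span (vec.span \<sigma>)"
    by (intro vec.dim_eq_span) (auto simp: vec.dim_span)
  then show ?thesis using ind assms(1) by (auto simp: orients_def vec.span_span)
qed

text \<open>Two points \<open>u\<close>, \<open>v\<close> of \<open>\<sigma> - \<tau>\<close> agree
  modulo \<open>vec.span \<tau>\<close> up to a factor \<mu>, which is positive because the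
  functional exposing \<tau> is positive at both.\<close>

lemma incidence_sign_eq:
  assumes "orients (ori \<tau>) \<tau>" "orients (ori \<sigma>) \<sigma>" "cone_facet_of \<tau> \<sigma>" "u \<in> \<sigma>" "u \<notin> \<tau>"
  shows "incidence_sign ori \<tau> \<sigma> = orientation_sign (ori \<sigma>) (- u # ori \<tau>)"
proof -
  define v where "v = (SOME u. u \<in> \<sigma> - \<tau>)"
  have "v \<in> \<sigma> - \<tau>" unfolding v_def by (rule someI_ex) (use assms(4,5) in blast)
  then have v: "v \<in> \<sigma>" "v \<notin> \<tau>" by auto
  obtain f where f: "klinear f" "\<forall>x\<in>\<sigma>. 0 \<le> f x" "\<tau> = {x \<in> \<sigma>. f x = 0}"
    using assms(3) by (auto simp: cone_face_of_def cone_facet_of_def)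
  have pos: "0 < f u" "0 < f v" using f(2,3) assms(4,5) v by (auto simp: less_le)
  have "v \<in> vec.span (insert u \<tau>)"
    unfolding facet_span_insert[OF assms(3-5)] by (rule vec.span_base[OF v(1)])
  then obtain \<mu> where \<mu>: "v - \<mu> *s u \<in> vec.span \<tau>" by (auto simp: vec.span_breakdown_eq)
  have "f (v - \<mu> *s u) = 0" using klinear_vanishes_span[OF f(1) _ \<mu>] f(3) by auto
  then have "f v = \<mu> * f u" by (simp add: klinear_simps[OF f(1)])
  then have "0 < \<mu>" using pos by (simp add: zero_less_mult_iff)
  define t where "t = - (v - \<mu> *s u)"
  have d: "distinct (ori \<tau>)" "vec.independent (set (ori \<tau>))" "vec.span (set (ori \<tau>)) = vec.span \<tau>"
    and b: "distinct (ori \<sigma>)" "vec.independent (set (ori \<sigma>))" "vec.span (set (ori \<sigma>)) = vec.span \<sigma>"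
    using assms(1,2) by (auto simp: orients_def)
  have t: "t \<in> vec.span (set (ori \<tau>))" "- v = \<mu> *s (- u) + t"
    using vec.span_neg[OF \<mu>] by (auto simp: t_def d(3))
  have sub: "set (ori \<tau>) \<subseteq> vec.span (set (ori \<sigma>))"
  proof -
    have "set (ori \<tau>) \<subseteq> vec.span \<tau>" using d(3) vec.span_superset by blast
    also have "\<dots> \<subseteq> vec.span \<sigma>"
      using assms(3) by (intro vec.span_mono face_subset) (auto simp: cone_facet_of_def)
    finally show ?thesis by (simp add: b(3))
  qed
  have "det (coord_mat (ori \<sigma>) (- v # ori \<tau>))
      = \<mu> * det (coord_mat (ori \<tau>) (ori \<tau>)) * det (coord_mat (ori \<sigma>) (- u # ori \<tau>))"
    unfolding t(2)
  proof (rule det_coord_mat_Cons[OF b(1,2) d(1,2) sub])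
    show "length (ori \<sigma>) = Suc (length (ori \<tau>))"
      using assms(3) orients_length[OF assms(1)] orients_length[OF assms(2)] by (simp add: cone_facet_of_def)
    show "- u \<in> vec.span (set (ori \<sigma>))"
      unfolding b(3) by (rule vec.span_neg[OF vec.span_base[OF assms(4)]])
  qed (use t vec.span_superset in auto)
  then show ?thesis
    using \<open>0 < \<mu>\<close> unfolding incidence_sign_def v_def[symmetric]
    by (simp add: orientation_sign_coord_mat coord_mat_self[OF d(1,2)] sgn_mult)
qed

text \<open>Composing the two transitions puts both outward vectors in front of the orientation of
  \<tau>. The order of these two vectors is then all that distinguishes the paths across a
  diamond.\<close>

lemma incidence_sign_mult:
  assumes "orients (ori \<tau>) \<tau>" "orients (ori \<rho>) \<rho>" "orients (ori \<sigma>) \<sigma>"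
    and "cone_facet_of \<tau> \<rho>" "cone_facet_of \<rho> \<sigma>" "u \<in> \<rho>" "u \<notin> \<tau>" "w \<in> \<sigma>" "w \<notin> \<rho>"
  shows "incidence_sign ori \<tau> \<rho> * incidence_sign ori \<rho> \<sigma>
    = orientation_sign (ori \<sigma>) (- w # - u # ori \<tau>)"
proof -
  have c: "orients (- u # ori \<tau>) \<rho>" by (rule orients_Cons[OF assms(1,4,6,7)])
  have sub: "set (ori \<rho>) \<subseteq> vec.span (set (ori \<sigma>))"
  proof -
    have "set (ori \<rho>) \<subseteq> vec.span \<rho>" using assms(2) vec.span_superset by (auto simp: orients_def)
    also have "\<dots> \<subseteq> vec.span \<sigma>"
      using assms(5) by (intro vec.span_mono face_subset) (auto simp: cone_facet_of_def)
    finally show ?thesis using assms(3) by (simp add: orients_def)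
  qed
  have "det (coord_mat (ori \<sigma>) ((1 *s (- w) + 0) # (- u # ori \<tau>)))
      = 1 * det (coord_mat (ori \<rho>) (- u # ori \<tau>)) * det (coord_mat (ori \<sigma>) (- w # ori \<rho>))"
  proof (rule det_coord_mat_Cons[OF _ _ _ _ sub])
    show "length (ori \<sigma>) = Suc (length (ori \<rho>))" "length (- u # ori \<tau>) = length (ori \<rho>)"
      using assms(5) orients_length[OF c] orients_length[OF assms(2)] orients_length[OF assms(3)]
      by (simp_all add: cone_facet_of_def)
    show "- w \<in> vec.span (set (ori \<sigma>))"
      using assms(3,8) vec.span_neg[OF vec.span_base[OF assms(8)]] by (simp add: orients_def)
    show "set (- u # ori \<tau>) \<subseteq> vec.span (set (ori \<rho>))"
      using c assms(2) vec.span_superset[of "set (- u # ori \<tau>)"] unfolding orients_def by simp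
  qed (use assms(2,3) vec.span_zero in \<open>auto simp: orients_def\<close>)
  then show ?thesis
    using incidence_sign_eq[OF assms(1,2,4,6,7)] incidence_sign_eq[OF assms(2,3,5,8,9)]
    by (simp add: orientation_sign_coord_mat sgn_mult)
qed

text \<open>All that the later arguments use of orientations: signs square to 1, and the two paths
  across a diamond cancel, which is what makes the differential square to zero.\<close>

definition sign_system ::
  "('k::linordered_field ^ 'm::finite) set \<Rightarrow> (('k ^ 'm) set \<Rightarrow> ('k ^ 'm) set \<Rightarrow> 'k) \<Rightarrow> bool" where
  "sign_system \<sigma> eps \<longleftrightarrow>
     (\<forall>\<tau> \<rho>. cone_face_of \<rho> \<sigma> \<longrightarrow> cone_facet_of \<tau> \<rho> \<longrightarrow> eps \<tau> \<rho> * eps \<tau> \<rho> = 1) \<and>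
     (\<forall>\<tau> \<rho>. cone_face_of \<rho> \<sigma> \<longrightarrow> cone_face_of \<tau> \<rho> \<longrightarrow> vec.dim \<rho> = vec.dim \<tau> + 2 \<longrightarrow>
        (\<Sum>\<kappa>\<in>faces_between \<tau> \<rho>. eps \<tau> \<kappa> * eps \<kappa> \<rho>) = 0)"

lemma sign_system_incidence_sign:
  assumes "fg_cone \<sigma>" "\<forall>\<tau>\<in>face_fan \<sigma>. orients (ori \<tau>) \<tau>"
  shows "sign_system \<sigma> (incidence_sign ori)"
  unfolding sign_system_def
proof (intro conjI allI impI)
  have ori: "orients (ori \<tau>) \<tau>" if "cone_face_of \<tau> \<rho>" "cone_face_of \<rho> \<sigma>" for \<tau> \<rho>
    using assms(2) face_trans[OF assms(1) that(2,1)] by (auto simp: face_fan_def)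
  {
    fix \<tau> \<rho> assume \<rho>: "cone_face_of \<rho> \<sigma>" and \<tau>\<rho>: "cone_facet_of \<tau> \<rho>"
    have \<tau>: "cone_face_of \<tau> \<rho>" "\<tau> \<noteq> \<rho>" using \<tau>\<rho> by (auto simp: cone_facet_of_def)
    obtain u where u: "u \<in> \<rho>" "u \<notin> \<tau>" using \<tau> face_subset by blast
    have o: "orients (ori \<tau>) \<tau>" "orients (ori \<rho>) \<rho>"
      using ori \<tau>(1) \<rho> face_refl by blast+
    have o': "orients (- u # ori \<tau>) \<rho>" by (rule orients_Cons[OF o(1) \<tau>\<rho> u])
    have "det (coord_mat (ori \<rho>) (- u # ori \<tau>)) \<noteq> 0"
      using o(2) o' orients_length[OF o(2)] orients_length[OF o']
      by (intro det_coord_mat_nonzero) (auto simp: orients_def)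
    then show "incidence_sign ori \<tau> \<rho> * incidence_sign ori \<tau> \<rho> = 1"
      unfolding incidence_sign_eq[OF o \<tau>\<rho> u] orientation_sign_coord_mat by (auto simp: sgn_if)
  }
  fix \<tau> \<rho> assume \<rho>: "cone_face_of \<rho> \<sigma>" and \<tau>: "cone_face_of \<tau> \<rho>" and dim: "vec.dim \<rho> = vec.dim \<tau> + 2"
  obtain \<kappa>\<^sub>1 \<kappa>\<^sub>2 where \<kappa>: "\<kappa>\<^sub>1 \<noteq> \<kappa>\<^sub>2" "faces_between \<tau> \<rho> = {\<kappa>\<^sub>1, \<kappa>\<^sub>2}"
    by (rule diamond[OF fg_cone_face[OF assms(1) \<rho>] \<tau> dim])
  then have f: "cone_facet_of \<tau> \<kappa>\<^sub>1" "cone_facet_of \<kappa>\<^sub>1 \<rho>" "cone_facet_of \<tau> \<kappa>\<^sub>2" "cone_facet_of \<kappa>\<^sub>2 \<rho>"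
    by blast+
  have o: "orients (ori \<tau>) \<tau>" "orients (ori \<rho>) \<rho>" "orients (ori \<kappa>\<^sub>1) \<kappa>\<^sub>1" "orients (ori \<kappa>\<^sub>2) \<kappa>\<^sub>2"
    using ori \<rho> \<tau> f face_refl by (auto simp: cone_facet_of_def)
  \<comment> \<open>The two intermediate faces meet only in \<tau>. Hence \<open>u\<close> and
    \<open>w\<close> each lie off the other face, and the same two vectors serve for both paths, in
    opposite order.\<close>
  have meet: "x \<in> \<tau>" if "cone_facet_of \<tau> \<kappa>" "cone_facet_of \<kappa> \<rho>" "cone_facet_of \<tau> \<kappa>'" "cone_facet_of \<kappa>' \<rho>"
    "\<kappa> \<noteq> \<kappa>'" "x \<in> \<kappa>" "x \<in> \<kappa>'" for \<kappa> \<kappa>' x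
  proof -
    note faces = facetD[OF that(1)] facetD[OF that(2)] facetD[OF that(3)] facetD[OF that(4)]
    have "\<not> \<kappa> \<subseteq> \<kappa>'"
      using same_dim_face_eq[OF faces(4) _ faces(11)] faces(3,9) that(5) by auto
    from cover_Int[OF \<tau> faces(4,10) faces(2,8,3) this] show ?thesis using that(6,7) by blast
  qed
  obtain u w where u: "u \<in> \<kappa>\<^sub>1" "u \<notin> \<tau>" and w: "w \<in> \<kappa>\<^sub>2" "w \<notin> \<tau>"
  proof -
    have "\<tau> \<noteq> \<kappa>\<^sub>1" "\<tau> \<noteq> \<kappa>\<^sub>2" "\<tau> \<subseteq> \<kappa>\<^sub>1" "\<tau> \<subseteq> \<kappa>\<^sub>2"
      using f face_subset by (auto simp: cone_facet_of_def)
    then show ?thesis using that by blast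
  qed
  have uw: "u \<notin> \<kappa>\<^sub>2" "w \<notin> \<kappa>\<^sub>1" "u \<in> \<rho>" "w \<in> \<rho>"
    using meet[OF f(1,2,3,4) \<kappa>(1)] u w f face_subset by (auto simp: cone_facet_of_def)
  have "(\<Sum>\<kappa>\<in>faces_between \<tau> \<rho>. incidence_sign ori \<tau> \<kappa> * incidence_sign ori \<kappa> \<rho>)
      = incidence_sign ori \<tau> \<kappa>\<^sub>1 * incidence_sign ori \<kappa>\<^sub>1 \<rho> + incidence_sign ori \<tau> \<kappa>\<^sub>2 * incidence_sign ori \<kappa>\<^sub>2 \<rho>"
    unfolding \<kappa>(2) using \<kappa>(1) by simp
  also have "\<dots> = orientation_sign (ori \<rho>) (- w # - u # ori \<tau>) + orientation_sign (ori \<rho>) (- u # - w # ori \<tau>)"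
    using incidence_sign_mult[OF o(1,3,2) f(1,2) u uw(4,2)] incidence_sign_mult[OF o(1,4,2) f(3,4) w uw(3,1)]
    by simp
  also have "\<dots> = 0"
    using det_coord_mat_swap[of "ori \<rho>" "- w" "- u" "ori \<tau>"] orients_length[OF o(2)] dim
    by (simp add: orientation_sign_coord_mat sgn_minus)
  finally show "(\<Sum>\<kappa> | cone_facet_of \<tau> \<kappa> \<and> cone_facet_of \<kappa> \<rho>.
      incidence_sign ori \<tau> \<kappa> * incidence_sign ori \<kappa> \<rho>) = 0" .
qed


section \<open>Exactness of the complex of faces containing a given face\<close>

lemma facet_face: "fg_cone C \<Longrightarrow> cone_face_of s C \<Longrightarrow> cone_facet_of t s \<Longrightarrow> cone_face_of t C"
  by (rule face_trans[OF _ _ facetD(1)])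

lemma facet_between:
  assumes "cone_face_of t C" "t \<subseteq> s" "s \<subseteq> C" "vec.dim s = vec.dim t + 1"
  shows "cone_facet_of t s"
  using assms face_between by (auto simp: cone_facet_of_def)

lemma facets_containing_facet:
  assumes "cone_facet_of G F"
  shows "facets_over G F = {G}"
proof -
  have "G = t" if "cone_facet_of t F" "G \<subseteq> t" for t
    using same_dim_face_eq[OF facetD(1)[OF assms] that(2) facetD(2)[OF that(1)]]
      facetD(3)[OF assms] facetD(3)[OF that(1)] by simp
  then show ?thesis using assms by blast
qed

lemma finite_facets: "fg_cone s \<Longrightarrow> finite {t. cone_facet_of t s \<and> P t}"
  by (rule finite_subset[OF _ finite_faces]) (auto simp: cone_facet_of_def)

text \<open>Both sides run over the flags \<open>k < t < s\<close> above \<open>G\<close>, grouped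
  by the middle face on the left and by the lowest one on the right.\<close>

lemma sum_facets_swap:
  fixes w :: "('k::linordered_field ^ 'm::finite) set \<Rightarrow> ('k ^ 'm) set \<Rightarrow> 'b::comm_monoid_add"
  assumes "fg_cone s"
  shows "(\<Sum>t\<in>facets_over G s. \<Sum>k\<in>facets_over G t. w k t) =
    (\<Sum>k | cone_face_of k s \<and> G \<subseteq> k \<and> vec.dim s = vec.dim k + 2.
      \<Sum>t\<in>faces_between k s. w k t)"
proof -
  let ?A = "facets_over G s"
  let ?B = "{k. cone_face_of k s \<and> G \<subseteq> k \<and> vec.dim s = vec.dim k + 2}"
  have fin: "finite ?A" "finite ?B"
    using finite_facets[OF assms] by (auto intro: finite_subset[OF _ finite_faces[OF assms]])
  have "facets_over G t = {k. k \<in> ?B \<and> cone_facet_of k t}" if "t \<in> ?A" for t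
  proof -
    have t: "cone_facet_of t s" using that by simp
    have "cone_face_of k s \<and> vec.dim s = vec.dim k + 2" if "cone_facet_of k t" for k
      using facet_face[OF assms facetD(1)[OF t] that] facetD(3)[OF that] facetD(3)[OF t] by simp
    then show ?thesis by blast
  qed
  then have "(\<Sum>t\<in>?A. \<Sum>k\<in>facets_over G t. w k t)
      = (\<Sum>t\<in>?A. \<Sum>k | k \<in> ?B \<and> cone_facet_of k t. w k t)"
    by (intro sum.cong refl) simp_all
  also have "\<dots> = (\<Sum>k\<in>?B. \<Sum>t | t \<in> ?A \<and> cone_facet_of k t. w k t)"
    by (rule sum.swap_restrict[OF fin])
  also have "\<dots> = (\<Sum>k\<in>?B. \<Sum>t\<in>faces_between k s. w k t)"
  proof (rule sum.cong[OF refl])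
    fix k assume "k \<in> ?B"
    then have "{t. t \<in> ?A \<and> cone_facet_of k t} = faces_between k s"
      using facetD(2) by blast
    then show "(\<Sum>t | t \<in> ?A \<and> cone_facet_of k t. w k t)
        = (\<Sum>t\<in>faces_between k s. w k t)" by simp
  qed
  finally show ?thesis .
qed

lemma sign_systemD:
  assumes "sign_system C eps" "cone_face_of s C"
  shows "cone_facet_of t s \<Longrightarrow> eps t s * eps t s = 1"
    and "cone_face_of t s \<Longrightarrow> vec.dim s = vec.dim t + 2 \<Longrightarrow>
      (\<Sum>k\<in>faces_between t s. eps t k * eps k s) = 0"
  using assms unfolding sign_system_def by blast+

lemma sign_system_face:
  assumes "sign_system C eps" "fg_cone C" "cone_face_of s C"
  shows "sign_system s eps"
  unfolding sign_system_def
proof (intro conjI allI impI)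
  fix t k assume "cone_face_of k s"
  then have k: "cone_face_of k C" by (rule face_trans[OF assms(2,3)])
  show "eps t k * eps t k = 1" if "cone_facet_of t k"
    using sign_systemD(1)[OF assms(1) k that] .
  show "(\<Sum>\<mu>\<in>faces_between t k. eps t \<mu> * eps \<mu> k) = 0"
    if "cone_face_of t k" "vec.dim k = vec.dim t + 2"
    using sign_systemD(2)[OF assms(1) k that] .
qed

text \<open>After regrouping by \<open>k\<close>, the coefficient of \<open>g k\<close> is a diamond
  sum. For \<open>G = {}\<close> this is the full complex, otherwise the star of
  \<open>G\<close>.\<close>

lemma coboundary_closed:
  assumes "fg_cone C" "sign_system C eps" "cone_face_of s C"
  shows "(\<Sum>t\<in>facets_over G s. eps t s * (\<Sum>k\<in>facets_over G t. eps k t * g k)) = 0"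
proof -
  have "(\<Sum>t\<in>facets_over G s. eps t s * (\<Sum>k\<in>facets_over G t. eps k t * g k))
    = (\<Sum>t\<in>facets_over G s. \<Sum>k\<in>facets_over G t. eps k t * eps t s * g k)"
    by (simp add: sum_distrib_left mult_ac)
  also have "\<dots> = (\<Sum>k | cone_face_of k s \<and> G \<subseteq> k \<and> vec.dim s = vec.dim k + 2.
      \<Sum>t\<in>faces_between k s. eps k t * eps t s * g k)"
    by (rule sum_facets_swap[OF fg_cone_face[OF assms(1,3)]])
  also have "\<dots> = (\<Sum>k | cone_face_of k s \<and> G \<subseteq> k \<and> vec.dim s = vec.dim k + 2. 0)"
    by (intro sum.cong refl)
      (simp add: sum_distrib_right[symmetric] sign_systemD(2)[OF assms(2,3)])
  finally show ?thesis by simp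
qed

text \<open>The part of the star of \<open>G\<close> that lies, off \<open>G\<close>, strictly below
  the hyperplane \<open>h = 0\<close>. It is the whole star if \<open>- h\<close> exposes
  \<open>G\<close>, and the sweep reduces it to smaller parts.\<close>

definition neg_faces ::
  "('k::linordered_field ^ 'm::finite) set \<Rightarrow> ('k ^ 'm) set \<Rightarrow> ('k ^ 'm \<Rightarrow> 'k) \<Rightarrow> ('k ^ 'm) set set" where
  "neg_faces C G h = {t. cone_face_of t C \<and> G \<subseteq> t \<and> (\<forall>x\<in>t - G. h x < 0)}"

lemma finite_neg_faces: "fg_cone C \<Longrightarrow> finite (neg_faces C G h)"
  by (rule finite_subset[OF _ finite_faces]) (auto simp: neg_faces_def)

lemma neg_faces_facet:
  assumes "fg_cone C" "s \<in> neg_faces C G h" "cone_facet_of t s" "G \<subseteq> t"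
  shows "t \<in> neg_faces C G h"
proof -
  have "cone_face_of t C" "t \<subseteq> s"
    using assms(2) facet_face[OF assms(1) _ assms(3)] facetD(2)[OF assms(3)] by (auto simp: neg_faces_def)
  then show ?thesis using assms(2,4) by (auto simp: neg_faces_def)
qed

text \<open>
  A sweep: the functional \<open>h\<close> is tilted until it vanishes on the face \<open>r\<close> with the largest slope
  \<open>h / f\<close>, where \<open>f\<close> exposes \<open>G\<close>; a functional exposing \<open>r\<close> breaks the ties.
\<close>

lemma neg_faces_peel:
  assumes C: "fg_cone C" and G: "cone_face_of G C" and h: "klinear h" "\<forall>x\<in>G. h x = 0"
    and ne: "t \<in> neg_faces C G h" "t \<noteq> G"
  obtains r h' where "cone_facet_of G r" "r \<in> neg_faces C G h" "klinear h'" "\<forall>x\<in>r. h' x = 0"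
    "neg_faces C G h' = {t \<in> neg_faces C G h. \<not> r \<subseteq> t}"
    "neg_faces C r h' = {t \<in> neg_faces C G h. r \<subseteq> t}"
proof -
  obtain f where f: "klinear f" "\<forall>x\<in>C. 0 \<le> f x" "G = {x \<in> C. f x = 0}"
    using G by (auto simp: cone_face_of_def)
  have fpos: "0 < f x" if "x \<in> C" "x \<notin> G" for x
    using that f(2,3) by (auto simp: less_le)
  define N where "N = neg_faces C G h - {G}"
  have N: "cone_face_of t C" "G \<subseteq> t" "t \<noteq> G" "\<And>x. x \<in> t \<Longrightarrow> x \<notin> G \<Longrightarrow> h x < 0" if "t \<in> N" for t
    using that by (auto simp: N_def neg_faces_def)
  note mh = klinear_minus[OF h(1)]
  define Q where "Q = (\<lambda>t \<theta>. (\<forall>x\<in>t. \<theta> * f x \<le> - h x) \<and> (\<exists>x\<in>t. f x \<noteq> 0 \<and> - h x = \<theta> * f x) \<and>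
      cone_face_of {x \<in> t. - h x = \<theta> * f x} t)"
  have ex: "\<exists>\<theta>. Q t \<theta>" if t: "t \<in> N" for t
  proof -
    have sub: "t \<subseteq> C" by (rule face_subset[OF N(1)[OF t]])
    have 1: "\<forall>x\<in>t. 0 \<le> f x" using f(2) sub by blast
    have 2: "\<forall>x\<in>t. f x = 0 \<longrightarrow> - h x = 0" using f(3) h(2) sub by auto
    obtain x where x: "x \<in> t" "x \<notin> G" using N(2)[OF t] N(3)[OF t] by blast
    then have "f x \<noteq> 0" using fpos[of x] sub by auto
    then obtain \<theta> where "\<forall>x\<in>t. \<theta> * f x \<le> - h x" "\<exists>x\<in>t. f x \<noteq> 0 \<and> - h x = \<theta> * f x"
      "cone_face_of {x \<in> t. - h x = \<theta> * f x} t"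
      by (rule min_ratio_face[OF fg_cone_face[OF C N(1)[OF t]] f(1) 1 mh 2 x(1)])
    then show ?thesis unfolding Q_def by blast
  qed
  define \<Theta> where "\<Theta> = (\<lambda>t. SOME \<theta>. Q t \<theta>)"
  have "Q t (\<Theta> t)" if "t \<in> N" for t
    unfolding \<Theta>_def by (rule someI_ex[OF ex[OF that]])
  note \<Theta> = this[unfolded Q_def]
  have "finite N" "t \<in> N" using finite_neg_faces[OF C] ne by (auto simp: N_def)
  then have fin: "finite (\<Theta> ` N)" "\<Theta> ` N \<noteq> {}" by auto
  define \<theta> where "\<theta> = Min (\<Theta> ` N)"
  obtain t\<^sub>0 where t0: "t\<^sub>0 \<in> N" "\<Theta> t\<^sub>0 = \<theta>"
    using Min_in[OF fin] unfolding \<theta>_def by auto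
  have \<theta>le: "\<theta> * f x \<le> - h x" if "t \<in> N" "x \<in> t" for t x
  proof -
    have "\<theta> \<le> \<Theta> t" unfolding \<theta>_def using fin(1) that(1) by (intro Min_le) auto
    moreover have "0 \<le> f x" using f(2) face_subset[OF N(1)[OF that(1)]] that(2) by blast
    ultimately have "\<theta> * f x \<le> \<Theta> t * f x" by (rule mult_right_mono)
    also have "\<dots> \<le> - h x" using \<Theta>[OF that(1)] that(2) by blast
    finally show ?thesis .
  qed
  \<comment> \<open>Besides \<open>G\<close>, \<open>R\<close> consists of the points of
    \<open>t\<^sub>0\<close> with the least ratio \<open>- h / f\<close>. Any cover of
    \<open>G\<close> inside \<open>R\<close> can be peeled off.\<close>
  define R where "R = {x \<in> t\<^sub>0. - h x = \<theta> * f x}"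
  have t0': "cone_face_of t\<^sub>0 C" "G \<subseteq> t\<^sub>0" "t\<^sub>0 \<subseteq> C" using N(1,2)[OF t0(1)] face_subset[of t\<^sub>0 C] by auto
  have R: "cone_face_of R t\<^sub>0" "R \<subseteq> t\<^sub>0" using \<Theta>[OF t0(1)] t0(2) by (auto simp: R_def)
  have GR: "G \<subseteq> R" using t0'(2) h(2) f(3) by (auto simp: R_def)
  obtain p where p: "p \<in> t\<^sub>0" "f p \<noteq> 0" "- h p = \<theta> * f p" using \<Theta>[OF t0(1)] t0(2) by auto
  then have "p \<notin> G" using f(3) by blast
  then have "0 < f p" "h p < 0" using fpos p(1) t0' N(4)[OF t0(1)] by auto
  then have "0 < \<theta> * f p" "0 < f p" using p(3) by simp_all
  then have \<theta>: "0 < \<theta>" by (simp add: zero_less_mult_iff)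
  have "p \<in> R" using p by (auto simp: R_def)
  then have "G \<noteq> R" using \<open>p \<notin> G\<close> by blast
  have fgR: "fg_cone R" using fg_cone_face[OF fg_cone_face[OF C t0'(1)] R(1)] .
  have "cone_face_of G R" by (rule face_between[OF G GR]) (use R(2) t0'(3) in auto)
  from exists_cover[OF fgR this \<open>G \<noteq> R\<close>] obtain r where
    r: "cone_face_of r R" "G \<subseteq> r" "vec.dim r = vec.dim G + 1" by blast
  have "cone_face_of r t\<^sub>0" by (rule face_trans[OF fg_cone_face[OF C t0'(1)] R(1) r(1)])
  then have rC: "cone_face_of r C" by (rule face_trans[OF C t0'(1)])
  then have rsub: "r \<subseteq> C" by (rule face_subset)
  have Gr: "cone_facet_of G r" by (rule facet_between[OF G r(2) rsub r(3)])
  have hr: "h x = - \<theta> * f x" if "x \<in> r" for x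
  proof -
    have "- h x = \<theta> * f x" using that face_subset[OF r(1)] by (auto simp: R_def)
    then have "h x = - (\<theta> * f x)" by (metis minus_minus)
    then show ?thesis by simp
  qed
  obtain e where e: "klinear e" "\<forall>x\<in>C. 0 \<le> e x" "r = {x \<in> C. e x = 0}"
    using rC by (auto simp: cone_face_of_def)
  \<comment> \<open>A bound for the ratio \<open>e / f\<close>: the negative of the least ratio of
    \<open>- e\<close> to \<open>f\<close>.\<close>
  obtain M where M: "0 \<le> M" "\<And>x. x \<in> C \<Longrightarrow> e x \<le> M * f x"
  proof -
    note me = klinear_minus[OF e(1)]
    have 0: "\<forall>x\<in>C. f x = 0 \<longrightarrow> - e x = 0" using f(3) e(3) r(2) by auto
    have "p \<in> C" using p(1) t0'(3) by blast
    obtain \<eta> where \<eta>: "\<forall>x\<in>C. \<eta> * f x \<le> - e x" "\<exists>x\<in>C. f x \<noteq> 0 \<and> - e x = \<eta> * f x"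
      by (rule min_ratio_face[OF C f(1,2) me 0 \<open>p \<in> C\<close> p(2)])
    obtain q where q: "q \<in> C" "f q \<noteq> 0" "- e q = \<eta> * f q" using \<eta>(2) by blast
    have "0 < f q" "0 \<le> e q" using f(2) e(2) q by (auto simp: less_le)
    then have "\<eta> \<le> 0" using q(3) mult_pos_pos[of \<eta> "f q"] by linarith
    show ?thesis
    proof (rule that[of "- \<eta>"])
      show "e x \<le> - \<eta> * f x" if "x \<in> C" for x
        using \<eta>(1) that by force
    qed (use \<open>\<eta> \<le> 0\<close> in simp)
  qed
  define u where "u = (\<lambda>x. 1 * h x + \<theta> * f x)"
  have u: "klinear u" unfolding u_def by (rule klinear_combination[OF h(1) f(1)])
  \<comment> \<open>On \<open>r\<close> both \<open>u\<close> and \<open>e\<close> vanish; on the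
    rest of the negative faces \<open>u \<le> 0\<close> and \<open>e > 0\<close>. Where
    \<open>h \<ge> 0\<close> off \<open>G\<close>, the factor \<open>M + 1\<close> leaves at least
    \<open>\<theta> * f > 0\<close> after \<open>\<theta> * e\<close> is subtracted, so no new face
    becomes negative.\<close>
  define h' where "h' = (\<lambda>x. (M + 1) * u x + (- \<theta>) * e x)"
  have h': "klinear h'" unfolding h'_def by (rule klinear_combination[OF u e(1)])
  have h'r: "h' x = 0" if "x \<in> r" for x
    using that e(3) by (simp add: h'_def u_def hr[OF that])
  have h'neg: "h' x < 0" if "t \<in> neg_faces C G h" "x \<in> t" "x \<notin> r" for t x
  proof -
    have "x \<notin> G" using that(3) r(2) by blast
    then have "t \<in> N" using that(1,2) by (auto simp: N_def)
    then have "u x \<le> 0" using \<theta>le[OF _ that(2)] by (fastforce simp: u_def)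
    moreover have "x \<in> C" using face_subset[OF N(1)[OF \<open>t \<in> N\<close>]] that(2) by blast
    then have "0 < e x" using e(2,3) that(3) by (auto simp: less_le)
    ultimately have "(M + 1) * u x \<le> 0" "0 < \<theta> * e x"
      using M(1) \<theta> by (auto intro!: mult_nonneg_nonpos)
    then show ?thesis by (simp add: h'_def)
  qed
  have h'pos: "0 < h' x" if "x \<in> C" "x \<notin> G" "0 \<le> h x" for x
  proof -
    have "\<theta> * e x \<le> \<theta> * (M * f x)" using M(2)[OF that(1)] \<theta> by (intro mult_left_mono) auto
    moreover have "0 \<le> (M + 1) * h x" using M(1) that(3) by (intro mult_nonneg_nonneg) auto
    moreover have "0 < \<theta> * f x" using \<theta> fpos[OF that(1,2)] by simp
    ultimately show ?thesis by (simp add: h'_def u_def algebra_simps)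
  qed
  have hneg: "h x < 0" if "x \<in> C" "x \<notin> G" "h' x < 0 \<or> x \<in> r" for x
    using h'pos[OF that(1,2)] h'r[of x] that(3) by force
  have meet: "x \<notin> r" if "cone_face_of t C" "G \<subseteq> t" "\<not> r \<subseteq> t" "x \<in> t" "x \<notin> G" for t x
    using cover_Int[OF G rC that(1) r(2) that(2) r(3) that(3)] that(4,5) by blast
  show ?thesis
  proof (rule that[OF Gr _ h'])
    show "r \<in> neg_faces C G h"
      using rC r(2) hneg rsub by (auto simp: neg_faces_def)
    show "\<forall>x\<in>r. h' x = 0" using h'r by blast
    show "neg_faces C G h' = {t \<in> neg_faces C G h. \<not> r \<subseteq> t}"
    proof (intro equalityI subsetI)
      fix t assume t: "t \<in> neg_faces C G h'"
      then have t': "cone_face_of t C" "G \<subseteq> t" "\<forall>x\<in>t - G. h' x < 0" "t \<subseteq> C"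
        using face_subset[of t C] by (auto simp: neg_faces_def)
      have "\<not> r \<subseteq> t"
      proof
        assume "r \<subseteq> t"
        have "r \<noteq> G" using r(3) by auto
        then obtain x where "x \<in> r" "x \<notin> G" using r(2) by blast
        then show False using t'(3) h'r[of x] \<open>r \<subseteq> t\<close> by force
      qed
      then show "t \<in> {t \<in> neg_faces C G h. \<not> r \<subseteq> t}"
        using t' hneg by (auto simp: neg_faces_def)
    next
      fix t assume "t \<in> {t \<in> neg_faces C G h. \<not> r \<subseteq> t}"
      then have t: "t \<in> neg_faces C G h" "cone_face_of t C" "G \<subseteq> t" "\<not> r \<subseteq> t"
        by (auto simp: neg_faces_def)
      show "t \<in> neg_faces C G h'"
        using t(2,3) h'neg[OF t(1)] meet[OF t(2-4)] by (auto simp: neg_faces_def)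
    qed
    show "neg_faces C r h' = {t \<in> neg_faces C G h. r \<subseteq> t}"
    proof (intro equalityI subsetI)
      fix t assume "t \<in> neg_faces C r h'"
      then have t': "cone_face_of t C" "r \<subseteq> t" "\<forall>x\<in>t - r. h' x < 0" "t \<subseteq> C"
        using face_subset[of t C] by (auto simp: neg_faces_def)
      then show "t \<in> {t \<in> neg_faces C G h. r \<subseteq> t}"
        using hneg r(2) by (auto simp: neg_faces_def)
    next
      fix t assume "t \<in> {t \<in> neg_faces C G h. r \<subseteq> t}"
      then have t: "t \<in> neg_faces C G h" "cone_face_of t C" "r \<subseteq> t"
        by (auto simp: neg_faces_def)
      show "t \<in> neg_faces C r h'"
        using t(2,3) h'neg[OF t(1)] by (auto simp: neg_faces_def)
    qed
  qed
qed

text \<open>Double induction, on the degree and on the number of negative faces. On the negative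
  faces without \<open>r\<close> the inner induction gives a solution. After its coboundary is
  subtracted, the cochain lives on the faces containing \<open>r\<close>, so it is a closed cochain
  on the star of \<open>r\<close>, of one degree less. As \<open>G\<close> itself belongs to the
  complex, the complex is augmented and exactness starts at the covers, where
  \<open>j = 1\<close>.\<close>

lemma neg_star_exact:
  assumes C: "fg_cone C" and eps: "sign_system C eps" and "1 \<le> j"
    and "cone_face_of G C" "klinear h" "\<forall>x\<in>G. h x = 0"
    and "\<And>s. s \<in> neg_faces C G h \<Longrightarrow> vec.dim s = vec.dim G + j + 1 \<Longrightarrow>
      (\<Sum>t\<in>facets_over G s. eps t s * y t) = 0"
  shows "\<exists>g. \<forall>t\<in>neg_faces C G h. vec.dim t = vec.dim G + j \<longrightarrow>
      y t = (\<Sum>k\<in>facets_over G t. eps k t * g k)"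
  using assms(3-)
proof (induction j arbitrary: G h y)
  case 0
  then show ?case by simp
next
  case (Suc j)
  note outer = Suc.IH
  from Suc.prems(2-) show ?case
  proof (induction "card (neg_faces C G h)" arbitrary: h y rule: less_induct)
    case less
    note G = less.prems(1) and h = less.prems(2,3) and closed = less.prems(4)
    show ?case
    proof (cases "\<exists>t\<in>neg_faces C G h. t \<noteq> G")
      case False
      have "vec.dim t \<noteq> vec.dim G + Suc j" if "t \<in> neg_faces C G h" for t
        using False that by auto
      then show ?thesis by blast
    next
      case True
      then obtain t\<^sub>1 where "t\<^sub>1 \<in> neg_faces C G h" "t\<^sub>1 \<noteq> G" by blast
      then obtain r h' where r: "cone_facet_of G r" "r \<in> neg_faces C G h"
        and h': "klinear h'" "\<forall>x\<in>r. h' x = 0"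
        and N': "neg_faces C G h' = {t \<in> neg_faces C G h. \<not> r \<subseteq> t}"
        and Nr: "neg_faces C r h' = {t \<in> neg_faces C G h. r \<subseteq> t}"
        by (rule neg_faces_peel[OF C G h])
      let ?N = "neg_faces C G h" and ?N' = "neg_faces C G h'"
      have rC: "cone_face_of r C" and Gr: "G \<subseteq> r" "vec.dim r = vec.dim G + 1"
        using r facetD[OF r(1)] by (auto simp: neg_faces_def)
      have Nface: "cone_face_of t C" "G \<subseteq> t" if "t \<in> ?N" for t
        using that by (auto simp: neg_faces_def)
      have card: "card ?N' < card ?N"
        using r(2) by (intro psubset_card_mono finite_neg_faces[OF C]) (auto simp: N')
      have h'G: "\<forall>x\<in>G. h' x = 0" using h'(2) Gr(1) by blast
      obtain g\<^sub>1 where g1: "\<forall>t\<in>?N'. vec.dim t = vec.dim G + Suc j \<longrightarrow>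
          y t = (\<Sum>k\<in>facets_over G t. eps k t * g\<^sub>1 k)"
        using less.hyps[OF card G h'(1) h'G closed] by (auto simp: N')
      \<comment> \<open>Extension by 0. The coboundary on faces without \<open>r\<close> is
        unchanged, because their facets over \<open>G\<close> do not contain \<open>r\<close>
        either.\<close>
      define g\<^sub>1' where "g\<^sub>1' = (\<lambda>k. if k \<in> ?N' then g\<^sub>1 k else 0)"
      define y' where "y' = (\<lambda>t. y t - (\<Sum>k\<in>facets_over G t. eps k t * g\<^sub>1' k))"
      have y'0: "y' t = 0" if "t \<in> ?N'" "vec.dim t = vec.dim G + Suc j" for t
      proof -
        have "(\<Sum>k\<in>facets_over G t. eps k t * g\<^sub>1' k)
            = (\<Sum>k\<in>facets_over G t. eps k t * g\<^sub>1 k)"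
          using neg_faces_facet[OF C that(1)] by (intro sum.cong refl) (auto simp: g\<^sub>1'_def)
        then show ?thesis using g1 that by (simp add: y'_def)
      qed
      have y'closed: "(\<Sum>t\<in>facets_over r s. eps t s * y' t) = 0"
        if "s \<in> neg_faces C r h'" "vec.dim s = vec.dim G + Suc j + 1" for s
      proof -
        have s: "s \<in> ?N" "cone_face_of s C" using that Nr Nface by auto
        have "(\<Sum>t\<in>facets_over r s. eps t s * y' t)
            = (\<Sum>t\<in>facets_over G s. eps t s * y' t)"
        proof (rule sum.mono_neutral_left)
          show "finite (facets_over G s)"
            by (rule finite_facets[OF fg_cone_face[OF C s(2)]])
          show "\<forall>t\<in>facets_over G s - facets_over r s. eps t s * y' t = 0"
          proof
            fix t assume "t \<in> facets_over G s - facets_over r s"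
            then have t: "cone_facet_of t s" "G \<subseteq> t" "\<not> r \<subseteq> t" by auto
            then have "t \<in> ?N'" using neg_faces_facet[OF C s(1)] by (simp add: N')
            moreover have "vec.dim t = vec.dim G + Suc j" using facetD(3)[OF t(1)] that(2) by simp
            ultimately show "eps t s * y' t = 0" using y'0 by simp
          qed
        qed (use Gr(1) in auto)
        also have "\<dots> = 0"
          using closed[OF s(1) that(2)] coboundary_closed[OF C eps s(2), where G = G and g = g\<^sub>1']
          by (simp add: y'_def right_diff_distrib sum_subtractf)
        finally show ?thesis .
      qed
      show ?thesis
      proof (cases "j = 0")
        case True
        have level: "t = r" if "t \<in> ?N" "vec.dim t = vec.dim G + 1" "r \<subseteq> t" for t
          using face_dim_eqD[OF face_between[OF rC that(3) face_subset[OF Nface(1)[OF that(1)]]]]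
            that(2) Gr(2) by simp
        show ?thesis
        proof (cases "\<exists>t\<in>?N. vec.dim t = vec.dim G + 1 \<and> t \<noteq> r")
          case True
          then obtain t\<^sub>2 where t2: "t\<^sub>2 \<in> ?N" "vec.dim t\<^sub>2 = vec.dim G + 1" "t\<^sub>2 \<noteq> r" by blast
          then have t2': "t\<^sub>2 \<in> ?N'" using level by (auto simp: N')
          have "G \<noteq> t\<^sub>2" using t2(2) by auto
          then obtain x where x: "x \<in> t\<^sub>2" "x \<notin> G" using Nface(2)[OF t2(1)] by blast
          then have "x \<in> C" "h' x < 0"
            using t2' face_subset[OF Nface(1)[OF t2(1)]] by (auto simp: neg_faces_def)
          \<comment> \<open>A second cover of \<open>G\<close> makes \<open>h'\<close> negative
            somewhere, hence on a cover \<open>F\<close> of \<open>r\<close>. Closedness at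
            \<open>F\<close> over \<open>r\<close> has the single term \<open>y' r\<close>.\<close>
          from exists_negative_cover[OF C rC h' this] obtain F where
            F: "F \<in> neg_faces C r h'" "vec.dim F = vec.dim r + 1" "r \<subseteq> F" "cone_face_of F C"
            by (auto simp: neg_faces_def)
          have rF: "cone_facet_of r F"
            by (rule facet_between[OF rC F(3) face_subset[OF F(4)] F(2)])
          have "eps r F * y' r = 0"
            using y'closed[OF F(1)] F(2) Gr(2) \<open>j = 0\<close> by (simp add: facets_containing_facet[OF rF])
          moreover have "eps r F \<noteq> 0" using sign_systemD(1)[OF eps F(4) rF] by auto
          ultimately have "y' r = 0" by simp
          have "y' t = 0" if "t \<in> ?N" "vec.dim t = vec.dim G + Suc j" for t
            using y'0[of t] level[of t] that \<open>j = 0\<close> \<open>y' r = 0\<close> by (cases "r \<subseteq> t") (auto simp: N')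
          then show ?thesis by (intro exI[of _ g\<^sub>1']) (auto simp: y'_def)
        next
          case False
          \<comment> \<open>If \<open>r\<close> is the only cover, the value at \<open>G\<close> is
            solved for from the value at \<open>r\<close>; the sign squares to 1.\<close>
          have "y r = (\<Sum>k\<in>facets_over G r. eps k r * (eps G r * y r))"
            using sign_systemD(1)[OF eps rC r(1)]
            by (simp add: facets_containing_facet[OF r(1)] mult.assoc[symmetric])
          moreover have "t = r" if "t \<in> ?N" "vec.dim t = vec.dim G + Suc j" for t
            using False that \<open>j = 0\<close> by auto
          ultimately show ?thesis by (intro exI[of _ "\<lambda>_. eps G r * y r"]) auto
        qed
      next
        case False
        obtain g\<^sub>2 where g2: "\<forall>t\<in>neg_faces C r h'. vec.dim t = vec.dim r + j \<longrightarrow>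
            y' t = (\<Sum>k\<in>facets_over r t. eps k t * g\<^sub>2 k)"
          using outer[where y = y', OF _ rC h'] y'closed False Gr(2) by auto
        define g where "g = (\<lambda>k. g\<^sub>1' k + (if r \<subseteq> k then g\<^sub>2 k else 0))"
        have "y t = (\<Sum>k\<in>facets_over G t. eps k t * g k)"
          if t: "t \<in> ?N" "vec.dim t = vec.dim G + Suc j" for t
        proof -
          have fin: "finite (facets_over G t)"
            by (rule finite_facets[OF fg_cone_face[OF C Nface(1)[OF t(1)]]])
          have "(\<Sum>k\<in>facets_over G t. eps k t * (if r \<subseteq> k then g\<^sub>2 k else 0))
              = (\<Sum>k\<in>facets_over r t. eps k t * g\<^sub>2 k)"
            using fin Gr(1) by (intro sum.mono_neutral_cong_right) auto
          also have "\<dots> = y' t"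
          proof (cases "r \<subseteq> t")
            case True
            then show ?thesis using g2 t Gr(2) by (simp add: Nr)
          next
            case False
            then have empty: "facets_over r t = {}" using facetD(2) by blast
            show ?thesis unfolding empty using y'0[of t] False t by (simp add: N')
          qed
          finally show ?thesis
            by (simp add: g_def distrib_left sum.distrib y'_def)
        qed
        then show ?thesis by blast
      qed
    qed
  qed
qed

text \<open>The sweep starts with the negative of a functional exposing \<open>G\<close>, for which
  every face over \<open>G\<close> is negative.\<close>

lemma star_exact:
  assumes "fg_cone C" "sign_system C eps" "1 \<le> j" "cone_face_of G C"
    and "\<And>s. cone_face_of s C \<Longrightarrow> G \<subseteq> s \<Longrightarrow> vec.dim s = vec.dim G + j + 1 \<Longrightarrow>
      (\<Sum>t\<in>facets_over G s. eps t s * y t) = 0"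
  obtains g where "\<And>t. cone_face_of t C \<Longrightarrow> G \<subseteq> t \<Longrightarrow> vec.dim t = vec.dim G + j \<Longrightarrow>
      y t = (\<Sum>k\<in>facets_over G t. eps k t * g k)"
proof -
  obtain f where f: "klinear f" "\<forall>x\<in>C. 0 \<le> f x" "G = {x \<in> C. f x = 0}"
    using assms(4) by (auto simp: cone_face_of_def)
  note mf = klinear_minus[OF f(1)]
  have neg: "t \<in> neg_faces C G (\<lambda>x. - f x)" if "cone_face_of t C" "G \<subseteq> t" for t
    using that f(2,3) face_subset[OF that(1)] by (fastforce simp: neg_faces_def less_le)
  have "\<forall>x\<in>G. - f x = 0" using f(3) by auto
  from neg_star_exact[OF assms(1-4) mf this, of y] obtain g where
    "\<forall>t\<in>neg_faces C G (\<lambda>x. - f x). vec.dim t = vec.dim G + j \<longrightarrow>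
      y t = (\<Sum>k\<in>facets_over G t. eps k t * g k)"
    using assms(5) by (auto simp: neg_faces_def)
  then show ?thesis using that neg by blast
qed


section \<open>Rays and pyramids\<close>

definition rays :: "('k::linordered_field ^ 'm::finite) set \<Rightarrow> ('k ^ 'm) set set" where
  "rays C = {r. cone_face_of r C \<and> vec.dim r = 1}"

text \<open>One fixed vector per ray, shared by all faces through it, so that coefficients in
  different faces can be compared.\<close>

definition generator :: "('k::linordered_field ^ 'm::finite) set \<Rightarrow> 'k ^ 'm" where
  "generator r = (SOME x. x \<in> r \<and> x \<noteq> 0)"

lemma raysD: "r \<in> rays C \<Longrightarrow> cone_face_of r C" "r \<in> rays C \<Longrightarrow> vec.dim r = 1"
  by (auto simp: rays_def)

lemma finite_rays: "fg_cone C \<Longrightarrow> finite (rays C)"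
  by (rule finite_subset[OF _ finite_faces]) (auto simp: rays_def)

lemma rays_face: "fg_cone C \<Longrightarrow> cone_face_of t C \<Longrightarrow> rays t = {r \<in> rays C. r \<subseteq> t}"
  using face_trans[of C t] face_between[of _ C t]
    face_subset[of t C] face_subset[of _ t]
  unfolding rays_def by blast

lemma generator:
  assumes "vec.dim r = 1"
  shows "generator r \<in> r" "generator r \<noteq> 0" "vec.span r = vec.span {generator r}"
proof -
  have "\<not> r \<subseteq> {0}"
    using assms vec.dim_subset[of r "{0}"] by (auto simp: vec.dim_insert)
  then have "\<exists>x. x \<in> r \<and> x \<noteq> 0" by blast
  from someI_ex[OF this] show g: "generator r \<in> r" "generator r \<noteq> 0"
    by (simp_all add: generator_def)
  have "vec.dim {generator r} = 1" using g(2) by (simp add: vec.dim_insert)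
  then have "vec.span {generator r} = vec.span r"
    using assms g(1) by (intro vec.dim_eq_span) auto
  then show "vec.span r = vec.span {generator r}" ..
qed

lemma rays_subset_eq:
  assumes "r \<in> rays C" "r' \<in> rays C" "generator r' \<in> r"
  shows "r' = r"
proof -
  have r': "r' \<subseteq> C" using raysD(1)[OF assms(2)] by (rule face_subset)
  have "r' \<subseteq> vec.span r'" by (rule vec.span_superset)
  also have "\<dots> \<subseteq> vec.span r"
    unfolding generator(3)[OF raysD(2)[OF assms(2)]] using assms(3)
    by (intro vec.span_mono) simp
  finally have "r' \<subseteq> r" using face_span_Int[OF raysD(1)[OF assms(1)]] r' by blast
  from same_dim_face_eq[OF raysD(1)[OF assms(2)] this]
  show ?thesis using raysD[OF assms(1)] raysD[OF assms(2)] face_subset by auto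
qed

text \<open>A functional exposing the ray \<open>p\<close> with the only possibly positive
  coefficient kills \<open>p\<close> and is positive on the other rays, so the other terms are all
  nonpositive and sum to 0. If no coefficient is positive, any ray can play the part of
  \<open>p\<close>.\<close>

lemma ray_relation_few_positive:
  assumes R: "finite R" "R \<subseteq> rays C" and rel: "(\<Sum>r\<in>R. x r *s generator r) = 0"
    and pos: "card {r \<in> R. 0 < x r} \<le> 1" and q: "q \<in> R"
  shows "x q = 0"
proof -
  obtain p where p: "p \<in> R" "\<And>r. r \<in> R \<Longrightarrow> r \<noteq> p \<Longrightarrow> x r \<le> 0"
  proof (cases "{r \<in> R. 0 < x r} = {}")
    case True
    then show ?thesis using that[OF q] by force
  next
    case False
    then have "card {r \<in> R. 0 < x r} \<noteq> 0" using R(1) by (subst card_0_eq) auto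
    then have "card {r \<in> R. 0 < x r} = 1" using pos by linarith
    then obtain p where p: "{r \<in> R. 0 < x r} = {p}" by (auto simp: card_1_singleton_iff)
    have "p \<in> R" using p by blast
    moreover have "x r \<le> 0" if "r \<in> R" "r \<noteq> p" for r
    proof -
      have "r \<notin> {r \<in> R. 0 < x r}" unfolding p using that(2) by simp
      then show ?thesis using that(1) by simp
    qed
    ultimately show ?thesis by (rule that)
  qed
  obtain e where e: "klinear e" "\<forall>y\<in>C. 0 \<le> e y" "p = {y \<in> C. e y = 0}"
    using p(1) R(2) by (auto simp: rays_def cone_face_of_def)
  have gen: "generator r \<in> C" if "r \<in> R" for r
    using that R(2) generator(1)[OF raysD(2)] face_subset[OF raysD(1)] by blast
  have epos: "0 < e (generator r)" if "r \<in> R" "r \<noteq> p" for r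
  proof -
    have "generator r \<notin> p" using rays_subset_eq[of p C r] that p(1) R(2) by blast
    then show ?thesis using e(2,3) gen[OF that(1)] by (auto simp: less_le)
  qed
  have ep: "e (generator p) = 0" using e(3) generator(1)[OF raysD(2)] p(1) R(2) by blast
  have "(\<Sum>r\<in>R. - (x r * e (generator r))) = - e (\<Sum>r\<in>R. x r *s generator r)"
    by (simp add: klinear_simps[OF e(1)] sum_negf)
  also have "\<dots> = 0" unfolding rel by (simp add: klinear_zero[OF e(1)])
  finally have "\<forall>r\<in>R. - (x r * e (generator r)) = 0"
    using R(1) p(2) epos ep
    by (subst (asm) sum_nonneg_eq_0_iff)
      (metis less_imp_le mult_nonpos_nonneg mult_zero_right neg_0_le_iff_le order_refl)+
  then have zero: "x r = 0" if "r \<in> R" "r \<noteq> p" for r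
    using epos[OF that] that by force
  have "(\<Sum>r\<in>R. x r *s generator r) = x p *s generator p"
    using zero R(1) p(1) by (subst sum.remove[OF R(1) p(1)]) (simp add: sum.neutral)
  then have "x p = 0" using rel generator(2)[OF raysD(2)] p(1) R(2) by auto
  then show ?thesis using zero q by blast
qed

text \<open>Of three coefficients, at most one is positive or at most one is negative. Four rays can
  be dependent, as in the cone over a square, which explains the 3 in the rule for polygons.\<close>

lemma three_rays_independent:
  assumes R: "finite R" "R \<subseteq> rays C" "card R \<le> 3" and rel: "(\<Sum>r\<in>R. x r *s generator r) = 0"
    and q: "q \<in> R"
  shows "x q = 0"
proof (cases "card {r \<in> R. 0 < x r} \<le> 1")
  case True
  then show ?thesis using ray_relation_few_positive[OF R(1,2) rel _ q] by blast
next
  case False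
  have "card {r \<in> R. 0 < x r} + card {r \<in> R. 0 < - x r}
      = card ({r \<in> R. 0 < x r} \<union> {r \<in> R. 0 < - x r})"
    using R(1) by (intro card_Un_disjoint[symmetric]) auto
  also have "\<dots> \<le> card R" using R(1) by (intro card_mono) auto
  finally have "card {r \<in> R. 0 < - x r} \<le> 1" using False R(3) by linarith
  moreover have "(\<Sum>r\<in>R. (- x r) *s generator r) = 0" using rel by (simp add: sum_negf)
  ultimately have "- x q = 0"
    by (intro ray_relation_few_positive[where x = "\<lambda>r. - x r", OF R(1,2) _ _ q])
  then show ?thesis by simp
qed

section \<open>Coordinates along the rays of a pointed cone\<close>

lemma dim_zero_face: "vec.dim {0 :: 'k::field ^ 'm::finite} = 0"
  by (simp add: vec.dim_insert)

lemma rays_eq_face_covers: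
  assumes "fg_cone C"
  shows "rays C = face_covers {0} C"
  using fg_cone_zero[OF fg_cone_face[OF assms]] by (auto simp: rays_def face_covers_def dim_zero_face)

text \<open>Rays are the covers of the face \<open>{0}\<close>, so this is the spanning property of
  covers.\<close>

lemma span_generators:
  assumes "fg_cone C" "cone_face_of {0} C"
  shows "vec.span C = vec.span (generator ` rays C)"
proof
  let ?V = "vec.span (generator ` rays C)"
  have "r \<subseteq> ?V" if "r \<in> rays C" for r
  proof -
    have "r \<subseteq> vec.span r" by (rule vec.span_superset)
    also have "\<dots> \<subseteq> ?V"
      unfolding generator(3)[OF raysD(2)[OF that]] using that by (intro vec.span_mono) blast
    finally show ?thesis .
  qed
  then have "{0} \<union> \<Union> (face_covers {0} C) \<subseteq> ?V"
    using vec.span_zero rays_eq_face_covers[OF assms(1)] by auto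
  then have "vec.span ({0} \<union> \<Union> (face_covers {0} C)) \<subseteq> ?V"
    by (rule vec.span_minimal) (rule vec.subspace_span)
  then have "C \<subseteq> ?V" using span_face_covers[OF assms] by blast
  then show "vec.span C \<subseteq> ?V"
    by (rule vec.span_minimal) (rule vec.subspace_span)
  have "generator ` rays C \<subseteq> C"
    using generator(1)[OF raysD(2)] face_subset[OF raysD(1)] by blast
  then show "?V \<subseteq> vec.span C" by (rule vec.span_mono)
qed

lemma generator_coordinates:
  assumes "fg_cone C" "cone_face_of {0} C" "v \<in> vec.span C"
  shows "\<exists>\<beta>. v = (\<Sum>r\<in>rays C. \<beta> r *s generator r)"
proof -
  have "v \<in> vec.span (generator ` rays C)" using assms(3) span_generators[OF assms(1,2)] by simp
  then obtain u where u: "v = (\<Sum>a\<in>generator ` rays C. u a *s a)"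
    using vec.span_finite[of "generator ` rays C"] finite_rays[OF assms(1)] by auto
  have "inj_on generator (rays C)"
  proof (rule inj_onI)
    fix r r' assume r: "r \<in> rays C" "r' \<in> rays C" "generator r = generator r'"
    have "generator r \<in> r'" unfolding r(3) by (rule generator(1)[OF raysD(2)[OF r(2)]])
    then show "r = r'" by (rule rays_subset_eq[OF r(2,1)])
  qed
  then have "v = (\<Sum>r\<in>rays C. u (generator r) *s generator r)"
    unfolding u by (simp add: sum.reindex)
  then show ?thesis by (rule exI[of _ "\<lambda>r. u (generator r)"])
qed

lemma facets_dim2:
  assumes "fg_cone e" "vec.dim e = 2"
  shows "facets e = rays e"
  using assms by (auto simp: rays_def cone_facet_of_def)

text \<open>The rays lie among the two middle faces of the diamond over \<open>{0}\<close>.\<close>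

lemma card_rays_dim2:
  assumes "fg_cone e" "cone_face_of {0} e" "vec.dim e = 2"
  shows "card (rays e) \<le> 2"
proof -
  obtain rho1 rho2 where s: "{k. cone_facet_of {0} k \<and> cone_facet_of k e} = {rho1, rho2}"
    by (rule diamond[OF assms(1,2)]) (use assms(3) dim_zero_face in auto)
  have "cone_facet_of {0} r" if "r \<in> rays e" for r
    using that fg_cone_zero[OF fg_cone_face[OF assms(1) raysD(1)[OF that]]] dim_zero_face
    by (intro facet_between[OF assms(2)]) (auto simp: rays_def face_subset)
  then have "rays e \<subseteq> {rho1, rho2}"
    using facets_dim2[OF assms(1,3)] unfolding s[symmetric] by blast
  then have "card (rays e) \<le> card {rho1, rho2}" by (intro card_mono) auto
  also have "\<dots> \<le> 2" by (simp add: card_insert_if)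
  finally show ?thesis .
qed

lemma coboundary_closed_vec:
  fixes C :: "('k::linordered_field ^ 'm::finite) set" and g :: "_ \<Rightarrow> 'k ^ 'd::finite"
  assumes "fg_cone C" "sign_system C eps" "cone_face_of s C"
  shows "(\<Sum>t\<in>facets s. eps t s *s (\<Sum>k\<in>facets t. eps k t *s g k)) = 0"
proof (subst Finite_Cartesian_Product.vec_eq_iff, rule allI)
  fix i
  show "(\<Sum>t\<in>facets s. eps t s *s (\<Sum>k\<in>facets t. eps k t *s g k)) $ i = 0 $ i"
    using coboundary_closed[OF assms, where G = "{}" and g = "\<lambda>k. g k $ i"] by simp
qed

text \<open>
  A cone with an apex \<open>a\<close> and a height coordinate \<open>ht\<close> along which it projects to its base, the face
  \<open>ht = 0\<close>.
\<close>

definition cone_pyramid ::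
  "('k::linordered_field ^ 'm::finite) set \<Rightarrow> 'k ^ 'm \<Rightarrow> ('k ^ 'm \<Rightarrow> 'k) \<Rightarrow> bool" where
  "cone_pyramid P a ht \<longleftrightarrow> klinear ht \<and> a \<in> P \<and> ht a = 1 \<and>
     (\<forall>x\<in>P. 0 \<le> ht x \<and> x - ht x *s a \<in> P)"

locale pyramid =
  fixes P :: "('k::linordered_field ^ 'm::finite) set" and a :: "'k ^ 'm" and ht :: "'k ^ 'm \<Rightarrow> 'k"
  assumes fg: "fg_cone P" and pointed: "cone_face_of {0} P" and pyr: "cone_pyramid P a ht"
begin

definition proj :: "'k ^ 'm \<Rightarrow> 'k ^ 'm" where
  "proj x = x - ht x *s a"

definition base :: "('k ^ 'm) set" where
  "base = {x \<in> P. ht x = 0}"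

definition apex :: "('k ^ 'm) set" where
  "apex = {x \<in> P. proj x = 0}"

text \<open>For a face \<open>e\<close> of the base, the join of \<open>e\<close> with the
  apex.\<close>

definition lift :: "('k ^ 'm) set \<Rightarrow> ('k ^ 'm) set" where
  "lift e = {x \<in> P. proj x \<in> e}"

lemma ht: "klinear ht" and aP: "a \<in> P" and hta: "ht a = 1"
  and ht_nonneg: "x \<in> P \<Longrightarrow> 0 \<le> ht x" and proj_in: "x \<in> P \<Longrightarrow> proj x \<in> P"
  using pyr by (auto simp: cone_pyramid_def proj_def)

lemma ht_proj: "ht (proj x) = 0"
  by (simp add: proj_def klinear_simps[OF ht] hta)

lemma decompose: "x = ht x *s a + proj x"
  by (simp add: proj_def)

lemma klinear_proj:
  assumes "klinear f"
  shows "klinear (\<lambda>x. f (proj x))"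
proof -
  have "(\<lambda>x. f (proj x)) = (\<lambda>x. 1 * f x + (- f a) * ht x)"
    by (simp add: proj_def klinear_simps[OF assms] fun_eq_iff)
  then show ?thesis using klinear_combination[OF assms ht, of 1 "- f a"] by simp
qed

lemma proj_span:
  assumes "\<And>x. x \<in> S \<Longrightarrow> proj x \<in> vec.span T" "y \<in> vec.span S"
  shows "proj y \<in> vec.span T"
proof -
  have "vec.subspace {x. proj x \<in> vec.span T}"
  proof (rule vec.subspaceI)
    show "0 \<in> {x. proj x \<in> vec.span T}"
      by (simp add: proj_def klinear_simps[OF ht] vec.span_zero)
    fix x y assume "x \<in> {x. proj x \<in> vec.span T}" "y \<in> {x. proj x \<in> vec.span T}"
    moreover have "proj (x + y) = proj x + proj y"
      by (simp add: proj_def klinear_simps[OF ht] vec.scale_left_distrib)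
    ultimately show "x + y \<in> {x. proj x \<in> vec.span T}" using vec.span_add by auto
  next
    fix c x assume "x \<in> {x. proj x \<in> vec.span T}"
    moreover have "proj (c *s x) = c *s proj x"
      by (simp add: proj_def klinear_simps[OF ht] vec.scale_right_diff_distrib)
    ultimately show "c *s x \<in> {x. proj x \<in> vec.span T}" using vec.span_scale by auto
  qed
  then show ?thesis using vec.span_minimal[of S "{x. proj x \<in> vec.span T}"] assms by blast
qed

lemma base_face: "cone_face_of base P"
  unfolding base_def cone_face_of_def using ht ht_nonneg by blast

lemma apex_face: "cone_face_of apex P"
proof -
  obtain g where g: "klinear g" "\<forall>x\<in>P. 0 \<le> g x" "{0} = {x \<in> P. g x = 0}"
    using pointed by (auto simp: cone_face_of_def)
  have "apex = {x \<in> P. g (proj x) = 0}"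
    using g(3) proj_in unfolding apex_def by blast
  then show ?thesis
    using klinear_proj[OF g(1)] g(2) proj_in unfolding cone_face_of_def by blast
qed

lemma a_apex: "a \<in> apex"
  by (simp add: apex_def aP proj_def hta)

lemma apex_multiple: "x \<in> apex \<Longrightarrow> x = ht x *s a"
  using decompose[of x] by (simp add: apex_def)

lemma a_nonzero: "a \<noteq> 0"
  using hta klinear_zero[OF ht] by auto

lemma dim_apex: "vec.dim apex = 1"
proof -
  have "vec.dim {a} = 1" using a_nonzero by (simp add: vec.dim_insert)
  moreover have "apex \<subseteq> vec.span {a}"
    using apex_multiple vec.span_scale[OF vec.span_base[of a "{a}"]] by (metis singletonI subsetI)
  then have "vec.dim apex \<le> vec.dim {a}" using vec.dim_subset vec.dim_span by metis
  moreover have "vec.dim {a} \<le> vec.dim apex" using a_apex by (intro vec.dim_subset) auto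
  ultimately show ?thesis by simp
qed

lemma apex_subset_iff:
  assumes "cone_face_of F P"
  shows "apex \<subseteq> F \<longleftrightarrow> a \<in> F"
proof
  assume "a \<in> F"
  then have "x \<in> F" if "x \<in> apex" for x
    using apex_multiple[OF that] fg_cone_scale[OF fg_cone_face[OF fg assms]] ht_nonneg that
    unfolding apex_def by (metis (no_types, lifting) mem_Collect_eq)
  then show "apex \<subseteq> F" by blast
qed (use a_apex in blast)

lemma proj_in_face:
  assumes "cone_face_of F P" "a \<in> F" "x \<in> F"
  shows "proj x \<in> F"
proof -
  have x: "x \<in> P" using assms(1,3) face_subset by blast
  have "ht x *s a \<in> P" by (rule fg_cone_scale[OF fg aP ht_nonneg[OF x]])
  moreover have "proj x + ht x *s a \<in> F" using assms(3) by (simp add: proj_def)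
  ultimately show ?thesis using face_summand[OF assms(1) proj_in[OF x]] by blast
qed

text \<open>Every \<open>x\<close> is the sum of \<open>ht x *s a\<close> and its projection, both
  in \<open>P\<close>. A nonzero first summand would put \<open>a\<close> into the face.\<close>

lemma face_subset_base:
  assumes "cone_face_of F P" "a \<notin> F"
  shows "F \<subseteq> base"
proof
  fix x assume x: "x \<in> F"
  then have xP: "x \<in> P" using assms(1) face_subset by blast
  have "ht x = 0"
  proof (rule ccontr)
    assume "ht x \<noteq> 0"
    then have pos: "0 < ht x" using ht_nonneg[OF xP] by simp
    have "ht x *s a \<in> P" by (rule fg_cone_scale[OF fg aP ht_nonneg[OF xP]])
    moreover have "ht x *s a + proj x \<in> F" using x decompose[of x] by simp
    ultimately have "ht x *s a \<in> F" using face_summand[OF assms(1) _ proj_in[OF xP]] by blast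
    then have "inverse (ht x) *s (ht x *s a) \<in> F"
      by (rule fg_cone_scale[OF fg_cone_face[OF fg assms(1)]]) (use pos in simp)
    then show False using assms(2) pos by (simp add: vec.scale_scale)
  qed
  then show "x \<in> base" using xP by (simp add: base_def)
qed

lemma dim_base_part:
  assumes "cone_face_of F P" "a \<in> F"
  shows "vec.dim F = vec.dim (F \<inter> base) + 1"
proof -
  have "a \<notin> vec.span (F \<inter> base)"
    using klinear_vanishes_span[OF ht, of "F \<inter> base" a] hta by (auto simp: base_def)
  then have d: "vec.dim (insert a (F \<inter> base)) = vec.dim (F \<inter> base) + 1"
    by (simp add: vec.dim_insert)
  have "F \<subseteq> vec.span (insert a (F \<inter> base))"
  proof
    fix x assume x: "x \<in> F"
    have "proj x \<in> F \<inter> base"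
      using proj_in_face[OF assms x] face_subset[OF assms(1)] by (auto simp: base_def ht_proj)
    then have "ht x *s a + proj x \<in> vec.span (insert a (F \<inter> base))"
      by (intro vec.span_add vec.span_scale vec.span_base) auto
    then show "x \<in> vec.span (insert a (F \<inter> base))" using decompose[of x] by simp
  qed
  then have "vec.dim F \<le> vec.dim (insert a (F \<inter> base))" using vec.dim_subset vec.dim_span by metis
  moreover have "vec.dim (insert a (F \<inter> base)) \<le> vec.dim F" using assms(2) by (intro vec.dim_subset) auto
  ultimately show ?thesis using d by simp
qed

lemma base_part_facet:
  assumes "cone_face_of F P" "a \<in> F"
  shows "cone_facet_of (F \<inter> base) F"
  using face_between[OF face_Int[OF assms(1) base_face]] face_subset[OF assms(1)]
    dim_base_part[OF assms] by (auto simp: cone_facet_of_def)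

lemma facet_without_apex:
  assumes "cone_face_of F P" "a \<in> F" "cone_facet_of e F" "a \<notin> e"
  shows "e = F \<inter> base"
proof -
  have "e \<subseteq> base" by (rule face_subset_base[OF facet_face[OF fg assms(1,3)] assms(4)])
  then have "e \<subseteq> F \<inter> base" using facetD(2)[OF assms(3)] by blast
  then show ?thesis
    using same_dim_face_eq[OF facetD(1)[OF assms(3)], of "F \<inter> base"] facetD(3)[OF assms(3)]
      dim_base_part[OF assms(1,2)] by simp
qed

lemma base_facet: "cone_facet_of base P"
  using base_part_facet[OF face_refl aP] face_subset[OF base_face]
  by (simp add: inf.absorb2)

lemma a_notin_base: "a \<notin> base"
  by (simp add: base_def hta)

lemma facets_cases: "facets P = insert base (facets_over apex P)"
  using base_facet facet_without_apex[OF face_refl aP] face_subset[OF base_face]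
    apex_subset_iff facetD(1) by blast

lemma lift_face:
  assumes "cone_face_of e P" "e \<subseteq> base"
  shows "cone_face_of (lift e) P" "a \<in> lift e" "lift e \<inter> base = e"
proof -
  obtain f where f: "klinear f" "\<forall>x\<in>P. 0 \<le> f x" "e = {x \<in> P. f x = 0}"
    using assms(1) by (auto simp: cone_face_of_def)
  have "lift e = {x \<in> P. f (proj x) = 0}"
    using f(3) proj_in unfolding lift_def by blast
  then show "cone_face_of (lift e) P"
    using klinear_proj[OF f(1)] f(2) proj_in unfolding cone_face_of_def by blast
  have "0 \<in> e" by (rule fg_cone_zero[OF fg_cone_face[OF fg assms(1)]])
  then show "a \<in> lift e" by (simp add: lift_def aP proj_def hta)
  show "lift e \<inter> base = e"
    using assms(2) by (auto simp: lift_def base_def proj_def)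
qed

lemma lift_base_part:
  assumes "cone_face_of F P" "a \<in> F"
  shows "lift (F \<inter> base) = F"
proof (intro equalityI subsetI)
  fix x assume x: "x \<in> lift (F \<inter> base)"
  then have "ht x *s a \<in> F"
    using ht_nonneg by (intro fg_cone_scale[OF fg_cone_face[OF fg assms(1)] assms(2)]) (auto simp: lift_def)
  moreover have "proj x \<in> F" using x by (simp add: lift_def)
  ultimately have "ht x *s a + proj x \<in> F" by (rule fg_cone_add[OF fg_cone_face[OF fg assms(1)]])
  then show "x \<in> F" using decompose[of x] by simp
next
  fix x assume x: "x \<in> F"
  then show "x \<in> lift (F \<inter> base)"
    using proj_in_face[OF assms x] face_subset[OF assms(1)]
    by (auto simp: lift_def base_def ht_proj)
qed

text \<open>The rays are the apex and those of the base part, an edge with at most two rays. So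
  every polygon through the apex is a triangle.\<close>

lemma card_rays_lateral:
  assumes "cone_face_of F P" "a \<in> F" "vec.dim F = 3"
  shows "card (rays F) \<le> 3"
proof -
  let ?e = "F \<inter> base"
  have e: "cone_face_of ?e F" "vec.dim ?e = 2"
    using facetD[OF base_part_facet[OF assms(1,2)]] assms(3) by auto
  have fgF: "fg_cone F" by (rule fg_cone_face[OF fg assms(1)])
  have fge: "fg_cone ?e" by (rule fg_cone_face[OF fgF e(1)])
  have "cone_face_of {0} ?e"
    using fg_cone_zero[OF fge] face_subset[OF assms(1)]
    by (intro face_between[OF pointed]) auto
  then have card: "card (rays ?e) \<le> 2" using card_rays_dim2[OF fge _ e(2)] by blast
  have "r \<in> insert apex (rays ?e)" if r: "r \<in> rays F" for r
  proof (cases "a \<in> r")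
    case True
    have rP: "cone_face_of r P" by (rule face_trans[OF fg assms(1) raysD(1)[OF r]])
    have "apex \<subseteq> r" using apex_subset_iff[OF rP] True by blast
    then have "apex = r"
      using same_dim_face_eq[OF apex_face, of r] face_subset[OF rP] raysD(2)[OF r] dim_apex by simp
    then show ?thesis by simp
  next
    case False
    then have "r \<subseteq> base"
      by (rule face_subset_base[OF face_trans[OF fg assms(1) raysD(1)[OF r]]])
    then show ?thesis
      using r rays_face[OF fgF e(1)] face_subset[OF raysD(1)[OF r]] by blast
  qed
  then have "rays F \<subseteq> insert apex (rays ?e)" by blast
  then have "card (rays F) \<le> card (insert apex (rays ?e))"
    using finite_rays[OF fge] by (intro card_mono) auto
  also have "\<dots> \<le> Suc (card (rays ?e))" by (rule card_insert_le_m1) (use finite_rays[OF fge] in auto)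
  finally show ?thesis using card by simp
qed

text \<open>
  Projecting along the apex kills the lateral faces of a cochain up to multiples of the apex; what
  remains is a scalar cocycle on the star of the apex.
\<close>

lemma cocycle_is_coboundary:
  assumes eps: "sign_system P eps" and dim: "vec.dim P = 4"
    and c: "\<And>F. cone_facet_of F P \<Longrightarrow> c F \<in> vec.span F"
    and closed: "(\<Sum>F\<in>facets P. eps F P *s c F) = 0"
  obtains b where "\<And>e. cone_face_of e P \<Longrightarrow> vec.dim e = 2 \<Longrightarrow> b e \<in> vec.span e"
    "\<And>F. cone_facet_of F P \<Longrightarrow> c F = (\<Sum>e\<in>facets F. eps e F *s b e)"
proof -
  \<comment> \<open>An edge \<open>e\<close> of the base lies in exactly one lateral facet,
    \<open>lift e\<close>. Its value is chosen to cancel the projection of \<open>c\<close>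
    there.\<close>
  define b\<^sub>1 where "b\<^sub>1 = (\<lambda>e. if a \<in> e then 0 else eps e (lift e) *s proj (c (lift e)))"
  define c' where "c' = (\<lambda>F. c F - (\<Sum>e\<in>facets F. eps e F *s b\<^sub>1 e))"
  have fgF: "fg_cone F" if "cone_facet_of F P" for F
    using that fg_cone_face[OF fg facetD(1)] by blast
  have facets: "facets F = insert (F \<inter> base) (facets_over apex F)"
    if F: "cone_facet_of F P" "a \<in> F" for F
    using base_part_facet[OF facetD(1)[OF F(1)] F(2)] facet_without_apex[OF facetD(1)[OF F(1)] F(2)]
      apex_subset_iff[OF facet_face[OF fg facetD(1)[OF F(1)]]] by blast
  have lateral_sum: "(\<Sum>e\<in>facets F. w e) = w (F \<inter> base) + (\<Sum>e\<in>facets_over apex F. w e)"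
    if F: "cone_facet_of F P" "a \<in> F" for F and w :: "_ \<Rightarrow> 'k ^ 'm"
    unfolding facets[OF F] using finite_facets[OF fgF[OF F(1)]] a_apex a_notin_base
    by (subst sum.insert) auto
  have c'_lateral: "c' F = ht (c F) *s a" if F: "cone_facet_of F P" "a \<in> F" for F
  proof -
    have "(\<Sum>e\<in>facets_over apex F. eps e F *s b\<^sub>1 e) = 0"
      using a_apex by (intro sum.neutral) (auto simp: b\<^sub>1_def)
    then have "(\<Sum>e\<in>facets F. eps e F *s b\<^sub>1 e) = eps (F \<inter> base) F *s b\<^sub>1 (F \<inter> base)"
      unfolding lateral_sum[OF F] by simp
    also have "\<dots> = (eps (F \<inter> base) F * eps (F \<inter> base) F) *s proj (c F)"
      using a_notin_base by (simp add: b\<^sub>1_def lift_base_part[OF facetD(1)[OF F(1)] F(2)] vec.scale_scale)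
    also have "\<dots> = proj (c F)"
      using sign_systemD(1)[OF eps facetD(1)[OF F(1)] base_part_facet[OF facetD(1)[OF F(1)] F(2)]] by simp
    finally show ?thesis by (simp add: c'_def proj_def)
  qed
  have split: "(\<Sum>F\<in>facets P. w F) = w base + (\<Sum>F\<in>facets_over apex P. w F)"
    for w :: "_ \<Rightarrow> 'k ^ 'm"
    by (subst facets_cases, subst sum.insert)
      (use finite_facets[OF fg] a_apex a_notin_base in auto)
  have lateral: "a \<in> F" if "apex \<subseteq> F" for F using that a_apex by blast
  have htbase: "ht (c base) = 0"
    using klinear_vanishes_span[OF ht _ c[OF base_facet]] by (simp add: base_def)
  have "ht (\<Sum>F\<in>facets P. eps F P *s c F) = 0" unfolding closed by (rule klinear_zero[OF ht])
  then have y_closed: "(\<Sum>F\<in>facets_over apex P. eps F P * ht (c F)) = 0"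
    unfolding split by (simp add: klinear_simps[OF ht] htbase)
  \<comment> \<open>The corrected cochain is still closed. Its lateral values are multiples of
    \<open>a\<close> whose signed sum is 0, by taking heights in the original relation; this forces
    the value on the base to vanish.\<close>
  have "(\<Sum>F\<in>facets P. eps F P *s c' F) = 0"
    using closed coboundary_closed_vec[OF fg eps face_refl, of b\<^sub>1]
    by (simp add: c'_def vec.scale_right_diff_distrib sum_subtractf)
  moreover have "(\<Sum>F\<in>facets_over apex P. eps F P *s c' F)
      = (\<Sum>F\<in>facets_over apex P. eps F P * ht (c F)) *s a"
    unfolding vec.scale_sum_left by (intro sum.cong refl) (simp add: c'_lateral lateral vec.scale_scale)
  ultimately have "eps base P *s c' base = 0" unfolding split y_closed by simp
  moreover have "eps base P \<noteq> 0" using sign_systemD(1)[OF eps face_refl base_facet] by auto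
  ultimately have c'_base: "c' base = 0" by simp
  \<comment> \<open>Only \<open>s = P\<close> has the required dimension, so closedness in the star
    of the apex is a single condition.\<close>
  have "(\<Sum>t\<in>facets_over apex s. eps t s * ht (c t)) = 0"
    if "cone_face_of s P" "apex \<subseteq> s" "vec.dim s = vec.dim apex + 2 + 1" for s
  proof -
    have "s = P" by (rule face_dim_eqD[OF that(1)]) (use that(3) dim dim_apex in simp)
    then show ?thesis using y_closed by simp
  qed
  then obtain g where g: "\<And>t. cone_face_of t P \<Longrightarrow> apex \<subseteq> t \<Longrightarrow> vec.dim t = vec.dim apex + 2 \<Longrightarrow>
      ht (c t) = (\<Sum>k\<in>facets_over apex t. eps k t * g k)"
    using star_exact[OF fg eps _ apex_face, of 2 "\<lambda>t. ht (c t)"] by auto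
  define b where "b = (\<lambda>e. if a \<in> e then g e *s a else b\<^sub>1 e)"
  show ?thesis
  proof (rule that)
    fix e assume e: "cone_face_of e P" "vec.dim e = 2"
    show "b e \<in> vec.span e"
    proof (cases "a \<in> e")
      case True
      then show ?thesis by (simp add: b_def vec.span_scale vec.span_base)
    next
      case False
      have eb: "e \<subseteq> base" by (rule face_subset_base[OF e(1) False])
      note l = lift_face[OF e(1) eb]
      have "vec.dim (lift e) = 3" using dim_base_part[OF l(1,2)] l(3) e(2) by simp
      then have "cone_facet_of (lift e) P" using l(1) dim by (simp add: cone_facet_of_def)
      then have "c (lift e) \<in> vec.span (lift e)" by (rule c)
      then have "proj (c (lift e)) \<in> vec.span e"
        by (rule proj_span[rotated]) (auto simp: lift_def vec.span_base)
      then show ?thesis using False by (simp add: b_def b\<^sub>1_def vec.span_scale)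
    qed
  next
    fix F assume F: "cone_facet_of F P"
    have dF: "vec.dim F = vec.dim apex + 2" using facetD(3)[OF F] dim dim_apex by simp
    show "c F = (\<Sum>e\<in>facets F. eps e F *s b e)"
    proof (cases "a \<in> F")
      case True
      have "(\<Sum>e\<in>facets F. eps e F *s b e)
          = (\<Sum>e\<in>facets F. eps e F *s b\<^sub>1 e)
            + (\<Sum>e\<in>facets_over apex F. eps e F * g e) *s a"
        unfolding lateral_sum[OF F True] vec.scale_sum_left
        using a_notin_base lateral by (simp add: b_def b\<^sub>1_def vec.scale_scale)
      also have "\<dots> = c F - c' F + ht (c F) *s a"
        using g[OF facetD(1)[OF F] _ dF] True apex_subset_iff[OF facetD(1)[OF F]] by (simp add: c'_def)
      finally show ?thesis using c'_lateral[OF F True] by simp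
    next
      case False
      then have F_base: "F = base" using facets_cases F lateral by blast
      have "(\<Sum>e\<in>facets F. eps e F *s b e) = (\<Sum>e\<in>facets F. eps e F *s b\<^sub>1 e)"
        using False facetD(2) by (intro sum.cong refl) (auto simp: b_def)
      then show ?thesis using c'_base unfolding F_base by (simp add: c'_def)
    qed
  qed
qed

end


section \<open>Cocycles and the cleaning rules\<close>

lemma facets_containing:
  assumes "fg_cone s" "cone_face_of k s" "vec.dim s = vec.dim k + 2"
  shows "faces_between k s = facets_over k s"
proof -
  have "cone_facet_of k t" if "cone_facet_of t s" "k \<subseteq> t" for t
    by (rule facet_between[OF assms(2) that(2) facetD(2)[OF that(1)]])
      (use assms(3) facetD(3)[OF that(1)] in simp)
  then show ?thesis using facetD(2) by blast
qed

text \<open>Both sides run over flags of a ray, an edge and the polygon. Grouped by rays, the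
  coefficient of \<open>generator r\<close> is the coboundary of \<open>\<beta> r\<close> in the
  star of \<open>r\<close>.\<close>

lemma sum_ray_expansion:
  assumes F: "fg_cone F" "vec.dim F = 3"
  shows "(\<Sum>e\<in>facets F. eps e F *s (\<Sum>r\<in>rays e. \<beta> r e *s generator r))
    = (\<Sum>r\<in>rays F. (\<Sum>e\<in>facets_over r F. eps e F * \<beta> r e) *s generator r)"
proof -
  have dim: "vec.dim e = 2" if "cone_facet_of e F" for e using facetD(3)[OF that] F(2) by simp
  have rays_e: "rays e = facets_over {} e" if "cone_facet_of e F" for e
    using facets_dim2[OF fg_cone_face[OF F(1) facetD(1)[OF that]] dim[OF that]] by simp
  have rays_F: "{k. cone_face_of k F \<and> {} \<subseteq> k \<and> vec.dim F = vec.dim k + 2} = rays F"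
    using F(2) by (auto simp: rays_def)
  have "(\<Sum>e\<in>facets F. eps e F *s (\<Sum>r\<in>rays e. \<beta> r e *s generator r))
      = (\<Sum>e\<in>facets_over {} F. \<Sum>r\<in>facets_over {} e. (eps e F * \<beta> r e) *s generator r)"
    by (intro sum.cong) (auto simp: rays_e vec.scale_sum_right)
  also have "\<dots> = (\<Sum>r\<in>rays F. \<Sum>e\<in>faces_between r F. (eps e F * \<beta> r e) *s generator r)"
    unfolding sum_facets_swap[OF F(1)] rays_F ..
  also have "\<dots> = (\<Sum>r\<in>rays F. (\<Sum>e\<in>facets_over r F. eps e F * \<beta> r e) *s generator r)"
  proof (rule sum.cong[OF refl])
    fix r assume r: "r \<in> rays F"
    have "faces_between r F = facets_over r F"
      using facets_containing[OF F(1) raysD(1)[OF r]] raysD(2)[OF r] F(2) by simp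
    then show "(\<Sum>e\<in>faces_between r F. (eps e F * \<beta> r e) *s generator r)
        = (\<Sum>e\<in>facets_over r F. eps e F * \<beta> r e) *s generator r"
      by (simp add: vec.scale_sum_left)
  qed
  finally show ?thesis .
qed

text \<open>An arbitrary expansion of the values \<open>c F\<close> along rays need not be closed at
  the rays. It is closed when it comes from expanding, edge by edge, an edge cochain with coboundary
  \<open>c\<close>, since it is then itself a coboundary at each ray.\<close>

lemma pyramid_ray_coefficients:
  assumes P: "fg_cone P" "cone_face_of {0} P" "sign_system P eps" "vec.dim P = 4" "cone_pyramid P a ht"
    and c: "\<And>F. cone_facet_of F P \<Longrightarrow> c F \<in> vec.span F"
    and closed: "(\<Sum>F\<in>facets P. eps F P *s c F) = 0"
  shows "\<exists>x. (\<forall>F. cone_facet_of F P \<longrightarrow> c F = (\<Sum>r\<in>rays F. x r F *s generator r)) \<and>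
    (\<forall>r\<in>rays P. (\<Sum>F\<in>facets_over r P. eps F P * x r F) = 0)"
proof -
  interpret pyramid P a ht using P by unfold_locales
  obtain b where b: "\<And>e. cone_face_of e P \<Longrightarrow> vec.dim e = 2 \<Longrightarrow> b e \<in> vec.span e"
    "\<And>F. cone_facet_of F P \<Longrightarrow> c F = (\<Sum>e\<in>facets F. eps e F *s b e)"
    by (rule cocycle_is_coboundary[where c = c, OF P(3,4) c closed]) auto
  have "\<exists>\<beta>. b e = (\<Sum>r\<in>rays e. \<beta> r *s generator r)" if "cone_face_of e P" "vec.dim e = 2" for e
  proof (rule generator_coordinates)
    show fge: "fg_cone e" by (rule fg_cone_face[OF P(1) that(1)])
    show "cone_face_of {0} e"
      using fg_cone_zero[OF fge] by (intro face_between[OF P(2) _ face_subset[OF that(1)]]) simp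
  qed (rule b(1)[OF that])
  then obtain \<beta> where \<beta>: "\<And>e. cone_face_of e P \<Longrightarrow> vec.dim e = 2 \<Longrightarrow>
      b e = (\<Sum>r\<in>rays e. \<beta> e r *s generator r)" by metis
  define x where "x = (\<lambda>r F. \<Sum>e\<in>facets_over r F. eps e F * \<beta> e r)"
  have "c F = (\<Sum>r\<in>rays F. x r F *s generator r)" if F: "cone_facet_of F P" for F
  proof -
    have dF: "vec.dim F = 3" using facetD(3)[OF F] P(4) by simp
    have "c F = (\<Sum>e\<in>facets F. eps e F *s (\<Sum>r\<in>rays e. \<beta> e r *s generator r))"
      unfolding b(2)[OF F] using \<beta> facet_face[OF P(1) facetD(1)[OF F]] facetD(3) dF
      by (intro sum.cong refl) fastforce
    also have "\<dots> = (\<Sum>r\<in>rays F. x r F *s generator r)"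
      unfolding x_def
      by (rule sum_ray_expansion[where \<beta> = "\<lambda>r e. \<beta> e r", OF fg_cone_face[OF P(1) facetD(1)[OF F]] dF])
    finally show ?thesis .
  qed
  moreover have "(\<Sum>F\<in>facets_over r P. eps F P * x r F) = 0" for r
    unfolding x_def by (rule coboundary_closed[OF P(1,3) face_refl])
  ultimately show ?thesis by blast
qed

text \<open>\<open>X P\<close> is chosen separately for each \<open>P\<close>. On a facet shared by
  two of them, the two choices may differ by a linear relation among the rays of the facet.\<close>

locale cocycle_coefficients =
  fixes C :: "('k::linordered_field ^ 'm::finite) set"
    and eps :: "('k ^ 'm) set \<Rightarrow> ('k ^ 'm) set \<Rightarrow> 'k"
    and c :: "('k ^ 'm) set \<Rightarrow> 'k ^ 'm"
    and X :: "('k ^ 'm) set \<Rightarrow> ('k ^ 'm) set \<Rightarrow> ('k ^ 'm) set \<Rightarrow> 'k"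
  assumes fg: "fg_cone C" and sign: "sign_system C eps" and pointed: "cone_face_of {0} C"
    and pyr: "\<And>P. cone_face_of P C \<Longrightarrow> vec.dim P = 4 \<Longrightarrow> \<exists>a ht. cone_pyramid P a ht"
    and X_repr: "\<And>P F. cone_face_of P C \<Longrightarrow> vec.dim P = 4 \<Longrightarrow> cone_facet_of F P \<Longrightarrow>
      c F = (\<Sum>r\<in>rays F. X P r F *s generator r)"
    and X_closed: "\<And>P r. cone_face_of P C \<Longrightarrow> vec.dim P = 4 \<Longrightarrow> r \<in> rays P \<Longrightarrow>
      (\<Sum>F\<in>facets_over r P. eps F P * X P r F) = 0"
begin

text \<open>The algebraic counterpart of cleanness, for one incidence of a vertex and a polygon. It
  is trivially true if \<open>F\<close> is a facet of at most one \<open>P\<close>.\<close>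

definition clean :: "('k ^ 'm) set \<Rightarrow> ('k ^ 'm) set \<Rightarrow> bool" where
  "clean r F \<longleftrightarrow> (\<forall>P P'. cone_face_of P C \<longrightarrow> cone_face_of P' C \<longrightarrow> vec.dim P = 4 \<longrightarrow>
     cone_facet_of F P \<longrightarrow> cone_facet_of F P' \<longrightarrow> X P r F = X P' r F)"

lemma cleanD:
  assumes "clean r F" "cone_face_of P C" "cone_face_of P' C" "vec.dim P = 4"
    "cone_facet_of F P" "cone_facet_of F P'"
  shows "X P r F = X P' r F"
  using assms unfolding clean_def by blast

lemma pointed_face:
  assumes "cone_face_of t C"
  shows "cone_face_of {0} t"
  using fg_cone_zero[OF fg_cone_face[OF fg assms]]
  by (intro face_between[OF pointed _ face_subset[OF assms]]) simp

text \<open>Two expansions of the same \<open>c F\<close> differ by a linear relation among the rays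
  of \<open>F\<close>. The rays in \<open>V\<close> drop out, and the at most three remaining ones
  are independent.\<close>

lemma polygon_rule:
  assumes F: "cone_face_of F C" and few: "card {r \<in> rays F. r \<notin> V} \<le> 3"
    and V: "\<And>r. r \<in> rays F \<Longrightarrow> r \<in> V \<Longrightarrow> clean r F" and r: "r \<in> rays F"
  shows "clean r F"
proof (cases "r \<in> V")
  case True
  then show ?thesis using V r by blast
next
  case False
  have fgF: "fg_cone F" by (rule fg_cone_face[OF fg F])
  let ?R = "{r \<in> rays F. r \<notin> V}"
  show ?thesis
    unfolding clean_def
  proof (intro allI impI)
    fix P P' assume P: "cone_face_of P C" "cone_face_of P' C" "vec.dim P = 4"
      "cone_facet_of F P" "cone_facet_of F P'"
    have P': "vec.dim P' = 4" using facetD(3)[OF P(4)] facetD(3)[OF P(5)] P(3) by simp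
    have "(\<Sum>r\<in>rays F. (X P r F - X P' r F) *s generator r) = 0"
      using X_repr[OF P(1,3,4)] X_repr[OF P(2) P' P(5)]
      by (simp add: vec.scale_left_diff_distrib sum_subtractf)
    moreover have "(\<Sum>r\<in>?R. (X P r F - X P' r F) *s generator r)
        = (\<Sum>r\<in>rays F. (X P r F - X P' r F) *s generator r)"
    proof (rule sum.mono_neutral_left[OF finite_rays[OF fgF]])
      show "\<forall>r\<in>rays F - ?R. (X P r F - X P' r F) *s generator r = 0"
      proof
        fix r assume "r \<in> rays F - ?R"
        then have "clean r F" using V by blast
        then have "X P r F = X P' r F" by (rule cleanD[OF _ P])
        then show "(X P r F - X P' r F) *s generator r = 0" by simp
      qed
    qed auto
    ultimately have "(\<Sum>r\<in>?R. (X P r F - X P' r F) *s generator r) = 0" by simp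
    then have "X P r F - X P' r F = 0"
      using few r False finite_rays[OF fgF]
      by (intro three_rays_independent[where x = "\<lambda>r. X P r F - X P' r F" and R = ?R and C = F]) auto
    then show "X P r F = X P' r F" by simp
  qed
qed

lemma clean_triangle:
  assumes "cone_face_of F C" "card (rays F) \<le> 3" "r \<in> rays F"
  shows "clean r F"
  using polygon_rule[OF assms(1), of "{}"] assms(2,3) by simp

lemma unclean_in_pyramid_unique:
  assumes P: "cone_face_of P C" "vec.dim P = 4"
    and F: "cone_facet_of F P" "r \<in> rays F" "\<not> clean r F"
    and F': "cone_facet_of F' P" "r \<in> rays F'" "\<not> clean r F'"
  shows "F = F'"
proof -
  obtain a ht where "cone_pyramid P a ht" using pyr[OF P] by blast
  then interpret p: pyramid P a ht
    using fg_cone_face[OF fg P(1)] pointed_face[OF P(1)] by unfold_locales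
  have "F = p.base" if F: "cone_facet_of F P" "r \<in> rays F" "\<not> clean r F" for F
  proof (rule ccontr)
    assume "F \<noteq> p.base"
    then have "a \<in> F" using p.facets_cases F(1) p.a_apex by blast
    then have "card (rays F) \<le> 3"
      using p.card_rays_lateral[OF facetD(1)[OF F(1)]] facetD(3)[OF F(1)] P(2) by simp
    then show False
      using clean_triangle[OF face_trans[OF fg P(1) facetD(1)[OF F(1)]]] F(2,3) by blast
  qed
  then show ?thesis using F F' by blast
qed

text \<open>With \<open>vec.dim C\<close> equal to n + 1, the bound allows at most n - 3 obstructed
  polygons at \<open>r\<close>. Counting the nonzero \<open>z R\<close> from above by obstructed
  polygons and from below by covers shows that there are none; exactness of the star of
  \<open>F\<close> then makes the coefficient independent of \<open>P\<close>.\<close>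

lemma vertex_rule:
  assumes r: "r \<in> rays C"
    and few: "card {F. cone_face_of F C \<and> vec.dim F = 3 \<and> r \<subseteq> F \<and> \<not> clean r F} + 4 \<le> vec.dim C"
    and F: "cone_face_of F C" "vec.dim F = 3" "r \<subseteq> F"
  shows "clean r F"
proof (rule ccontr)
  assume bad: "\<not> clean r F"
  let ?Bad = "{F. cone_face_of F C \<and> vec.dim F = 3 \<and> r \<subseteq> F \<and> \<not> clean r F}"
  have finBad: "finite ?Bad" by (rule finite_subset[OF _ finite_faces[OF fg]]) auto
  have ray: "r \<in> rays t" if "cone_face_of t C" "r \<subseteq> t" for t
    using that r rays_face[OF fg that(1)] by blast
  have facet: "cone_facet_of t s"
    if "cone_face_of t C" "cone_face_of s C" "t \<subseteq> s" "vec.dim s = vec.dim t + 1" for t s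
    by (rule facet_between[OF that(1,3) face_subset[OF that(2)] that(4)])
  \<comment> \<open>The factor \<open>eps F P\<close> turns a coefficient independent of
    \<open>P\<close> into the coboundary of a single value at \<open>F\<close>. The obstruction is
    then the coboundary \<open>z\<close> of \<open>y\<close>.\<close>
  define y where "y = (\<lambda>P. eps F P * X P r F)"
  define z where "z = (\<lambda>R. \<Sum>P\<in>facets_over F R. eps P R * y P)"
  have z_zero: "z R = 0"
    if R: "cone_face_of R C" "vec.dim R = 5" "F \<subseteq> R" and only: "\<And>F'. F' \<in> ?Bad \<Longrightarrow> F' \<subseteq> R \<Longrightarrow> F' = F" for R
  proof -
    have fgR: "fg_cone R" by (rule fg_cone_face[OF fg R(1)])
    have FR: "cone_face_of F R" by (rule face_between[OF F(1) R(3) face_subset[OF R(1)]])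
    let ?K = "{k. cone_face_of k R \<and> r \<subseteq> k \<and> vec.dim R = vec.dim k + 2}"
    have finK: "finite ?K" by (rule finite_subset[OF _ finite_faces[OF fgR]]) auto
    have FK: "F \<in> ?K" using FR F(2,3) R(2) by simp
    \<comment> \<open>Closedness at \<open>r\<close> is summed over the facets of \<open>R\<close>
      and regrouped by polygons \<open>k\<close>. The coefficient of a clean \<open>k\<close>
      factors out of a diamond sum, which is 0; the contribution of \<open>F\<close> is
      \<open>z R\<close>.\<close>
    have "0 = (\<Sum>P\<in>facets_over r R. eps P R * (\<Sum>k\<in>facets_over r P. eps k P * X P r k))"
    proof (rule sum.neutral[symmetric], rule ballI)
      fix P assume "P \<in> facets_over r R"
      then have P: "cone_face_of P C" "vec.dim P = 4" "r \<subseteq> P"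
        using facet_face[OF fg R(1)] facetD(3) R(2) by fastforce+
      show "eps P R * (\<Sum>k\<in>facets_over r P. eps k P * X P r k) = 0"
        using X_closed[OF P(1,2) ray[OF P(1,3)]] by simp
    qed
    also have "\<dots> = (\<Sum>P\<in>facets_over r R. \<Sum>k\<in>facets_over r P. eps P R * (eps k P * X P r k))"
      by (simp add: sum_distrib_left)
    also have "\<dots> = (\<Sum>k\<in>?K. \<Sum>P\<in>faces_between k R. eps P R * (eps k P * X P r k))"
      by (rule sum_facets_swap[OF fgR])
    also have "\<dots> = (\<Sum>P\<in>faces_between F R. eps P R * (eps F P * X P r F))"
    proof -
      have "(\<Sum>P\<in>faces_between k R. eps P R * (eps k P * X P r k)) = 0"
        if k: "k \<in> ?K - {F}" for k
      proof -
        have kS: "cone_face_of k C" "vec.dim k = 3" "r \<subseteq> k" "k \<noteq> F"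
          using k face_trans[OF fg R(1)] R(2) by auto
        have "k \<subseteq> R" using k face_subset[of k R] by simp
        then have cl: "clean r k" using only[of k] kS by blast
        \<comment> \<open>The common coefficient of \<open>k\<close>, arbitrary if there is no
          \<open>P\<close> between \<open>k\<close> and \<open>R\<close>.\<close>
        obtain x where x: "\<And>P. cone_facet_of k P \<and> cone_facet_of P R \<Longrightarrow> X P r k = x"
        proof (cases "\<exists>P. cone_facet_of k P \<and> cone_facet_of P R")
          case True
          then obtain P where P: "cone_facet_of k P" "cone_facet_of P R" by blast
          have P4: "vec.dim P = 4" using facetD(3)[OF P(1)] kS(2) by simp
          show ?thesis
          proof (rule that[of "X P r k"])
            fix P' assume P': "cone_facet_of k P' \<and> cone_facet_of P' R"
            show "X P' r k = X P r k"
            proof (rule cleanD[OF cl, symmetric])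
              show "cone_face_of P C" "cone_face_of P' C"
                using facet_face[OF fg R(1)] P(2) P' by blast+
            qed (use P P' P4 in auto)
          qed
        qed (use that in blast)
        have "(\<Sum>P\<in>faces_between k R. eps P R * (eps k P * X P r k))
            = (\<Sum>P\<in>faces_between k R. eps k P * eps P R) * x"
          unfolding sum_distrib_right using x by (intro sum.cong refl) (simp add: mult_ac)
        also have "\<dots> = 0"
          using sign_systemD(2)[OF sign R(1), of k] k by simp
        finally show "(\<Sum>P\<in>faces_between k R. eps P R * (eps k P * X P r k)) = 0" .
      qed
      then show ?thesis by (subst sum.remove[OF finK FK]) (simp add: sum.neutral)
    qed
    also have "\<dots> = z R"
      unfolding z_def y_def using facets_containing[OF fgR FR] F(2) R(2) by simp
    finally show ?thesis by simp
  qed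
  let ?NZ = "{R. cone_face_of R C \<and> vec.dim R = 5 \<and> F \<subseteq> R \<and> z R \<noteq> 0}"
  have finNZ: "finite ?NZ" by (rule finite_subset[OF _ finite_faces[OF fg]]) auto
  have FB: "F \<in> ?Bad" using F bad by simp
  have "card ?NZ \<le> card (?Bad - {F})"
  proof -
    define p where "p = (\<lambda>R. SOME F'. F' \<in> ?Bad - {F} \<and> F' \<subseteq> R)"
    have p: "p R \<in> ?Bad - {F} \<and> p R \<subseteq> R" if "R \<in> ?NZ" for R
      unfolding p_def by (rule someI_ex) (use z_zero[of R] that in blast)
    \<comment> \<open>If \<open>R\<close> and \<open>R'\<close> share the chosen polygon, they
      intersect in a pyramid that contains it and \<open>F\<close>, two obstructed polygons at
      \<open>r\<close>.\<close>
    have "inj_on p ?NZ"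
    proof (rule inj_onI, rule ccontr)
      fix R R' assume R: "R \<in> ?NZ" and R': "R' \<in> ?NZ" and eq: "p R = p R'" and ne: "R \<noteq> R'"
      let ?F = "p R" and ?P = "R \<inter> R'"
      have F1: "?F \<in> ?Bad - {F}" "?F \<subseteq> R" using p[OF R] by blast+
      have F2: "?F \<subseteq> R'" unfolding eq using p[OF R'] by blast
      have pF: "cone_face_of ?F C" "vec.dim ?F = 3" "r \<subseteq> ?F" "\<not> clean r ?F" "?F \<noteq> F" "?F \<subseteq> ?P"
        using F1 F2 by simp_all
      have FP: "F \<subseteq> ?P" using R R' by blast
      have P: "cone_face_of ?P C" using R R' by (intro face_Int) auto
      have RC: "R \<subseteq> C" "R' \<subseteq> C" using R R' face_subset[of R C] face_subset[of R' C] by simp_all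
      have PR: "cone_face_of ?P R" by (rule face_between[OF P _ RC(1)]) simp
      have "?P \<noteq> R"
      proof
        assume "?P = R"
        then have "R \<subseteq> R'" by blast
        then have "R = R'"
          using same_dim_face_eq[OF _ _ RC(2), of R] R R' by simp
        then show False using ne by simp
      qed
      then have up: "vec.dim ?P \<le> 4" using face_dim_less[OF PR] R by simp
      have "F \<noteq> ?P"
        using same_dim_face_eq[OF pF(1) _ face_subset[OF F(1)]] pF(2,5,6) F(2) by auto
      moreover have "cone_face_of F ?P" by (rule face_between[OF F(1) FP face_subset[OF P]])
      ultimately have "vec.dim F < vec.dim ?P" using face_dim_less by blast
      then have P4: "vec.dim ?P = 4" using up F(2) by simp
      have "F = ?F"
      proof (rule unclean_in_pyramid_unique[OF P P4 _ _ bad _ _ pF(4)])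
        show "cone_facet_of F ?P" by (rule facet[OF F(1) P FP]) (use P4 F(2) in simp)
        show "cone_facet_of ?F ?P" by (rule facet[OF pF(1) P pF(6)]) (use P4 pF(2) in simp)
      qed (use ray[OF F(1,3)] ray[OF pF(1,3)] in auto)
      then show False using pF(5) by simp
    qed
    moreover have "p ` ?NZ \<subseteq> ?Bad - {F}" using p by blast
    ultimately show ?thesis using card_inj_on_le finBad by blast
  qed
  also have "\<dots> = card ?Bad - 1" using FB finBad by simp
  finally have NZ_small: "card ?NZ \<le> card ?Bad - 1" .
  have "card ?Bad \<noteq> 0" using FB finBad by auto
  have z0: "z R = 0" if R: "cone_face_of R C" "vec.dim R = 5" "F \<subseteq> R" for R
  proof (rule ccontr)
    assume "z R \<noteq> 0"
    then have RNZ: "R \<in> ?NZ" using R by simp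
    \<comment> \<open>Closedness of \<open>z\<close> at \<open>S\<close> does not allow the nonzero
      term of \<open>R\<close> to stand alone.\<close>
    have ex: "\<exists>R'. R' \<in> ?NZ - {R} \<and> R' \<subseteq> S" if S: "S \<in> face_covers R C" for S
    proof (rule ccontr)
      assume none: "\<not> ?thesis"
      have S': "cone_face_of S C" "R \<subseteq> S" "vec.dim S = 6" using S R(2) by (auto simp: face_covers_def)
      have fgS: "fg_cone S" by (rule fg_cone_face[OF fg S'(1)])
      have RS: "cone_facet_of R S" by (rule facet[OF R(1) S'(1,2)]) (use S'(3) R(2) in simp)
      have "0 = (\<Sum>R'\<in>facets_over F S. eps R' S * z R')"
        unfolding z_def by (rule coboundary_closed[OF fg sign S'(1), symmetric])
      also have "\<dots> = eps R S * z R + (\<Sum>R'\<in>facets_over F S - {R}. eps R' S * z R')"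
        using RS R(3) by (intro sum.remove finite_facets[OF fgS]) simp
      also have "(\<Sum>R'\<in>facets_over F S - {R}. eps R' S * z R') = 0"
      proof (rule sum.neutral, rule ballI)
        fix R' assume R': "R' \<in> facets_over F S - {R}"
        then have "cone_face_of R' C" "vec.dim R' = 5" "R' \<subseteq> S"
          using facet_face[OF fg S'(1)] facetD[of R' S] S'(3) by auto
        then have "z R' = 0" using none R' by blast
        then show "eps R' S * z R' = 0" by simp
      qed
      finally have "eps R S * z R = 0" by simp
      moreover have "eps R S \<noteq> 0" using sign_systemD(1)[OF sign S'(1) RS] by auto
      ultimately show False using \<open>z R \<noteq> 0\<close> by simp
    qed
    define q where "q = (\<lambda>S. SOME R'. R' \<in> ?NZ - {R} \<and> R' \<subseteq> S)"
    have q: "q S \<in> ?NZ - {R} \<and> q S \<subseteq> S" if "S \<in> face_covers R C" for S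
      unfolding q_def by (rule someI_ex) (rule ex[OF that])
    \<comment> \<open>Two covers of \<open>R\<close> intersect in \<open>R\<close> alone, so they
      cannot share another cone of dimension 5.\<close>
    have "inj_on q (face_covers R C)"
    proof (rule inj_onI, rule ccontr)
      fix S S' assume S: "S \<in> face_covers R C" and S': "S' \<in> face_covers R C"
        and eq: "q S = q S'" and ne: "S \<noteq> S'"
      have Sf: "cone_face_of S C" "R \<subseteq> S" "vec.dim S = 6" and Sf': "cone_face_of S' C" "R \<subseteq> S'" "vec.dim S' = 6"
        using S S' R(2) by (auto simp: face_covers_def)
      have "\<not> S \<subseteq> S'"
        using same_dim_face_eq[OF Sf(1) _ face_subset[OF Sf'(1)]] ne Sf(3) Sf'(3) by auto
      then have RI: "S \<inter> S' = R"
        by (intro cover_Int[OF R(1) Sf(1) Sf'(1) Sf(2) Sf'(2)]) (use Sf(3) R(2) in simp)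
      have "q S \<subseteq> S" using q[OF S] by blast
      moreover have "q S \<subseteq> S'" unfolding eq using q[OF S'] by blast
      ultimately have "q S \<subseteq> R" using RI by blast
      moreover have qS: "cone_face_of (q S) C" "vec.dim (q S) = 5" "q S \<noteq> R" using q[OF S] by blast+
      ultimately show False
        using same_dim_face_eq[OF qS(1) _ face_subset[OF R(1)]] R(2) by simp
    qed
    moreover have "q ` face_covers R C \<subseteq> ?NZ - {R}" using q by blast
    ultimately have "card (face_covers R C) \<le> card (?NZ - {R})"
      using card_inj_on_le finNZ by blast
    also have "\<dots> = card ?NZ - 1" using RNZ finNZ by simp
    finally have "card (face_covers R C) \<le> card ?NZ - 1" .
    moreover have "card ?NZ \<noteq> 0" using RNZ finNZ by auto
    moreover have "vec.dim C \<le> 5 + card (face_covers R C)"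
      using dim_le_card_face_covers[OF fg R(1)] R(2) by simp
    \<comment> \<open>At least 1 + (n - 4) nonzero values stand against at most n - 4. The two
      cardinalities known to be nonzero guard the truncated subtractions.\<close>
    ultimately show False using NZ_small few \<open>card ?Bad \<noteq> 0\<close> by linarith
  qed
  have "(\<Sum>t\<in>facets_over F s. eps t s * y t) = 0"
    if "cone_face_of s C" "F \<subseteq> s" "vec.dim s = vec.dim F + 1 + 1" for s
    using z0[OF that(1) _ that(2)] that(3) F(2) by (simp add: z_def)
  then obtain g where g: "\<And>t. cone_face_of t C \<Longrightarrow> F \<subseteq> t \<Longrightarrow> vec.dim t = vec.dim F + 1 \<Longrightarrow>
      y t = (\<Sum>k\<in>facets_over F t. eps k t * g k)"
    using star_exact[OF fg sign _ F(1), of 1 y] by auto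
  have "X P r F = g F" if P: "cone_face_of P C" "cone_facet_of F P" for P
  proof -
    have "eps F P * X P r F = eps F P * g F"
      using g[OF P(1) facetD(2)[OF P(2)] facetD(3)[OF P(2)]]
      by (simp add: y_def facets_containing_facet[OF P(2)])
    moreover have "eps F P \<noteq> 0" using sign_systemD(1)[OF sign P] by auto
    ultimately show ?thesis by simp
  qed
  then have "clean r F" unfolding clean_def by metis
  then show False using bad by simp
qed

text \<open>
  Once the coefficients do not depend on the three-dimensional face, they form a cocycle on the
  star of each vertex, hence a coboundary there; the potentials are the sought edge cochain.
\<close>

lemma coboundary_if_clean:
  assumes c: "\<And>F. cone_face_of F C \<Longrightarrow> vec.dim F = 3 \<Longrightarrow> c F \<in> vec.span F"
    and clean: "\<And>F r. cone_face_of F C \<Longrightarrow> vec.dim F = 3 \<Longrightarrow> r \<in> rays F \<Longrightarrow> clean r F"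
  obtains b where "\<And>e. cone_face_of e C \<Longrightarrow> vec.dim e = 2 \<Longrightarrow> b e \<in> vec.span e"
    "\<And>F. cone_face_of F C \<Longrightarrow> vec.dim F = 3 \<Longrightarrow> c F = (\<Sum>e\<in>facets F. eps e F *s b e)"
proof -
  define A where "A = (\<lambda>F x. c F = (\<Sum>r\<in>rays F. x r *s generator r) \<and>
      (\<forall>P r. cone_face_of P C \<longrightarrow> cone_facet_of F P \<longrightarrow> r \<in> rays F \<longrightarrow> x r = X P r F))"
  have ex_A: "\<exists>x. A F x"
    if F: "cone_face_of F C" "vec.dim F = 3" for F
  proof (cases "\<exists>P. cone_face_of P C \<and> cone_facet_of F P")
    case True
    then obtain P where P: "cone_face_of P C" "cone_facet_of F P" by blast
    have P4: "vec.dim P = 4" using facetD(3)[OF P(2)] F(2) by simp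
    show ?thesis
      unfolding A_def
    proof (intro exI[of _ "\<lambda>r. X P r F"] conjI allI impI)
      show "c F = (\<Sum>r\<in>rays F. X P r F *s generator r)" by (rule X_repr[OF P(1) P4 P(2)])
      show "X P r F = X P' r F" if "cone_face_of P' C" "cone_facet_of F P'" "r \<in> rays F" for P' r
        by (rule cleanD[OF clean[OF F that(3)] P(1) that(1) P4 P(2) that(2)])
    qed
  next
    \<comment> \<open>A polygon that is a facet of no face, such as the whole cone in dimension 3,
      carries no compatibility condition, and any expansion along its rays will do.\<close>
    case False
    then show ?thesis
      using generator_coordinates[OF fg_cone_face[OF fg F(1)] pointed_face[OF F(1)] c[OF F]]
      unfolding A_def by blast
  qed
  define x where "x = (\<lambda>F. SOME x. A F x)"
  have "A F (x F)" if "cone_face_of F C" "vec.dim F = 3" for F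
    unfolding x_def by (rule someI_ex[OF ex_A[OF that]])
  then have x: "\<And>F. cone_face_of F C \<Longrightarrow> vec.dim F = 3 \<Longrightarrow> c F = (\<Sum>r\<in>rays F. x F r *s generator r)"
    "\<And>F P r. cone_face_of F C \<Longrightarrow> vec.dim F = 3 \<Longrightarrow> cone_face_of P C \<Longrightarrow> cone_facet_of F P \<Longrightarrow>
      r \<in> rays F \<Longrightarrow> x F r = X P r F"
    unfolding A_def by blast+
  define B where "B = (\<lambda>r g. \<forall>F. cone_face_of F C \<longrightarrow> r \<subseteq> F \<longrightarrow> vec.dim F = 3 \<longrightarrow>
      x F r = (\<Sum>e\<in>facets_over r F. eps e F * g e))"
  have ex_B: "\<exists>g. B r g" if r: "r \<in> rays C" for r
  proof -
    have "(\<Sum>F\<in>facets_over r P. eps F P * x F r) = 0"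
      if P: "cone_face_of P C" "r \<subseteq> P" "vec.dim P = vec.dim r + 2 + 1" for P
    proof -
      have P4: "vec.dim P = 4" using P(3) raysD(2)[OF r] by simp
      have rP: "r \<in> rays P" using r P(1,2) rays_face[OF fg P(1)] by blast
      have "x F r = X P r F" if "cone_facet_of F P" "r \<subseteq> F" for F
      proof (rule x(2)[OF _ _ P(1) that(1)])
        show "cone_face_of F C" by (rule facet_face[OF fg P(1) that(1)])
        then show "r \<in> rays F" using r that(2) rays_face[OF fg] by blast
        show "vec.dim F = 3" using facetD(3)[OF that(1)] P4 by simp
      qed
      then have "(\<Sum>F\<in>facets_over r P. eps F P * x F r)
          = (\<Sum>F\<in>facets_over r P. eps F P * X P r F)"
        by (intro sum.cong refl) simp
      then show ?thesis using X_closed[OF P(1) P4 rP] by simp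
    qed
    then obtain g where "\<And>t. cone_face_of t C \<Longrightarrow> r \<subseteq> t \<Longrightarrow> vec.dim t = vec.dim r + 2 \<Longrightarrow>
        x t r = (\<Sum>k\<in>facets_over r t. eps k t * g k)"
      using star_exact[OF fg sign _ raysD(1)[OF r], of 2 "\<lambda>F. x F r"] by auto
    then have "B r g" unfolding B_def using raysD(2)[OF r] by simp
    then show ?thesis by blast
  qed
  define g where "g = (\<lambda>r. SOME g. B r g)"
  have "B r (g r)" if "r \<in> rays C" for r
    unfolding g_def by (rule someI_ex[OF ex_B[OF that]])
  then have g: "x F r = (\<Sum>e\<in>facets_over r F. eps e F * g r e)"
    if "r \<in> rays C" "cone_face_of F C" "r \<subseteq> F" "vec.dim F = 3" for r F
    using that unfolding B_def by blast
  show ?thesis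
  proof (rule that[of "\<lambda>e. \<Sum>r\<in>rays e. g r e *s generator r"])
    fix e assume "cone_face_of e C"
    show "(\<Sum>r\<in>rays e. g r e *s generator r) \<in> vec.span e"
      using generator(1)[OF raysD(2)] face_subset[OF raysD(1)]
      by (intro vec.span_sum vec.span_scale vec.span_base) blast
  next
    fix F assume F: "cone_face_of F C" "vec.dim F = 3"
    have "c F = (\<Sum>r\<in>rays F. (\<Sum>e\<in>facets_over r F. eps e F * g r e) *s generator r)"
      unfolding x(1)[OF F]
    proof (rule sum.cong[OF refl])
      fix r assume "r \<in> rays F"
      then have "r \<in> rays C" "r \<subseteq> F" using rays_face[OF fg F(1)] by auto
      then show "x F r *s generator r = (\<Sum>e\<in>facets_over r F. eps e F * g r e) *s generator r"
        using g F by simp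
    qed
    also have "\<dots> = (\<Sum>e\<in>facets F. eps e F *s (\<Sum>r\<in>rays e. g r e *s generator r))"
      by (rule sum_ray_expansion[OF fg_cone_face[OF fg F(1)] F(2), symmetric])
    finally show "c F = (\<Sum>e\<in>facets F. eps e F *s (\<Sum>r\<in>rays e. g r e *s generator r))" .
  qed
qed

end


section \<open>Faces of a polytope and faces of its cone\<close>

lemma height_one_None [simp]: "height_one x $ None = 1"
  and height_one_Some [simp]: "height_one x $ Some j = x $ j"
  by (simp_all add: height_one_def)

lemma inj_height_one: "inj (height_one :: 'k::linordered_field ^ 'm::finite \<Rightarrow> _)"
proof (rule injI)
  fix x y :: "'k ^ 'm"
  assume "height_one x = height_one y"
  then have "x $ j = y $ j" for j by (metis height_one_Some)
  then show "x = y" by (simp add: Finite_Cartesian_Product.vec_eq_iff)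
qed

lemma option_vec_eqI:
  fixes x y :: "'k::linordered_field ^ 'm::finite option"
  assumes "x $ None = y $ None" "\<And>j. x $ Some j = y $ Some j"
  shows "x = y"
  unfolding Finite_Cartesian_Product.vec_eq_iff
proof
  fix i show "x $ i = y $ i" using assms by (cases i) auto
qed

text \<open>Homogenization is affine, not linear: the additional coordinate of the right-hand side
  is the coefficient sum.\<close>

lemma height_one_affine_combination:
  fixes c :: "'k::linordered_field ^ 'm::finite \<Rightarrow> 'k"
  assumes "sum c T = 1"
  shows "height_one (\<Sum>v\<in>T. c v *s v) = (\<Sum>v\<in>T. c v *s height_one v)"
  by (rule option_vec_eqI) (use assms in simp_all)

lemma height_one_in_cone_over: "height_one x \<in> cone_over P \<longleftrightarrow> x \<in> P"
proof
  assume "height_one x \<in> cone_over P"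
  moreover have "height_one x \<noteq> 0"
    by (metis height_one_None zero_index zero_neq_one)
  ultimately obtain t y where ty: "height_one x = t *s height_one y" "y \<in> P"
    by (auto simp: cone_over_def)
  have "t = 1" using arg_cong[OF ty(1), of "\<lambda>z. z $ None"] by simp
  then have "x = y" using ty(1) injD[OF inj_height_one] by auto
  then show "x \<in> P" using ty(2) by simp
next
  assume "x \<in> P"
  then show "height_one x \<in> cone_over P"
    unfolding cone_over_def by (auto intro!: exI[of _ "1::'a"] exI[of _ x])
qed

lemma conic_sum: "(\<And>i. i \<in> I \<Longrightarrow> x i \<in> conic S) \<Longrightarrow> (\<Sum>i\<in>I. x i) \<in> conic S"
  by (induction I rule: infinite_finite_induct) (auto simp: conic_zero conic_add)

text \<open>Dividing by the coefficient sum \<open>t\<close> turns a conic combination into a convex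
  one; \<open>t = 0\<close> forces all coefficients to vanish and gives the origin.\<close>

lemma cone_over_kconvex_hull:
  assumes "finite S"
  shows "cone_over (kconvex_hull S) = conic (height_one ` S)"
proof (intro equalityI subsetI)
  fix y assume "y \<in> cone_over (kconvex_hull S)"
  then consider "y = 0" | t c T where "y = t *s height_one (\<Sum>v\<in>T. c v *s v)" "0 \<le> t" "T \<subseteq> S"
      "\<forall>v\<in>T. 0 \<le> c v" "sum c T = 1"
    by (auto simp: cone_over_def kconvex_hull_def)
  then show "y \<in> conic (height_one ` S)"
  proof cases
    case 1
    then show ?thesis by (simp add: conic_zero)
  next
    case 2
    have "c v *s height_one v \<in> conic (height_one ` S)" if "v \<in> T" for v
      using that 2 assms by (intro conic_scale conic_base) auto
    then show ?thesis
      unfolding 2(1) height_one_affine_combination[OF 2(5)]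
      by (rule conic_scale[OF conic_sum 2(2)])
  qed
next
  fix y assume "y \<in> conic (height_one ` S)"
  then obtain d where d: "y = (\<Sum>s\<in>height_one ` S. d s *s s)" "\<forall>s\<in>height_one ` S. 0 \<le> d s"
    unfolding conic_def by blast
  define c where "c = (\<lambda>v. d (height_one v))"
  have y: "y = (\<Sum>v\<in>S. c v *s height_one v)" and c: "\<forall>v\<in>S. 0 \<le> c v"
    using d by (simp_all add: c_def sum.reindex inj_on_subset[OF inj_height_one subset_UNIV])
  define t where "t = sum c S"
  show "y \<in> cone_over (kconvex_hull S)"
  proof (cases "t = 0")
    case True
    then have "\<forall>v\<in>S. c v = 0" using c assms by (simp add: t_def sum_nonneg_eq_0_iff)
    then show ?thesis by (simp add: y cone_over_def)
  next
    case False
    have "0 \<le> t" using c by (simp add: t_def sum_nonneg)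
    have one: "(\<Sum>v\<in>S. c v / t) = 1"
      using False by (simp add: t_def flip: sum_divide_distrib)
    have "y = t *s (\<Sum>v\<in>S. (c v / t) *s height_one v)"
      using False by (simp add: y vec.scale_sum_right)
    also have "\<dots> = t *s height_one (\<Sum>v\<in>S. (c v / t) *s v)"
      by (simp add: height_one_affine_combination[OF one])
    finally have y': "y = t *s height_one (\<Sum>v\<in>S. (c v / t) *s v)" .
    have "(\<Sum>v\<in>S. (c v / t) *s v) \<in> kconvex_hull S"
      unfolding kconvex_hull_def using one assms c \<open>0 \<le> t\<close>
      by (intro CollectI exI[of _ S] exI[of _ "\<lambda>v. c v / t"]) auto
    then show ?thesis unfolding cone_over_def using y' \<open>0 \<le> t\<close> by blast
  qed
qed

lemma fg_cone_cone_over: "kpolytope P \<Longrightarrow> fg_cone (cone_over P)"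
  unfolding kpolytope_def fg_cone_def using cone_over_kconvex_hull finite_imageI by blast

lemma klinear_component: "klinear (\<lambda>x. x $ i)"
  by (rule klinearI) auto

text \<open>The height coordinate is nonnegative on the cone and vanishes only at the
  origin.\<close>

lemma cone_over_pointed:
  shows "cone_face_of {0} (cone_over P)"
proof -
  have "\<forall>x\<in>cone_over P. 0 \<le> x $ None" by (auto simp: cone_over_def)
  moreover have "{0} = {x \<in> cone_over P. x $ None = 0}" by (auto simp: cone_over_def)
  ultimately show ?thesis using klinear_component unfolding cone_face_of_def by blast
qed

text \<open>The inverse of \<open>cone_over\<close> on faces, with the empty face corresponding to
  \<open>{0}\<close>.\<close>

definition slice :: "('k::linordered_field ^ 'm::finite option) set \<Rightarrow> ('k ^ 'm) set" where
  "slice \<tau> = {x. height_one x \<in> \<tau>}"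

lemma slice_cone_over [simp]: "slice (cone_over F) = F"
  by (auto simp: slice_def height_one_in_cone_over)

text \<open>The inequality \<open>f x \<le> b\<close> is homogenized to the functional
  \<open>b * t - f x\<close>, where \<open>t\<close> is the height.\<close>

lemma cone_over_face:
  fixes P :: "('k::linordered_field ^ 'm::finite) set"
  assumes "kface_of F P"
  shows "cone_face_of (cone_over F) (cone_over P)"
proof -
  obtain f b where f: "klinear f" "\<forall>x\<in>P. f x \<le> b" "F = {x \<in> P. f x = b}"
    using assms by (auto simp: kface_of_def)
  define tail :: "'k ^ 'm option \<Rightarrow> 'k ^ 'm" where "tail = (\<lambda>y. \<chi> j. y $ Some j)"
  have tail: "tail (x + y) = tail x + tail y" "tail (c *s x) = c *s tail x" for x y c
    by (simp_all add: tail_def Finite_Cartesian_Product.vec_eq_iff)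
  define g where "g = (\<lambda>y. b * (y $ None) - f (tail y))"
  have g: "klinear g"
    by (rule klinearI) (simp_all add: g_def tail klinear_simps[OF f(1)] algebra_simps)
  have tail_h: "tail (height_one x) = x" for x
    by (simp add: tail_def Finite_Cartesian_Product.vec_eq_iff)
  have gh: "g (t *s height_one x) = t * (b - f x)" for t x
    by (simp add: g_def tail tail_h klinear_simps[OF f(1)] algebra_simps)
  have g0: "g 0 = 0" by (rule klinear_zero[OF g])
  have "\<forall>y\<in>cone_over P. 0 \<le> g y"
    using f(2) by (auto simp: cone_over_def g0 gh)
  moreover have "cone_over F = {y \<in> cone_over P. g y = 0}"
  proof (intro equalityI subsetI)
    fix y assume "y \<in> cone_over F"
    then show "y \<in> {y \<in> cone_over P. g y = 0}" using f(3) by (auto simp: cone_over_def g0 gh)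
  next
    fix y assume y: "y \<in> {y \<in> cone_over P. g y = 0}"
    show "y \<in> cone_over F"
    proof (cases "y = 0")
      case False
      then obtain t x where tx: "y = t *s height_one x" "0 \<le> t" "x \<in> P" using y by (auto simp: cone_over_def)
      then have "t \<noteq> 0" using False by auto
      then have "x \<in> F" using y tx f(3) by (simp add: gh)
      then show ?thesis using tx by (auto simp: cone_over_def)
    qed (simp add: cone_over_def)
  qed
  ultimately show ?thesis using g unfolding cone_face_of_def by blast
qed

text \<open>Dehomogenization: restricted to height one, the functional is affine. Its value at
  \<open>height_one 0\<close> is the bound \<open>b\<close>, and minus its linear part is
  \<open>f\<close>.\<close>

lemma face_slice:
  fixes P :: "('k::linordered_field ^ 'm::finite) set"
  assumes "cone_face_of \<tau> (cone_over P)"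
  shows "kface_of (slice \<tau>) P" "cone_over (slice \<tau>) = \<tau>"
proof -
  obtain g where g: "klinear g" "\<forall>x\<in>cone_over P. 0 \<le> g x" "\<tau> = {x \<in> cone_over P. g x = 0}"
    using assms by (auto simp: cone_face_of_def)
  define emb :: "'k ^ 'm \<Rightarrow> 'k ^ 'm option" where
    "emb = (\<lambda>x. height_one x - height_one 0)"
  have emb: "emb (x + y) = emb x + emb y" "emb (c *s x) = c *s emb x" for x y c
    by (auto intro!: option_vec_eqI simp: emb_def)
  define f where "f = (\<lambda>x. - g (emb x))"
  define b where "b = g (height_one 0)"
  have f: "klinear f"
    by (rule klinearI) (simp_all add: f_def emb klinear_simps[OF g(1)] algebra_simps)
  have gh: "g (height_one x) = b - f x" for x
  proof -
    have "height_one x = height_one 0 + emb x"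
      by (rule option_vec_eqI) (simp_all add: emb_def)
    then show ?thesis by (simp add: b_def f_def klinear_simps[OF g(1)])
  qed
  have "\<forall>x\<in>P. f x \<le> b"
    using g(2) gh height_one_in_cone_over by (metis diff_ge_0_iff_ge)
  moreover have "slice \<tau> = {x \<in> P. f x = b}"
    using g(3) gh by (auto simp: slice_def height_one_in_cone_over)
  ultimately show "kface_of (slice \<tau>) P" using f unfolding kface_of_def by blast
  show "cone_over (slice \<tau>) = \<tau>"
  proof (intro equalityI subsetI)
    fix y assume "y \<in> cone_over (slice \<tau>)"
    then show "y \<in> \<tau>"
    proof (cases "y = 0")
      case True
      then show ?thesis using g(3) by (simp add: cone_over_def klinear_zero[OF g(1)])
    next
      case False
      then obtain t x where tx: "y = t *s height_one x" "0 \<le> t" "height_one x \<in> \<tau>"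
        using \<open>y \<in> cone_over (slice \<tau>)\<close> by (auto simp: cone_over_def slice_def)
      then have "x \<in> P" "g (height_one x) = 0" using g(3) height_one_in_cone_over by auto
      then have "y \<in> cone_over P" "g y = 0"
        using tx by (auto simp: cone_over_def klinear_simps[OF g(1)])
      then show ?thesis using g(3) by blast
    qed
  next
    fix y assume y: "y \<in> \<tau>"
    show "y \<in> cone_over (slice \<tau>)"
    proof (cases "y = 0")
      case False
      then obtain t x where tx: "y = t *s height_one x" "0 \<le> t" "x \<in> P"
        using y g(3) by (auto simp: cone_over_def)
      then have "t \<noteq> 0" using False by auto
      then have "g (height_one x) = 0" using y g(3) tx by (simp add: klinear_simps[OF g(1)])
      then have "x \<in> slice \<tau>" using g(3) tx(3) by (simp add: slice_def height_one_in_cone_over)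
      then show ?thesis using tx by (auto simp: cone_over_def)
    qed (simp add: cone_over_def)
  qed
qed

text \<open>The cone is spanned by one lifted point and the differences embedded at height 0. The
  lifted point has height 1, so it adds a dimension.\<close>

lemma dim_cone_over:
  fixes F :: "('k::linordered_field ^ 'm::finite) set"
  assumes "F \<noteq> {}"
  shows "vec.dim (cone_over F) = kdim F + 1"
proof -
  obtain x0 where x0: "x0 \<in> F" using assms by blast
  define emb :: "'k ^ 'm \<Rightarrow> 'k ^ 'm option" where
    "emb = (\<lambda>x. height_one x - height_one 0)"
  have emb_simps: "emb x $ None = 0" "emb x $ Some j = x $ j" for x j by (simp_all add: emb_def)
  have emb_diff: "emb (x - y) = height_one x - height_one y" for x y
    by (rule option_vec_eqI) (simp_all add: emb_simps)
  have lin: "Vector_Spaces.linear (*s) (*s) emb"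
    unfolding Vector_Spaces.linear_iff
    by (intro conjI allI vec.vector_space_axioms option_vec_eqI) (simp_all add: emb_simps)
  have inj: "inj emb"
  proof (rule injI)
    fix x y assume "emb x = emb y"
    then have "x $ j = y $ j" for j by (metis emb_simps(2))
    then show "x = y" by (simp add: Finite_Cartesian_Product.vec_eq_iff)
  qed
  let ?D = "{x - y | x y. x \<in> F \<and> y \<in> F}"
  have dimD: "vec.dim (emb ` ?D) = kdim F"
    unfolding kdim_def by (rule vec.dim_image_eq[OF lin inj_on_subset[OF inj]]) simp
  have None0: "v $ None = 0" if "v \<in> vec.span (emb ` ?D)" for v
    by (rule klinear_vanishes_span[OF klinear_component _ that]) (use emb_simps(1) in blast)
  have "height_one x0 \<notin> vec.span (emb ` ?D)"
    using None0[of "height_one x0"] by auto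
  then have d: "vec.dim (insert (height_one x0) (emb ` ?D)) = kdim F + 1"
    using dimD by (simp add: vec.dim_insert)
  have "cone_over F \<subseteq> vec.span (insert (height_one x0) (emb ` ?D))"
  proof
    fix y assume y: "y \<in> cone_over F"
    show "y \<in> vec.span (insert (height_one x0) (emb ` ?D))"
    proof (cases "y = 0")
      case False
      then obtain t x where tx: "y = t *s height_one x" "x \<in> F" using y by (auto simp: cone_over_def)
      have "height_one x = height_one x0 + emb (x - x0)" by (simp add: emb_diff)
      moreover have "emb (x - x0) \<in> emb ` ?D" using tx(2) x0 by blast
      ultimately show ?thesis
        unfolding tx(1) by (auto intro!: vec.span_scale vec.span_add intro: vec.span_base)
    qed (simp add: vec.span_zero)
  qed
  from vec.dim_subset[OF this] have "vec.dim (cone_over F) \<le> kdim F + 1" by (simp add: vec.dim_span d)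
  moreover
  have "insert (height_one x0) (emb ` ?D) \<subseteq> vec.span (cone_over F)"
  proof -
    have sp: "height_one x \<in> vec.span (cone_over F)" if "x \<in> F" for x
      by (rule vec.span_base) (rule iffD2[OF height_one_in_cone_over that])
    show ?thesis
    proof
      fix y assume "y \<in> insert (height_one x0) (emb ` ?D)"
      then consider "y = height_one x0" | x1 x2 where "x1 \<in> F" "x2 \<in> F" "y = height_one x1 - height_one x2"
        using emb_diff by blast
      then show "y \<in> vec.span (cone_over F)"
        by cases (simp_all add: sp x0 vec.span_diff)
    qed
  qed
  from vec.dim_subset[OF this] have "kdim F + 1 \<le> vec.dim (cone_over F)" by (simp add: vec.dim_span d)
  ultimately show ?thesis by simp
qed

section \<open>Faces and vertices under the cone correspondence\<close>

lemma cone_over_empty: "cone_over {} = {0}"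
  by (simp add: cone_over_def)

lemma kfaces_cone_over:
  assumes "F \<in> kfaces d P"
  shows "cone_face_of (cone_over F) (cone_over P)" "vec.dim (cone_over F) = d + 1"
  using assms cone_over_face dim_cone_over by (auto simp: kfaces_def)

lemma slice_kfaces:
  assumes "cone_face_of \<tau> (cone_over P)" "vec.dim \<tau> = d + 1"
  shows "slice \<tau> \<in> kfaces d P"
proof -
  note s = face_slice[OF assms(1)]
  have ne: "slice \<tau> \<noteq> {}"
    using s(2) assms(2) cone_over_empty dim_zero_face by (metis add_is_0 zero_neq_one)
  then show ?thesis
    using s(1) dim_cone_over[OF ne] s(2) assms(2) by (simp add: kfaces_def)
qed

lemma kdim_singleton: "kdim {v} = 0"
  by (simp add: kdim_def dim_zero_face)

lemma rays_cone_over: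
  shows "rays (cone_over P) = (\<lambda>v. cone_over {v}) ` kvertices P"
proof (intro equalityI subsetI)
  fix r assume r: "r \<in> rays (cone_over P)"
  then have "slice r \<in> kfaces 0 P" using slice_kfaces[of r P 0] by (simp add: rays_def)
  then have s: "kface_of (slice r) P" "slice r \<noteq> {}" "kdim (slice r) = 0" by (auto simp: kfaces_def)
  obtain v where v: "v \<in> slice r" using s(2) by blast
  have "x = v" if "x \<in> slice r" for x
  proof -
    have "{x - y | x y. x \<in> slice r \<and> y \<in> slice r} \<subseteq> {0}"
      using s(3) unfolding kdim_def by simp
    moreover have "x - v \<in> {x - y | x y. x \<in> slice r \<and> y \<in> slice r}" using that v by blast
    ultimately have "x - v \<in> {0}" by (rule subsetD)
    then show ?thesis by simp
  qed
  then have eq: "slice r = {v}" using v by blast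
  then have "r = cone_over {v}" using face_slice(2)[OF raysD(1)[OF r]] by simp
  then show "r \<in> (\<lambda>v. cone_over {v}) ` kvertices P" using s(1) eq by (auto simp: kvertices_def)
next
  fix r assume "r \<in> (\<lambda>v. cone_over {v}) ` kvertices P"
  then obtain v where v: "kface_of {v} P" "r = cone_over {v}" by (auto simp: kvertices_def)
  have "vec.dim r = 1" using dim_cone_over[of "{v}"] kdim_singleton[of v] by (simp add: v(2))
  then show "r \<in> rays (cone_over P)"
    using cone_over_face[OF v(1)] v(2) by (simp add: rays_def)
qed

lemma cone_over_subset_iff: "cone_over F \<subseteq> cone_over G \<longleftrightarrow> F \<subseteq> G"
proof
  assume "cone_over F \<subseteq> cone_over G"
  then show "F \<subseteq> G" using height_one_in_cone_over by blast
qed (auto simp: cone_over_def)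

lemma inj_cone_over: "inj cone_over"
  by (rule injI) (metis slice_cone_over)

lemma inj_vertex_ray: "inj (\<lambda>v. cone_over {v})"
  by (rule injI) (metis slice_cone_over singleton_inject)

lemma finite_kvertices:
  assumes "fg_cone (cone_over P)"
  shows "finite (kvertices P)"
  using finite_rays[OF assms] unfolding rays_cone_over
  by (rule finite_imageD) (rule inj_on_subset[OF inj_vertex_ray subset_UNIV])

lemma finite_kfaces:
  assumes "fg_cone (cone_over P)"
  shows "finite (kfaces d P)"
proof (rule finite_imageD)
  have "cone_over ` kfaces d P \<subseteq> {\<tau>. cone_face_of \<tau> (cone_over P)}" using kfaces_cone_over by blast
  then show "finite (cone_over ` kfaces d P)" using finite_faces[OF assms] finite_subset by blast
qed (rule inj_on_subset[OF inj_cone_over subset_UNIV])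

text \<open>A point off the affine hull of the base lifts to a vector off the linear span of the
  lifted base, which gives a height functional vanishing on the base. The required property is
  stable under sums and nonnegative multiples, so it need only be checked on lifts of
  \<open>a\<close> and of points of \<open>B\<close>.\<close>

lemma cone_pyramid_cone_over:
  fixes P :: "('k::linordered_field ^ 'm::finite) set"
  assumes "kpyramid P" "fg_cone (cone_over P)"
  shows "\<exists>a ht. cone_pyramid (cone_over P) a ht"
proof -
  obtain B a where B: "a \<notin> kaffine_hull B" "P = kconvex_hull (insert a B)"
    using assms(1) by (auto simp: kpyramid_def)
  let ?a = "height_one a"
  have "?a \<notin> vec.span (height_one ` B)"
  proof
    assume "?a \<in> vec.span (height_one ` B)"
    then obtain T u where T: "finite T" "T \<subseteq> height_one ` B" "?a = (\<Sum>v\<in>T. u v *s v)"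
      by (auto simp: vec.span_explicit)
    obtain S where S: "S \<subseteq> B" "T = height_one ` S" using T(2) by (auto simp: subset_image_iff)
    have inj: "inj_on height_one S" by (rule inj_on_subset[OF inj_height_one subset_UNIV])
    define c where "c = (\<lambda>v. u (height_one v))"
    have fin: "finite S" using T(1) finite_imageD[OF _ inj] S(2) by blast
    have a: "?a = (\<Sum>v\<in>S. c v *s height_one v)"
      unfolding T(3) S(2) by (simp add: sum.reindex[OF inj] c_def)
    have one: "sum c S = 1" using arg_cong[OF a, of "\<lambda>z. z $ None"] by simp
    have "a = (\<Sum>v\<in>S. c v *s v)"
      by (rule injD[OF inj_height_one]) (use a height_one_affine_combination[OF one] in simp)
    then have "a \<in> kaffine_hull B" using S(1) fin one unfolding kaffine_hull_def by blast
    then show False using B(1) by simp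
  qed
  then obtain ht where ht: "klinear ht" "\<forall>y\<in>vec.span (height_one ` B). ht y = 0" "ht ?a = 1"
    by (rule exists_separating_klinear)
  define Q where "Q = {x \<in> cone_over P. 0 \<le> ht x \<and> x - ht x *s ?a \<in> cone_over P}"
  have Q0: "0 \<in> Q"
    using fg_cone_zero[OF assms(2)] by (simp add: Q_def klinear_zero[OF ht(1)])
  have Qadd: "x + y \<in> Q" if "x \<in> Q" "y \<in> Q" for x y
  proof -
    have eq: "x + y - ht (x + y) *s ?a = (x - ht x *s ?a) + (y - ht y *s ?a)"
      by (simp add: klinear_simps[OF ht(1)] vec.scale_left_distrib)
    have "0 \<le> ht (x + y)" using that by (simp add: Q_def klinear_simps[OF ht(1)])
    then show ?thesis
      using that fg_cone_add[OF assms(2)] unfolding Q_def mem_Collect_eq eq by blast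
  qed
  have Qscale: "t *s x \<in> Q" if "x \<in> Q" "0 \<le> t" for t x
  proof -
    have eq: "t *s x - ht (t *s x) *s ?a = t *s (x - ht x *s ?a)"
      by (simp add: klinear_simps[OF ht(1)] vec.scale_right_diff_distrib vec.scale_scale)
    have "0 \<le> ht (t *s x)" using that by (simp add: Q_def klinear_simps[OF ht(1)])
    then show ?thesis
      using that fg_cone_scale[OF assms(2)] unfolding Q_def mem_Collect_eq eq by blast
  qed
  have hP: "height_one v \<in> cone_over P" if "v \<in> insert a B" for v
  proof -
    have "v \<in> P"
      unfolding B(2) kconvex_hull_def using that
      by (intro CollectI exI[of _ "{v}"] exI[of _ "\<lambda>_. 1"]) auto
    then show ?thesis by (simp add: height_one_in_cone_over)
  qed
  have Qh: "height_one v \<in> Q" if "v \<in> insert a B" for v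
  proof (cases "v = a")
    case True
    then show ?thesis using hP[OF that] fg_cone_zero[OF assms(2)] ht(3) by (simp add: Q_def)
  next
    case False
    then have "ht (height_one v) = 0" using ht(2) that by (simp add: vec.span_base)
    then show ?thesis using hP[OF that] by (simp add: Q_def)
  qed
  have Qsum: "(\<Sum>v\<in>T. x v) \<in> Q" if "\<And>v. v \<in> T \<Longrightarrow> x v \<in> Q" for x and T :: "('k ^ 'm) set"
    using that by (induction T rule: infinite_finite_induct) (auto simp: Q0 Qadd)
  have "y \<in> Q" if "y \<in> cone_over P" for y
  proof (cases "y = 0")
    case False
    then obtain t x where tx: "y = t *s height_one x" "0 \<le> t" "x \<in> P" using \<open>y \<in> cone_over P\<close>
      by (auto simp: cone_over_def)
    then obtain T c where T: "x = (\<Sum>v\<in>T. c v *s v)" "T \<subseteq> insert a B" "\<forall>v\<in>T. 0 \<le> c v" "sum c T = 1"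
      unfolding B(2) kconvex_hull_def by blast
    show ?thesis
      unfolding tx(1) T(1) height_one_affine_combination[OF T(4)]
      using T(2,3) Qh by (intro Qscale[OF _ tx(2)] Qsum Qscale) auto
  qed (simp add: Q0)
  then show ?thesis
    using ht(1,3) hP[of a] unfolding cone_pyramid_def Q_def by blast
qed


section \<open>The cleaning process\<close>

lemma vertex_ray_iff: "cone_over {v} \<in> rays (cone_over P) \<longleftrightarrow> v \<in> kvertices P"
  unfolding rays_cone_over using injD[OF inj_vertex_ray] by blast

lemma kvertices_subset: "kvertices P \<subseteq> P"
  by (auto simp: kvertices_def kface_of_def)

lemma kvertices_kface:
  assumes "fg_cone (cone_over P)" "F \<in> kfaces d P"
  shows "kvertices F = kvertices P \<inter> F"
proof -
  have "v \<in> kvertices F \<longleftrightarrow> v \<in> kvertices P \<and> v \<in> F" for v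
    using rays_face[OF assms(1) kfaces_cone_over(1)[OF assms(2)]]
    by (simp add: cone_over_subset_iff flip: vertex_ray_iff)
  then show ?thesis by blast
qed

locale polytope_cocycle = cocycle_coefficients "cone_over \<Delta>" eps c X
  for \<Delta> :: "('k::linordered_field ^ 'n::finite) set" and eps c X +
  assumes nonempty: "\<Delta> \<noteq> {}"
begin

text \<open>The combinatorial process is sound for the algebraic property: its steps are instances
  of \<open>polygon_rule\<close> and \<open>vertex_rule\<close>. The two halves feed each other,
  rule (i) using the clean vertices and rule (ii) the clean polygons.\<close>

lemma clean_step_invariant:
  assumes "(clean_step \<Delta>)\<^sup>*\<^sup>* ({}, {}) (V, C)"
  shows "(\<forall>v\<in>V. \<forall>F\<in>kfaces 2 \<Delta>. v \<in> F \<longrightarrow> clean (cone_over {v}) (cone_over F)) \<and>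
    (\<forall>F\<in>C. \<forall>v\<in>kvertices F. clean (cone_over {v}) (cone_over F))"
  using assms
proof (induction "(V, C)" arbitrary: V C rule: rtranclp_induct)
  case base
  then show ?case by simp
next
  case (step s)
  obtain V0 C0 where s: "s = (V0, C0)" by (cases s)
  have V0: "clean (cone_over {v}) (cone_over F)" if "v \<in> V0" "F \<in> kfaces 2 \<Delta>" "v \<in> F" for v F
    using step.hyps(3)[OF s] that by blast
  have C0: "clean (cone_over {v}) (cone_over F)" if "F \<in> C0" "v \<in> kvertices F" for v F
    using step.hyps(3)[OF s] that by blast
  from step.hyps(2) show ?case
    unfolding s
  proof (cases rule: clean_step.cases)
    case (clean_face F)
    have F: "cone_face_of (cone_over F) (cone_over \<Delta>)" "vec.dim (cone_over F) = 3"
      using kfaces_cone_over[OF clean_face(3)] by simp_all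
    have fin: "finite (kvertices F)" by (rule finite_kvertices[OF fg_cone_face[OF fg F(1)]])
    have "card (kvertices F - V0) = card (kvertices F) - card (kvertices F \<inter> V0)"
      using fin by (simp add: card_Diff_subset_Int)
    then have "card (kvertices F - V0) \<le> 3" using clean_face(4) by simp
    moreover have "{r \<in> rays (cone_over F). r \<notin> (\<lambda>v. cone_over {v}) ` V0}
        \<subseteq> (\<lambda>v. cone_over {v}) ` (kvertices F - V0)"
      unfolding rays_cone_over by blast
    then have "card {r \<in> rays (cone_over F). r \<notin> (\<lambda>v. cone_over {v}) ` V0} \<le> card (kvertices F - V0)"
      using fin by (intro surj_card_le) auto
    ultimately have few: "card {r \<in> rays (cone_over F). r \<notin> (\<lambda>v. cone_over {v}) ` V0} \<le> 3" by simp
    have "clean (cone_over {v}) (cone_over F)" if "v \<in> kvertices F" for v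
    proof (rule polygon_rule[OF F(1) few])
      show "cone_over {v} \<in> rays (cone_over F)" using that by (simp add: vertex_ray_iff)
      fix r assume "r \<in> rays (cone_over F)" "r \<in> (\<lambda>v. cone_over {v}) ` V0"
      then obtain u where u: "r = cone_over {u}" "u \<in> V0" "u \<in> kvertices F"
        by (auto simp: vertex_ray_iff)
      then show "clean r (cone_over F)" using V0[OF u(2) clean_face(3)] kvertices_subset by blast
    qed
    then show ?thesis using clean_face(1,2) V0 C0 by auto
  next
    case (clean_vertex v)
    let ?B = "{F. cone_face_of F (cone_over \<Delta>) \<and> vec.dim F = 3 \<and> cone_over {v} \<subseteq> F \<and> \<not> clean (cone_over {v}) F}"
    let ?U = "{F \<in> kfaces 2 \<Delta>. v \<in> F \<and> F \<notin> C0}"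
    have v: "cone_over {v} \<in> rays (cone_over \<Delta>)" using clean_vertex(3) by (simp add: vertex_ray_iff)
    \<comment> \<open>Clean polygons are unobstructed at all their vertices, so a polygon obstructed
      at \<open>v\<close> is not clean yet. The bound of rule (ii) therefore also bounds the
      obstructed polygons.\<close>
    have "?B \<subseteq> cone_over ` ?U"
    proof
      fix F assume F: "F \<in> ?B"
      have sl: "slice F \<in> kfaces 2 \<Delta>" "cone_over (slice F) = F"
        using slice_kfaces[of F \<Delta> 2] face_slice(2)[of F \<Delta>] F by simp_all
      have vF: "v \<in> slice F"
        using F sl(2) cone_over_subset_iff[of "{v}" "slice F"] by simp
      then have "v \<in> kvertices (slice F)"
        using kvertices_kface[OF fg sl(1)] clean_vertex(3) by blast
      then have "slice F \<notin> C0" using C0[of "slice F" v] sl(2) F by auto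
      then have "slice F \<in> ?U" using sl(1) vF by blast
      then have "cone_over (slice F) \<in> cone_over ` ?U" by (rule imageI)
      then show "F \<in> cone_over ` ?U" unfolding sl(2) .
    qed
    moreover have "finite ?U" by (rule finite_subset[OF _ finite_kfaces[OF fg]]) auto
    ultimately have "card ?B \<le> card ?U" by (rule surj_card_le[rotated])
    \<comment> \<open>The 3 of rule (ii) becomes 4 because the cone has one dimension more than
      \<Delta>.\<close>
    then have few: "card ?B + 4 \<le> vec.dim (cone_over \<Delta>)"
      using clean_vertex(4) dim_cone_over[OF nonempty] by simp
    have "clean (cone_over {v}) (cone_over F)" if "F \<in> kfaces 2 \<Delta>" "v \<in> F" for F
      using vertex_rule[OF v few, of "cone_over F"] kfaces_cone_over[OF that(1)] that(2)
      by (simp add: cone_over_subset_iff)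
    then show ?thesis using clean_vertex(1,2) V0 C0 by auto
  qed
qed

text \<open>Each of the two hypotheses reaches every incidence of a vertex and a polygon, through
  its own half of the invariant.\<close>

lemma clean_if_cleanable:
  assumes "(\<forall>v \<in> kvertices \<Delta>. vertex_may_be_cleaned \<Delta> v) \<or> (\<forall>F \<in> kfaces 2 \<Delta>. face_may_be_cleaned \<Delta> F)"
    and F: "cone_face_of F (cone_over \<Delta>)" "vec.dim F = 3" "r \<in> rays F"
  shows "clean r F"
proof -
  have sl: "slice F \<in> kfaces 2 \<Delta>" "cone_over (slice F) = F"
    using slice_kfaces[of F \<Delta> 2] face_slice(2)[OF F(1)] F by simp_all
  have "r \<in> rays (cone_over (slice F))" using F(3) sl(2) by simp
  then obtain v where v: "v \<in> kvertices (slice F)" "r = cone_over {v}"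
    unfolding rays_cone_over by blast
  have v\<Delta>: "v \<in> kvertices \<Delta>" "v \<in> slice F" using v(1) kvertices_kface[OF fg sl(1)] by auto
  from assms(1) have "clean (cone_over {v}) (cone_over (slice F))"
  proof
    assume "\<forall>v \<in> kvertices \<Delta>. vertex_may_be_cleaned \<Delta> v"
    then obtain V C where "(clean_step \<Delta>)\<^sup>*\<^sup>* ({}, {}) (V, C)" "v \<in> V"
      using v\<Delta>(1) unfolding vertex_may_be_cleaned_def by blast
    then show ?thesis using clean_step_invariant sl(1) v\<Delta>(2) by blast
  next
    assume "\<forall>F \<in> kfaces 2 \<Delta>. face_may_be_cleaned \<Delta> F"
    then obtain V C where "(clean_step \<Delta>)\<^sup>*\<^sup>* ({}, {}) (V, C)" "slice F \<in> C"
      using sl(1) unfolding face_may_be_cleaned_def by blast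
    then show ?thesis using clean_step_invariant v(1) by blast
  qed
  then show ?thesis unfolding v(2) sl(2) .
qed

end

text \<open>Both rules are monotone: further clean vertices or polygons never block an application.
  A run can therefore be replayed on top of any state.\<close>

lemma clean_step_join:
  assumes fg: "fg_cone (cone_over P)"
    and "(clean_step P)\<^sup>*\<^sup>* ({}, {}) (V1, C1)"
  shows "(clean_step P)\<^sup>*\<^sup>* (V, C) (V \<union> V1, C \<union> C1)"
  using assms(2)
proof (induction "(V1, C1)" arbitrary: V1 C1 rule: rtranclp_induct)
  case base
  then show ?case by simp
next
  case (step s)
  obtain V0 C0 where s: "s = (V0, C0)" by (cases s)
  have "clean_step P (V \<union> V0, C \<union> C0) (V \<union> V1, C \<union> C1)"
    using step.hyps(2) unfolding s
  proof (cases rule: clean_step.cases)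
    case (clean_face F)
    have "finite (kvertices F)"
      by (rule finite_kvertices[OF fg_cone_face[OF fg kfaces_cone_over(1)[OF clean_face(3)]]])
    then have "card (kvertices F \<inter> V0) \<le> card (kvertices F \<inter> (V \<union> V0))"
      by (intro card_mono) auto
    then have "card (kvertices F) \<le> card (kvertices F \<inter> (V \<union> V0)) + 3"
      using clean_face(4) by simp
    from clean_step.clean_face[OF clean_face(3) this, of "C \<union> C0"]
    show ?thesis using clean_face(1,2) by simp
  next
    case (clean_vertex v)
    have "card {F \<in> kfaces 2 P. v \<in> F \<and> F \<notin> C \<union> C0} \<le> card {F \<in> kfaces 2 P. v \<in> F \<and> F \<notin> C0}"
      by (intro card_mono finite_subset[OF _ finite_kfaces[OF fg, of 2]]) auto
    then have "card {F \<in> kfaces 2 P. v \<in> F \<and> F \<notin> C \<union> C0} + 3 \<le> kdim P"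
      using clean_vertex(4) by simp
    from clean_step.clean_vertex[OF clean_vertex(3) this, of "V \<union> V0"]
    show ?thesis using clean_vertex(1,2) by simp
  qed
  then show ?case using step.hyps(3)[OF s] by (rule rtranclp.rtrancl_into_rtrancl[rotated])
qed

text \<open>Cleanability provides a separate run for each vertex or polygon; replaying finitely many
  runs one after the other reaches a common state.\<close>

lemma simultaneous_cleaning:
  assumes fg: "fg_cone (cone_over P)" and "finite I"
    and "\<forall>i\<in>I. \<exists>V C. (clean_step P)\<^sup>*\<^sup>* ({}, {}) (V, C) \<and> A i \<subseteq> V \<and> B i \<subseteq> C"
  shows "\<exists>V C. (clean_step P)\<^sup>*\<^sup>* ({}, {}) (V, C) \<and> \<Union> (A ` I) \<subseteq> V \<and> \<Union> (B ` I) \<subseteq> C"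
  using assms(2,3)
proof (induction I rule: finite_induct)
  case (insert i I)
  obtain V1 C1 where 1: "(clean_step P)\<^sup>*\<^sup>* ({}, {}) (V1, C1)" "\<Union> (A ` I) \<subseteq> V1" "\<Union> (B ` I) \<subseteq> C1"
    using insert.IH insert.prems by auto
  obtain V2 C2 where 2: "(clean_step P)\<^sup>*\<^sup>* ({}, {}) (V2, C2)" "A i \<subseteq> V2" "B i \<subseteq> C2"
    using insert.prems by blast
  show ?case
  proof (intro exI conjI)
    show "(clean_step P)\<^sup>*\<^sup>* ({}, {}) (V1 \<union> V2, C1 \<union> C2)"
      by (rule rtranclp_trans[OF 1(1) clean_step_join[OF fg 2(1)]])
  qed (use 1 2 in auto)
qed auto

text \<open>Once all vertices are clean, rule (i) applies to every polygon. Once all polygons are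
  clean, rule (ii) asks for \<open>0 + 3 \<le> kdim P\<close>, which is where the bound on the
  dimension enters.\<close>

lemma vertices_cleanable_iff_faces_cleanable:
  assumes fg: "fg_cone (cone_over P)" and dim: "3 \<le> kdim P"
  shows "(\<forall>v \<in> kvertices P. vertex_may_be_cleaned P v) \<longleftrightarrow> (\<forall>F \<in> kfaces 2 P. face_may_be_cleaned P F)"
proof (intro iffI ballI)
  fix F assume v: "\<forall>v \<in> kvertices P. vertex_may_be_cleaned P v" and F: "F \<in> kfaces 2 P"
  obtain V C where VC: "(clean_step P)\<^sup>*\<^sup>* ({}, {}) (V, C)" "kvertices P \<subseteq> V"
    using simultaneous_cleaning[OF fg finite_kvertices[OF fg], where A = "\<lambda>v. {v}" and B = "\<lambda>_. {}"] v
    by (auto simp: vertex_may_be_cleaned_def)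
  have "kvertices F \<inter> V = kvertices F" using VC(2) kvertices_kface[OF fg F] by blast
  then have "clean_step P (V, C) (V, insert F C)" by (intro clean_step.clean_face[OF F]) simp
  then have "(clean_step P)\<^sup>*\<^sup>* ({}, {}) (V, insert F C)" using VC(1) by (rule rtranclp.rtrancl_into_rtrancl[rotated])
  then show "face_may_be_cleaned P F" unfolding face_may_be_cleaned_def by blast
next
  fix v assume F: "\<forall>F \<in> kfaces 2 P. face_may_be_cleaned P F" and v: "v \<in> kvertices P"
  obtain V C where VC: "(clean_step P)\<^sup>*\<^sup>* ({}, {}) (V, C)" "kfaces 2 P \<subseteq> C"
    using simultaneous_cleaning[OF fg finite_kfaces[OF fg, of 2], where A = "\<lambda>_. {}" and B = "\<lambda>F. {F}"] F
    by (auto simp: face_may_be_cleaned_def)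
  have none: "{F \<in> kfaces 2 P. v \<in> F \<and> F \<notin> C} = {}" using VC(2) by blast
  have "clean_step P (V, C) (insert v V, C)"
    by (rule clean_step.clean_vertex[OF v]) (unfold none, use dim in simp)
  then have "(clean_step P)\<^sup>*\<^sup>* ({}, {}) (insert v V, C)" using VC(1) by (rule rtranclp.rtrancl_into_rtrancl[rotated])
  then show "vertex_may_be_cleaned P v" unfolding vertex_may_be_cleaned_def by blast
qed

section \<open>Vanishing of \<open>D\<^sup>2\<close>\<close>

lemma cochain_diff_add:
  "cochain_diff ori \<Sigma> (\<lambda>\<tau> \<sigma> x. x) k (\<lambda>\<sigma>. a \<sigma> + b \<sigma>)
    = (\<lambda>\<sigma>. cochain_diff ori \<Sigma> (\<lambda>\<tau> \<sigma> x. x) k a \<sigma> + cochain_diff ori \<Sigma> (\<lambda>\<tau> \<sigma> x. x) k b \<sigma>)"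
  by (simp add: cochain_diff_def fun_eq_iff sum.distrib vec.scale_right_distrib)

lemma cochain_diff_diff:
  "cochain_diff ori \<Sigma> (\<lambda>\<tau> \<sigma> x. x) k (\<lambda>\<sigma>. a \<sigma> - b \<sigma>)
    = (\<lambda>\<sigma>. cochain_diff ori \<Sigma> (\<lambda>\<tau> \<sigma> x. x) k a \<sigma> - cochain_diff ori \<Sigma> (\<lambda>\<tau> \<sigma> x. x) k b \<sigma>)"
  by (simp add: cochain_diff_def fun_eq_iff sum_subtractf vec.scale_right_diff_distrib)

lemma cochains_span_add:
  "a \<in> cochains \<Sigma> vec.span k \<Longrightarrow> b \<in> cochains \<Sigma> vec.span k \<Longrightarrow> (\<lambda>\<sigma>. a \<sigma> + b \<sigma>) \<in> cochains \<Sigma> vec.span k"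
  by (auto simp: cochains_def vec.span_add split: if_splits)

lemma cochains_span_diff:
  "a \<in> cochains \<Sigma> vec.span k \<Longrightarrow> b \<in> cochains \<Sigma> vec.span k \<Longrightarrow> (\<lambda>\<sigma>. a \<sigma> - b \<sigma>) \<in> cochains \<Sigma> vec.span k"
  by (auto simp: cochains_def vec.span_diff split: if_splits)

lemma zero_cocycle: "(\<lambda>_. 0) \<in> cocycles ori \<Sigma> vec.span (\<lambda>\<tau> \<sigma> x. x) k"
  by (auto simp: cocycles_def cochains_def cochain_diff_def fun_eq_iff vec.span_zero)

text \<open>Cohomology is a set of cosets, so vanishing means that only the coset of 0 occurs.
  Translation by a preimage of \<open>c\<close> identifies the coset of \<open>c\<close> with
  it.\<close>

lemma span_cohomology_trivial:
  assumes "\<And>c. c \<in> cocycles ori \<Sigma> vec.span (\<lambda>\<tau> \<sigma> x. x) (Suc k) \<Longrightarrow>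
    \<exists>b\<in>cochains \<Sigma> vec.span k. c = cochain_diff ori \<Sigma> (\<lambda>\<tau> \<sigma> x. x) k b"
  shows "cohomology ori \<Sigma> vec.span (\<lambda>\<tau> \<sigma> x. x) (Suc k)
    = {cohomology_class ori \<Sigma> vec.span (\<lambda>\<tau> \<sigma> x. x) (Suc k) (\<lambda>_. 0)}"
proof -
  let ?\<delta> = "cochain_diff ori \<Sigma> (\<lambda>\<tau> \<sigma> x. x) k"
  let ?B = "?\<delta> ` cochains \<Sigma> vec.span k"
  have cls: "cohomology_class ori \<Sigma> vec.span (\<lambda>\<tau> \<sigma> x. x) (Suc k) c = {(\<lambda>\<sigma>. c \<sigma> + d \<sigma>) | d. d \<in> ?B}" for c
    by (simp add: cohomology_class_def coboundaries_def)
  have "{(\<lambda>\<sigma>. c \<sigma> + d \<sigma>) | d. d \<in> ?B} = {(\<lambda>\<sigma>. 0 + d \<sigma>) | d. d \<in> ?B}"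
    if c: "c \<in> cocycles ori \<Sigma> vec.span (\<lambda>\<tau> \<sigma> x. x) (Suc k)" for c
  proof -
    obtain b where b: "b \<in> cochains \<Sigma> vec.span k" "c = ?\<delta> b" using assms[OF c] by blast
    show ?thesis
    proof (intro equalityI subsetI)
      fix x assume "x \<in> {(\<lambda>\<sigma>. c \<sigma> + d \<sigma>) | d. d \<in> ?B}"
      then obtain a where a: "a \<in> cochains \<Sigma> vec.span k" "x = (\<lambda>\<sigma>. c \<sigma> + ?\<delta> a \<sigma>)" by blast
      have "x = (\<lambda>\<sigma>. 0 + ?\<delta> (\<lambda>\<sigma>. b \<sigma> + a \<sigma>) \<sigma>)"
        unfolding a(2) b(2) cochain_diff_add by simp
      then show "x \<in> {(\<lambda>\<sigma>. 0 + d \<sigma>) | d. d \<in> ?B}" using cochains_span_add[OF b(1) a(1)] by blast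
    next
      fix x assume "x \<in> {(\<lambda>\<sigma>. 0 + d \<sigma>) | d. d \<in> ?B}"
      then obtain a where a: "a \<in> cochains \<Sigma> vec.span k" "x = (\<lambda>\<sigma>. 0 + ?\<delta> a \<sigma>)" by blast
      have "x = (\<lambda>\<sigma>. c \<sigma> + ?\<delta> (\<lambda>\<sigma>. a \<sigma> - b \<sigma>) \<sigma>)"
        unfolding a(2) b(2) cochain_diff_diff by simp
      then show "x \<in> {(\<lambda>\<sigma>. c \<sigma> + d \<sigma>) | d. d \<in> ?B}" using cochains_span_diff[OF a(1) b(1)] by blast
    qed
  qed
  then have "cohomology ori \<Sigma> vec.span (\<lambda>\<tau> \<sigma> x. x) (Suc k)
      = (\<lambda>_. {(\<lambda>\<sigma>. 0 + d \<sigma>) | d. d \<in> ?B}) ` cocycles ori \<Sigma> vec.span (\<lambda>\<tau> \<sigma> x. x) (Suc k)"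
    unfolding cohomology_def cls by (rule image_cong[OF refl])
  then show ?thesis unfolding cls image_constant[OF zero_cocycle] .
qed

lemma face_fan_facets:
  assumes "fg_cone \<sigma>" "cone_face_of \<rho> \<sigma>"
  shows "{\<tau>. \<tau> \<in> face_fan \<sigma> \<and> cone_facet_of \<tau> \<rho>} = facets \<rho>"
  using facet_face[OF assms] by (auto simp: face_fan_def)

lemma cleanable_cocycle_is_coboundary:
  fixes \<Delta> :: "('k::linordered_field ^ 'n::finite) set"
  assumes fg: "fg_cone (cone_over \<Delta>)" and nonempty: "\<Delta> \<noteq> {}"
    and pyr: "\<forall>P \<in> kfaces 3 \<Delta>. kpyramid P"
    and ori: "\<forall>\<sigma> \<in> face_fan (cone_over \<Delta>). orients (ori \<sigma>) \<sigma>"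
    and cleanable: "(\<forall>v \<in> kvertices \<Delta>. vertex_may_be_cleaned \<Delta> v) \<or> (\<forall>F \<in> kfaces 2 \<Delta>. face_may_be_cleaned \<Delta> F)"
    and c: "c \<in> cocycles ori (face_fan (cone_over \<Delta>)) vec.span (\<lambda>\<tau> \<sigma> x. x) 3"
  shows "\<exists>b\<in>cochains (face_fan (cone_over \<Delta>)) vec.span 2.
    c = cochain_diff ori (face_fan (cone_over \<Delta>)) (\<lambda>\<tau> \<sigma> x. x) 2 b"
proof -
  let ?\<sigma> = "cone_over \<Delta>"
  define eps where "eps = incidence_sign ori"
  have sign: "sign_system ?\<sigma> eps" unfolding eps_def by (rule sign_system_incidence_sign[OF fg ori])
  have cc: "c \<in> cochains (face_fan ?\<sigma>) vec.span 3"
    and dc: "cochain_diff ori (face_fan ?\<sigma>) (\<lambda>\<tau> \<sigma> x. x) 3 c = (\<lambda>_. 0)"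
    using c by (simp_all add: cocycles_def)
  have cval: "if cone_face_of F ?\<sigma> \<and> vec.dim F = 3 then c F \<in> vec.span F else c F = 0" for F
    using cc unfolding cochains_def face_fan_def by simp
  have c_span: "c F \<in> vec.span F" if "cone_face_of F ?\<sigma>" "vec.dim F = 3" for F
    using cval[of F] that by simp
  have c_closed: "(\<Sum>F\<in>facets P. eps F P *s c F) = 0" if "cone_face_of P ?\<sigma>" "vec.dim P = 4" for P
    using fun_cong[OF dc, of P] that face_fan_facets[OF fg that(1)]
    by (simp add: cochain_diff_def face_fan_def eps_def)
  have pyramids: "\<exists>a ht. cone_pyramid P a ht" if P: "cone_face_of P ?\<sigma>" "vec.dim P = 4" for P
  proof -
    have "slice P \<in> kfaces 3 \<Delta>" "cone_over (slice P) = P"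
      using slice_kfaces[OF P(1), of 3] P(2) face_slice(2)[OF P(1)] by simp_all
    then show ?thesis
      using cone_pyramid_cone_over[of "slice P"] pyr fg_cone_face[OF fg P(1)] by simp
  qed
  define A where "A = (\<lambda>P x. (\<forall>F. cone_facet_of F P \<longrightarrow> c F = (\<Sum>r\<in>rays F. x r F *s generator r)) \<and>
    (\<forall>r\<in>rays P. (\<Sum>F\<in>facets_over r P. eps F P * x r F) = 0))"
  \<comment> \<open>One choice of ray coefficients per pyramid. The choices are made independently
    of each other, and cleanness is what makes them agree.\<close>
  define X where "X = (\<lambda>P. SOME x. A P x)"
  have X: "A P (X P)" if P: "cone_face_of P ?\<sigma>" "vec.dim P = 4" for P
  proof -
    obtain a ht where a: "cone_pyramid P a ht" using pyramids[OF P] by blast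
    have fgP: "fg_cone P" by (rule fg_cone_face[OF fg P(1)])
    have "cone_face_of {0} P"
      using fg_cone_zero[OF fgP]
      by (intro face_between[OF cone_over_pointed _ face_subset[OF P(1)]]) simp
    then have "\<exists>x. A P x"
      unfolding A_def
    proof (rule pyramid_ray_coefficients[OF fgP _ sign_system_face[OF sign fg P(1)] P(2) a])
      show "c F \<in> vec.span F" if "cone_facet_of F P" for F
        using c_span[OF facet_face[OF fg P(1) that]] facetD(3)[OF that] P(2) by simp
    qed (rule c_closed[OF P])
    then show ?thesis unfolding X_def by (rule someI_ex)
  qed
  interpret polytope_cocycle \<Delta> eps c X
  proof unfold_locales
    show "c F = (\<Sum>r\<in>rays F. X P r F *s generator r)"
      if "cone_face_of P ?\<sigma>" "vec.dim P = 4" "cone_facet_of F P" for P F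
      using X[OF that(1,2)] that(3) unfolding A_def by blast
    show "(\<Sum>F\<in>facets_over r P. eps F P * X P r F) = 0"
      if "cone_face_of P ?\<sigma>" "vec.dim P = 4" "r \<in> rays P" for P r
      using X[OF that(1,2)] that(3) unfolding A_def by blast
  qed (use fg sign cone_over_pointed pyramids nonempty in auto)
  obtain b where b: "\<And>e. cone_face_of e ?\<sigma> \<Longrightarrow> vec.dim e = 2 \<Longrightarrow> b e \<in> vec.span e"
    "\<And>F. cone_face_of F ?\<sigma> \<Longrightarrow> vec.dim F = 3 \<Longrightarrow> c F = (\<Sum>e\<in>facets F. eps e F *s b e)"
    by (rule coboundary_if_clean[OF c_span clean_if_cleanable[OF cleanable]]) auto
  \<comment> \<open>Cochains have to vanish off the cones of dimension 2, so \<open>b\<close> is cut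
    off there.\<close>
  define b' where "b' = (\<lambda>e. if cone_face_of e ?\<sigma> \<and> vec.dim e = 2 then b e else 0)"
  have "b' \<in> cochains (face_fan ?\<sigma>) vec.span 2"
    using b(1) by (auto simp: cochains_def face_fan_def b'_def)
  moreover have "c F = cochain_diff ori (face_fan ?\<sigma>) (\<lambda>\<tau> \<sigma> x. x) 2 b' F" for F
  proof (cases "cone_face_of F ?\<sigma> \<and> vec.dim F = 3")
    case True
    have "b' e = b e" if "cone_facet_of e F" for e
      using facet_face[OF fg _ that] facetD(3)[OF that] True by (simp add: b'_def)
    then have "(\<Sum>e\<in>facets F. eps e F *s b' e) = c F"
      using b(2)[of F] True by simp
    then show ?thesis
      using True face_fan_facets[OF fg, of F] by (simp add: cochain_diff_def face_fan_def eps_def)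
  next
    case False
    then show ?thesis using cval[of F] by (auto simp: cochain_diff_def face_fan_def)
  qed
  ultimately show ?thesis by blast
qed

theorem mainTheorem2:
  fixes \<iota> :: "'k::linordered_field \<Rightarrow> real"
    and \<Delta> :: "('k ^ 'n::finite) set"
    and ori :: "('k ^ 'n option) set \<Rightarrow> ('k ^ 'n option) list"
  assumes "real_subfield_embedding \<iota>"
    and "kpolytope \<Delta>" and "kdim \<Delta> = CARD('n)"
    and "\<forall>P \<in> kfaces 3 \<Delta>. kpyramid P"
    and "\<forall>\<sigma> \<in> face_fan (cone_over \<Delta>). orients (ori \<sigma>) \<sigma>"
  shows "(((\<forall>v \<in> kvertices \<Delta>. vertex_may_be_cleaned \<Delta> v) \<or>
           (\<forall>F \<in> kfaces 2 \<Delta>. face_may_be_cleaned \<Delta> F))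
           \<longrightarrow> D_space ori 2 \<Delta> = {D_class ori 2 \<Delta> (\<lambda>_. 0)}) \<and>
         (3 \<le> CARD('n) \<longrightarrow>
           ((\<forall>v \<in> kvertices \<Delta>. vertex_may_be_cleaned \<Delta> v) \<longleftrightarrow>
            (\<forall>F \<in> kfaces 2 \<Delta>. face_may_be_cleaned \<Delta> F)))"
proof (intro conjI impI)
  have fg: "fg_cone (cone_over \<Delta>)" by (rule fg_cone_cone_over[OF assms(2)])
  have "\<Delta> \<noteq> {}"
  proof
    assume "\<Delta> = {}"
    then have "kdim \<Delta> = 0" by (simp add: kdim_def)
    then show False using assms(3) by simp
  qed
  note coboundary = cleanable_cocycle_is_coboundary[OF fg this assms(4,5)]
  assume cleanable: "(\<forall>v \<in> kvertices \<Delta>. vertex_may_be_cleaned \<Delta> v) \<or>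
    (\<forall>F \<in> kfaces 2 \<Delta>. face_may_be_cleaned \<Delta> F)"
  \<comment> \<open>\<open>D\<^sup>2\<close> is cohomology of the fan in degree 3, because the cone
    shifts dimensions by one; its coboundaries come from degree 2.\<close>
  have three: "2 + 1 = Suc 2" "3 = Suc 2" by simp_all
  show "D_space ori 2 \<Delta> = {D_class ori 2 \<Delta> (\<lambda>_. 0)}"
    unfolding D_space_def D_class_def three(1)
    by (rule span_cohomology_trivial) (rule coboundary[OF cleanable, unfolded three(2)])
next
  assume "3 \<le> CARD('n)"
  then show "(\<forall>v \<in> kvertices \<Delta>. vertex_may_be_cleaned \<Delta> v) \<longleftrightarrow>
      (\<forall>F \<in> kfaces 2 \<Delta>. face_may_be_cleaned \<Delta> F)"
    using vertices_cleanable_iff_faces_cleanable[OF fg_cone_cone_over[OF assms(2)]] assms(3) by simp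
qed

end
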